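(* Let $\boldsymbol{\mu}$ be an admissible scheduling process and $\mathbf{y}$ an $\mathbb{R}^{n_y}$-valued process. Let $\mathcal{S}=(\{A_i,K_i\}_{i=1}^{n_\mu},C,I_{n_y},\mathbf{v})$ be an asLPV-SSA, and assume that $\mathcal{S}$ is a realization of $(\mathbf{y},\boldsymbol{\mu})$ in innovation form (so $F=I_{n_y}$ and $\mathbf{v}$ is the innovation process $\mathbf{e}$ of $\mathbf{y}$ w.r.t. $\boldsymbol{\mu}$). Assume that $(\mathbf{y},\boldsymbol{\mu})$ is full rank and that $\mathbf{y}$ is SII w.r.t. $\boldsymbol{\mu}$. If the dLPV-SSA $\mathcal{D}_{\mathcal{S}}=(\{A_i,K_i\}_{i=1}^{n_\mu},C,I_{n_y})$ is minimal and $\mathcal{S}$ is stably invertable w.r.t. $\boldsymbol{\mu}$, i.e. all eigenvalues of $\sum_{i=1}^{n_\mu} p_i (A_i-K_iC)\otimes(A_i-K_iC)$ are inside the complex unit disk, then $\mathcal{S}$ is a minimal asLPV-SSA realization of $(\mathbf{y},\boldsymbol{\mu})$ in innovation form.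
   Context: All random variables live on a fixed probability space; all processes are discrete-time with time axis $\mathbb{Z}$. Words. $\Sigma=\{1,\dots,n_\mu\}$; $\Sigma^+$ is the set of nonempty finite words over $\Sigma$, $\epsilon$ is the empty word, $\Sigma^*=\Sigma^+\cup\{\epsilon\}$, $|w|$ is the length of $w$, and $vw$ denotes concatenation. Scheduling products. $\boldsymbol{\mu}=[\boldsymbol{\mu}_1,\dots,\boldsymbol{\mu}_{n_\mu}]^T$ is a real vector-valued process. For $w=\sigma_1\cdots\sigma_k\in\Sigma^+$, $\boldsymbol{\mu}_w(t)=\boldsymbol{\mu}_{\sigma_1}(t-k+1)\boldsymbol{\mu}_{\sigma_2}(t-k+2)\cdots\boldsymbol{\mu}_{\sigma_k}(t)$, and $\boldsymbol{\mu}_\epsilon(t)=1$. Admissible scheduling. $\boldsymbol{\mu}$ is admissible if: (i) with $\mathscr{F}_t^{\boldsymbol{\mu},-}$ the $\sigma$-algebra generated by $\{\boldsymbol{\mu}(k)\}_{k<t}$, there are positive numbers $\{p_\sigma\}_{\sigma\in\Sigma}$ such that for all $w,v\in\Sigma^+$, $\sigma,\sigma'\in\Sigma$, $t\in\mathbb{Z}$: $E[\boldsymbol{\mu}_{w\sigma}(t)\boldsymbol{\mu}_{v\sigma'}(t)\mid\mathscr{F}_t^{\boldsymbol{\mu},-}]$ equals $p_\sigma\boldsymbol{\mu}_w(t-1)\boldsymbol{\mu}_v(t-1)$ if $\sigma=\sigma'$ and $0$ otherwise; $E[\boldsymbol{\mu}_{w\sigma}(t)\boldsymbol{\mu}_{\sigma'}(t)\mid\mathscr{F}_t^{\boldsymbol{\mu},-}]$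 equals $p_\sigma\boldsymbol{\mu}_w(t-1)$ if $\sigma=\sigma'$ and $0$ otherwise; $E[\boldsymbol{\mu}_\sigma(t)\boldsymbol{\mu}_{\sigma'}(t)\mid\mathscr{F}_t^{\boldsymbol{\mu},-}]=0$ if $\sigma\neq\sigma'$; (ii) there are real numbers $\{\alpha_\sigma\}_{\sigma\in\Sigma}$ with $\sum_{\sigma\in\Sigma}\alpha_\sigma\boldsymbol{\mu}_\sigma(t)=1$ for all $t$; (iii) for all $w,v\in\Sigma^+$ the process $[\boldsymbol{\mu}_w,\boldsymbol{\mu}_v]^T$ is wide-sense stationary. The scheduling process is assumed admissible throughout; it determines $\{p_\sigma\}$. Put $p_w=p_{\sigma_1}\cdots p_{\sigma_k}$ for $w=\sigma_1\cdots\sigma_k$, $p_\epsilon=1$. For a process $\mathbf{r}$ and $w\in\Sigma^*$, $\mathbf{z}^{\mathbf{r}}_w(t)=\mathbf{r}(t-|w|)\,\boldsymbol{\mu}_w(t-1)\frac{1}{\sqrt{p_w}}$ (so $\mathbf{z}^{\mathbf r}_\epsilon=\mathbf{r}$). ZMWSII. $\mathbf{r}$ is ZMWSII w.r.t. $\boldsymbol{\mu}$ if (1) for all $t$, the $\sigma$-algebras generated by $\{\mathbf{r}(k)\}_{k\le t}$ and by $\{\boldsymbol{\mu}_\sigma(k)\}_{k\ge t,\sigma\in\Sigma}$ are conditionally independent given the one generated by $\{\boldsymbol{\mu}_\sigma(k)\}_{k<t,\sigma\in\Sigma}$; (2) $\mathbf{r}$ and $\mathbf{z}^{\mathbf{r}}_w$,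 $w\in\Sigma^+$, are zero mean, square integrable and jointly wide-sense stationary: for all $t,s,k\in\mathbb{Z}$, $w,v\in\Sigma^+$, the expectations $E[\mathbf{r}(t+k)(\mathbf{z}^{\mathbf r}_w(s+k))^T]$, $E[\mathbf{r}(t+k)(\mathbf{r}(s+k))^T]$, $E[\mathbf{z}^{\mathbf r}_w(t+k)(\mathbf{z}^{\mathbf r}_v(s+k))^T]$ do not depend on $k$. SII. $\mathbf{r}$ is SII w.r.t. $\boldsymbol{\mu}$ if for all $w\in\Sigma^*$, $t\in\mathbb{Z}$ the random variable $\mathbf{r}(t+|w|)\boldsymbol{\mu}_w(t+|w|-1)\frac{1}{\sqrt{p_w}}$ is square integrable. asLPV-SSA. A stationary autonomous stochastic LPV-SSA (asLPV-SSA; LPV-SSA stands for linear parameter-varying state-space representation with affine dependence on the scheduling), written $\mathcal{S}=(\{A_\sigma,K_\sigma\}_{\sigma=1}^{n_\mu},C,F,\mathbf{v})$, is a system $\mathbf{x}(t+1)=\sum_{i=1}^{n_\mu}(A_i\mathbf{x}(t)+K_i\mathbf{v}(t))\boldsymbol{\mu}_i(t)$, $\mathbf{y}(t)=C\mathbf{x}(t)+F\mathbf{v}(t)$, $t\in\mathbb{Z}$, with $A_\sigma\in\mathbb{R}^{n_x\times n_x}$, $K_\sigma\in\mathbb{R}^{n_x\times m}$, $C\in\mathbb{R}^{n_y\times n_x}$, $F\in\mathbb{R}^{n_y\times m}$, state process $\mathbf{x}$, noise process $\mathbf{v}$, output process $\mathbf{y}$, such that (1) $[\mathbf{x}^T,\mathbf{v}^T]^T$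 is ZMWSII w.r.t. $\boldsymbol\mu$ and $E[\mathbf{z}^{\mathbf x}_\sigma(t)(\mathbf{z}^{\mathbf v}_\sigma(t))^T]=0$, $E[\mathbf{v}(t)(\mathbf{z}^{\mathbf x}_w(t))^T]=0$ for all $\sigma\in\Sigma$, $w\in\Sigma^+$; (2) $\mathbf{v}$ is ZMWSII w.r.t. $\boldsymbol\mu$ and $E[\mathbf{v}(t)(\mathbf{z}^{\mathbf v}_w(t))^T]=0$ for all $w\in\Sigma^+$; (3) all eigenvalues of $\sum_{\sigma\in\Sigma}p_\sigma A_\sigma\otimes A_\sigma$ are inside the open unit disk. $\mathcal{S}$ is a realization of $(\tilde{\mathbf y},\tilde{\boldsymbol\mu})$ if its output and scheduling processes equal $\tilde{\mathbf y}$ and $\tilde{\boldsymbol\mu}$. The dimension of $\mathcal{S}$ is $n_x$; a realization of $(\mathbf{y},\boldsymbol\mu)$ is minimal if no asLPV-SSA realization of $(\mathbf{y},\boldsymbol\mu)$ has smaller dimension. Innovation. $\mathbf{e}(t)=\mathbf{y}(t)-E_l[\mathbf{y}(t)\mid\{\mathbf{z}^{\mathbf y}_w(t)\}_{w\in\Sigma^+}]$, where $E_l[\mathbf{z}\mid\mathfrak{S}]$ is the componentwise orthogonal projection, in the Hilbert space of real square-integrable random variables with inner product $E[\mathbf{z}_1\mathbf{z}_2]$, onto the smallest closed subspace containing all coordinates of the elements of $\mathfrak{S}$. An asLPV-SSA is in innovation form if it is a realization of $(\mathbf{y},\boldsymbol\mu)$, $F=I_{n_y}$ and $\mathbf{v}=\mathbf{e}$.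 $(\mathbf{y},\boldsymbol\mu)$ is full rank if $Q_i=E[\mathbf{e}(t)(\mathbf{e}(t))^T\boldsymbol{\mu}_i^2(t)]$ is invertible for all $i=1,\dots,n_\mu$. Deterministic systems. A dLPV-SSA $\mathscr{S}=(\{\mathcal{A}_i,\mathcal{B}_i\}_{i=1}^{n_\mu},\mathcal{C},\mathcal{D})$ is a deterministic system $\mathrm{x}(t+1)=\sum_{i=1}^{n_\mu}(\mathcal{A}_i\mathrm{x}(t)+\mathcal{B}_i\mathrm{u}(t))\mu_i(t)$, $\mathrm{y}(t)=\mathcal{C}\mathrm{x}(t)+\mathcal{D}\mathrm{u}(t)$, with state, input, output and scheduling trajectories $\mathrm{x},\mathrm{u},\mathrm{y},\mu$; its dimension is the dimension of its state-space. Its sub-Markov function $M_{\mathscr S}$ on $\Sigma^*$ is $M_{\mathscr S}(\epsilon)=\mathcal{D}$, $M_{\mathscr S}(\sigma s)=\mathcal{C}\mathcal{A}_s\mathcal{B}_\sigma$ for $\sigma\in\Sigma$, $s\in\Sigma^*$, where $\mathcal{A}_s=\mathcal{A}_{\sigma_k}\mathcal{A}_{\sigma_{k-1}}\cdots\mathcal{A}_{\sigma_1}$ for $s=\sigma_1\cdots\sigma_k$ and $\mathcal{A}_\epsilon=I$. A dLPV-SSA is minimal if no dLPV-SSA with the same sub-Markov function has smaller dimension. *)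

theory Defs
  imports
    "HOL-Probability.Probability"
    "Jordan_Normal_Form.Char_Poly"
begin

hide_type (open) Finite_Cartesian_Product.vec
hide_const (open) Finite_Cartesian_Product.vec Finite_Cartesian_Product.mat
unbundle no vec_syntax

text \<open>
  State and noise dimensions are quantified over in the notion of minimality, so vectors and
  matrices are those of Jordan_Normal_Form, with dimensions as explicit natural numbers (zero
  allowed). Identities between random variables are understood almost surely.
\<close>

type_synonym 'a vproc = "int \<Rightarrow> 'a \<Rightarrow> real vec"
type_synonym 'a sched = "nat \<Rightarrow> int \<Rightarrow> 'a \<Rightarrow> real"


subsection \<open>Random vectors and generated sigma-algebras\<close>

definition random_vec :: "'a measure \<Rightarrow> nat \<Rightarrow> ('a \<Rightarrow> real vec) \<Rightarrow> bool" where
  "random_vec M n X \<longleftrightarrow>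
     (\<forall>\<omega>\<in>space M. X \<omega> \<in> carrier_vec n) \<and>
     (\<forall>i<n. (\<lambda>\<omega>. X \<omega> $ i) \<in> borel_measurable M)"

definition vector_process :: "'a measure \<Rightarrow> nat \<Rightarrow> 'a vproc \<Rightarrow> bool" where
  "vector_process M n r \<longleftrightarrow> (\<forall>t. random_vec M n (r t))"

definition L2 :: "'a measure \<Rightarrow> ('a \<Rightarrow> real) set" where
  "L2 M = {X. X \<in> borel_measurable M \<and> integrable M (\<lambda>\<omega>. (X \<omega>)\<^sup>2)}"

definition square_integrable_vec :: "'a measure \<Rightarrow> nat \<Rightarrow> ('a \<Rightarrow> real vec) \<Rightarrow> bool" where
  "square_integrable_vec M n X \<longleftrightarrow> random_vec M n X \<and> (\<forall>i<n. (\<lambda>\<omega>. X \<omega> $ i) \<in> L2 M)"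

definition mean_vec :: "'a measure \<Rightarrow> nat \<Rightarrow> ('a \<Rightarrow> real vec) \<Rightarrow> real vec" where
  "mean_vec M n X = vec n (\<lambda>i. \<integral>\<omega>. X \<omega> $ i \<partial>M)"

text \<open>The \<open>n \<times> m\<close> matrix \<open>E[X Y\<^sup>T]\<close>.\<close>

definition corr_mat ::
  "'a measure \<Rightarrow> nat \<Rightarrow> nat \<Rightarrow> ('a \<Rightarrow> real vec) \<Rightarrow> ('a \<Rightarrow> real vec) \<Rightarrow> real mat" where
  "corr_mat M n m X Y = mat n m (\<lambda>(i, j). \<integral>\<omega>. X \<omega> $ i * Y \<omega> $ j \<partial>M)"

definition wide_sense_stationary :: "'a measure \<Rightarrow> nat \<Rightarrow> 'a vproc \<Rightarrow> bool" where
  "wide_sense_stationary M n r \<longleftrightarrow>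
     (\<forall>t. square_integrable_vec M n (r t)) \<and>
     (\<forall>t s. mean_vec M n (r t) = mean_vec M n (r s)) \<and>
     (\<forall>t s k. corr_mat M n n (r (t + k)) (r (s + k)) = corr_mat M n n (r t) (r s))"

text \<open>Written with \<^const>\<open>sigma\<close> so that an empty family generates the trivial sigma-algebra on
  the space of \<open>M\<close>.\<close>

definition gen_sigma :: "'a measure \<Rightarrow> ('a \<Rightarrow> real) set \<Rightarrow> 'a measure" where
  "gen_sigma M \<X> = sigma (space M) {X -` B \<inter> space M | X B. X \<in> \<X> \<and> B \<in> sets borel}"

definition cond_indep :: "'a measure \<Rightarrow> 'a measure \<Rightarrow> 'a measure \<Rightarrow> 'a measure \<Rightarrow> bool" where
  "cond_indep M F G H \<longleftrightarrow>
     (\<forall>A\<in>sets F. \<forall>B\<in>sets G. AE \<omega> in M.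
        real_cond_exp M H (indicator (A \<inter> B)) \<omega> =
        real_cond_exp M H (indicator A) \<omega> * real_cond_exp M H (indicator B) \<omega>)"


subsection \<open>Orthogonal projection in the space of square-integrable random variables\<close>

definition L2_closed_subspace :: "'a measure \<Rightarrow> ('a \<Rightarrow> real) set \<Rightarrow> bool" where
  "L2_closed_subspace M H \<longleftrightarrow>
     H \<subseteq> L2 M \<and> (\<lambda>_. 0) \<in> H \<and>
     (\<forall>X\<in>H. \<forall>Y\<in>H. (\<lambda>\<omega>. X \<omega> + Y \<omega>) \<in> H) \<and>
     (\<forall>c. \<forall>X\<in>H. (\<lambda>\<omega>. c * X \<omega>) \<in> H) \<and>
     (\<forall>f X. (\<forall>k::nat. f k \<in> H) \<and> X \<in> L2 M \<and>
        (\<lambda>k. \<integral>\<omega>. (f k \<omega> - X \<omega>)\<^sup>2 \<partial>M) \<longlonglongrightarrow> 0 \<longrightarrow> X \<in> H)"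

text \<open>\<open>is_lin_proj M S X P\<close>: \<open>P\<close> is a version of \<open>E\<^sub>l[X | S]\<close>. The last closure
  condition above makes closed subspaces stable under almost sure equality, so \<open>P\<close> is determined
  exactly up to almost sure equality.\<close>

definition is_lin_proj ::
  "'a measure \<Rightarrow> ('a \<Rightarrow> real) set \<Rightarrow> ('a \<Rightarrow> real) \<Rightarrow> ('a \<Rightarrow> real) \<Rightarrow> bool" where
  "is_lin_proj M S X P \<longleftrightarrow>
     X \<in> L2 M \<and> S \<subseteq> L2 M \<and> P \<in> L2_closed_subspace M hull S \<and>
     (\<forall>Y \<in> L2_closed_subspace M hull S. (\<integral>\<omega>. (X \<omega> - P \<omega>) * Y \<omega> \<partial>M) = 0)"


subsection \<open>Words and scheduling processes\<close>

definition words :: "nat \<Rightarrow> nat list set" where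
  "words n\<^sub>\<mu> = lists {1..n\<^sub>\<mu>}"

definition nonempty_words :: "nat \<Rightarrow> nat list set" where
  "nonempty_words n\<^sub>\<mu> = words n\<^sub>\<mu> - {[]}"

definition sched_word :: "'a sched \<Rightarrow> nat list \<Rightarrow> int \<Rightarrow> 'a \<Rightarrow> real" where
  "sched_word \<mu> w t \<omega> = (\<Prod>i<length w. \<mu> (w ! i) (t - int (length w) + 1 + int i) \<omega>)"

definition word_weight :: "(nat \<Rightarrow> real) \<Rightarrow> nat list \<Rightarrow> real" where
  "word_weight p w = prod_list (map p w)"

definition sched_past :: "'a measure \<Rightarrow> nat \<Rightarrow> 'a sched \<Rightarrow> int \<Rightarrow> 'a measure" where
  "sched_past M n\<^sub>\<mu> \<mu> t = gen_sigma M {\<mu> \<sigma> k | \<sigma> k. \<sigma> \<in> {1..n\<^sub>\<mu>} \<and> k < t}"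

definition sched_future :: "'a measure \<Rightarrow> nat \<Rightarrow> 'a sched \<Rightarrow> int \<Rightarrow> 'a measure" where
  "sched_future M n\<^sub>\<mu> \<mu> t = gen_sigma M {\<mu> \<sigma> k | \<sigma> k. \<sigma> \<in> {1..n\<^sub>\<mu>} \<and> k \<ge> t}"

text \<open>\<open>\<mu>\<close> is admissible with the numbers \<open>p\<^sub>\<sigma>\<close>. These are determined by \<open>\<mu>\<close>; they are carried
  as an argument because all later notions refer to them.\<close>

definition admissible_scheduling ::
  "'a measure \<Rightarrow> nat \<Rightarrow> 'a sched \<Rightarrow> (nat \<Rightarrow> real) \<Rightarrow> bool" where
  "admissible_scheduling M n\<^sub>\<mu> \<mu> p \<longleftrightarrow>
     (\<forall>\<sigma>\<in>{1..n\<^sub>\<mu>}. \<forall>t. \<mu> \<sigma> t \<in> borel_measurable M) \<and>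
     (\<forall>\<sigma>\<in>{1..n\<^sub>\<mu>}. p \<sigma> > 0) \<and>
     (\<forall>w\<in>nonempty_words n\<^sub>\<mu>. \<forall>v\<in>nonempty_words n\<^sub>\<mu>. \<forall>\<sigma>\<in>{1..n\<^sub>\<mu>}. \<forall>\<sigma>'\<in>{1..n\<^sub>\<mu>}. \<forall>t.
        AE \<omega> in M.
          real_cond_exp M (sched_past M n\<^sub>\<mu> \<mu> t)
            (\<lambda>\<omega>. sched_word \<mu> (w @ [\<sigma>]) t \<omega> * sched_word \<mu> (v @ [\<sigma>']) t \<omega>) \<omega> =
          (if \<sigma> = \<sigma>' then p \<sigma> * sched_word \<mu> w (t - 1) \<omega> * sched_word \<mu> v (t - 1) \<omega> else 0)) \<and>
     (\<forall>w\<in>nonempty_words n\<^sub>\<mu>. \<forall>\<sigma>\<in>{1..n\<^sub>\<mu>}. \<forall>\<sigma>'\<in>{1..n\<^sub>\<mu>}. \<forall>t.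
        AE \<omega> in M.
          real_cond_exp M (sched_past M n\<^sub>\<mu> \<mu> t)
            (\<lambda>\<omega>. sched_word \<mu> (w @ [\<sigma>]) t \<omega> * \<mu> \<sigma>' t \<omega>) \<omega> =
          (if \<sigma> = \<sigma>' then p \<sigma> * sched_word \<mu> w (t - 1) \<omega> else 0)) \<and>
     (\<forall>\<sigma>\<in>{1..n\<^sub>\<mu>}. \<forall>\<sigma>'\<in>{1..n\<^sub>\<mu>}. \<forall>t. \<sigma> \<noteq> \<sigma>' \<longrightarrow>
        (AE \<omega> in M. real_cond_exp M (sched_past M n\<^sub>\<mu> \<mu> t) (\<lambda>\<omega>. \<mu> \<sigma> t \<omega> * \<mu> \<sigma>' t \<omega>) \<omega> = 0)) \<and>
     (\<exists>\<alpha>. \<forall>t. AE \<omega> in M. (\<Sum>\<sigma>\<in>{1..n\<^sub>\<mu>}. \<alpha> \<sigma> * \<mu> \<sigma> t \<omega>) = 1) \<and>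
     (\<forall>w\<in>nonempty_words n\<^sub>\<mu>. \<forall>v\<in>nonempty_words n\<^sub>\<mu>.
        wide_sense_stationary M 2 (\<lambda>t \<omega>. vec_of_list [sched_word \<mu> w t \<omega>, sched_word \<mu> v t \<omega>]))"

definition zproc ::
  "'a sched \<Rightarrow> (nat \<Rightarrow> real) \<Rightarrow> 'a vproc \<Rightarrow> nat list \<Rightarrow> 'a vproc" where
  "zproc \<mu> p r w t \<omega> =
     (sched_word \<mu> w (t - 1) \<omega> * (1 / sqrt (word_weight p w))) \<cdot>\<^sub>v r (t - int (length w)) \<omega>"

definition ZMWSII ::
  "'a measure \<Rightarrow> nat \<Rightarrow> 'a sched \<Rightarrow> (nat \<Rightarrow> real) \<Rightarrow> nat \<Rightarrow> 'a vproc \<Rightarrow> bool" where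
  "ZMWSII M n\<^sub>\<mu> \<mu> p n r \<longleftrightarrow>
     vector_process M n r \<and>
     (\<forall>t. cond_indep M (gen_sigma M {(\<lambda>\<omega>. r k \<omega> $ i) | k i. k \<le> t \<and> i < n})
            (sched_future M n\<^sub>\<mu> \<mu> t) (sched_past M n\<^sub>\<mu> \<mu> t)) \<and>
     (\<forall>t. mean_vec M n (r t) = 0\<^sub>v n \<and> square_integrable_vec M n (r t)) \<and>
     (\<forall>w\<in>nonempty_words n\<^sub>\<mu>. \<forall>t.
        mean_vec M n (zproc \<mu> p r w t) = 0\<^sub>v n \<and> square_integrable_vec M n (zproc \<mu> p r w t)) \<and>
     (\<forall>w\<in>nonempty_words n\<^sub>\<mu>. \<forall>t s k.
        corr_mat M n n (r (t + k)) (zproc \<mu> p r w (s + k)) =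
        corr_mat M n n (r t) (zproc \<mu> p r w s)) \<and>
     (\<forall>t s k. corr_mat M n n (r (t + k)) (r (s + k)) = corr_mat M n n (r t) (r s)) \<and>
     (\<forall>w\<in>nonempty_words n\<^sub>\<mu>. \<forall>v\<in>nonempty_words n\<^sub>\<mu>. \<forall>t s k.
        corr_mat M n n (zproc \<mu> p r w (t + k)) (zproc \<mu> p r v (s + k)) =
        corr_mat M n n (zproc \<mu> p r w t) (zproc \<mu> p r v s))"

definition SII ::
  "'a measure \<Rightarrow> nat \<Rightarrow> 'a sched \<Rightarrow> (nat \<Rightarrow> real) \<Rightarrow> nat \<Rightarrow> 'a vproc \<Rightarrow> bool" where
  "SII M n\<^sub>\<mu> \<mu> p n r \<longleftrightarrow>
     (\<forall>w\<in>words n\<^sub>\<mu>. \<forall>t. square_integrable_vec M n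
        (\<lambda>\<omega>. (sched_word \<mu> w (t + int (length w) - 1) \<omega> * (1 / sqrt (word_weight p w)))
                \<cdot>\<^sub>v r (t + int (length w)) \<omega>))"


subsection \<open>Stability\<close>

definition kronecker :: "'b::semiring_0 mat \<Rightarrow> 'b mat \<Rightarrow> 'b mat" where
  "kronecker A B = mat (dim_row A * dim_row B) (dim_col A * dim_col B)
     (\<lambda>(i, j). A $$ (i div dim_row B, j div dim_col B) * B $$ (i mod dim_row B, j mod dim_col B))"

text \<open>The matrix \<open>\<Sum>\<^sub>\<sigma> p\<^sub>\<sigma> A\<^sub>\<sigma> \<otimes> A\<^sub>\<sigma>\<close> for \<open>n \<times> n\<close> matrices \<open>A\<^sub>\<sigma>\<close>.\<close>

definition kron_sum :: "nat \<Rightarrow> (nat \<Rightarrow> real) \<Rightarrow> nat \<Rightarrow> (nat \<Rightarrow> real mat) \<Rightarrow> real mat" where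
  "kron_sum n\<^sub>\<mu> p n A =
     mat (n * n) (n * n) (\<lambda>(i, j). \<Sum>\<sigma>\<in>{1..n\<^sub>\<mu>}. p \<sigma> * kronecker (A \<sigma>) (A \<sigma>) $$ (i, j))"

definition eigenvalues_in_unit_disk :: "real mat \<Rightarrow> bool" where
  "eigenvalues_in_unit_disk B \<longleftrightarrow>
     (\<forall>z. eigenvalue (map_mat complex_of_real B) z \<longrightarrow> cmod z < 1)"

definition stably_invertible ::
  "nat \<Rightarrow> (nat \<Rightarrow> real) \<Rightarrow> nat \<Rightarrow> (nat \<Rightarrow> real mat) \<Rightarrow> (nat \<Rightarrow> real mat) \<Rightarrow> real mat \<Rightarrow> bool" where
  "stably_invertible n\<^sub>\<mu> p n A K C \<longleftrightarrow>
     eigenvalues_in_unit_disk (kron_sum n\<^sub>\<mu> p n (\<lambda>\<sigma>. A \<sigma> - K \<sigma> * C))"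


subsection \<open>State-space representations\<close>

text \<open>State dimension \<open>n\<close>, input or noise dimension \<open>m\<close>, output dimension \<open>q\<close>.\<close>

definition lpv_matrices ::
  "nat \<Rightarrow> nat \<Rightarrow> nat \<Rightarrow> nat \<Rightarrow> (nat \<Rightarrow> real mat) \<Rightarrow> (nat \<Rightarrow> real mat) \<Rightarrow> real mat \<Rightarrow> real mat \<Rightarrow> bool"
where
  "lpv_matrices n\<^sub>\<mu> n m q A B C D \<longleftrightarrow>
     (\<forall>\<sigma>\<in>{1..n\<^sub>\<mu>}. A \<sigma> \<in> carrier_mat n n \<and> B \<sigma> \<in> carrier_mat n m) \<and>
     C \<in> carrier_mat q n \<and> D \<in> carrier_mat q m"

fun word_mat :: "nat \<Rightarrow> (nat \<Rightarrow> real mat) \<Rightarrow> nat list \<Rightarrow> real mat" where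
  "word_mat n A [] = 1\<^sub>m n"
| "word_mat n A (\<sigma> # s) = word_mat n A s * A \<sigma>"

fun sub_markov ::
  "nat \<Rightarrow> (nat \<Rightarrow> real mat) \<Rightarrow> (nat \<Rightarrow> real mat) \<Rightarrow> real mat \<Rightarrow> real mat \<Rightarrow> nat list \<Rightarrow> real mat"
where
  "sub_markov n A B C D [] = D"
| "sub_markov n A B C D (\<sigma> # s) = C * word_mat n A s * B \<sigma>"

text \<open>A dLPV-SSA is given by its matrices.\<close>

definition dLPV_minimal ::
  "nat \<Rightarrow> nat \<Rightarrow> nat \<Rightarrow> nat \<Rightarrow> (nat \<Rightarrow> real mat) \<Rightarrow> (nat \<Rightarrow> real mat) \<Rightarrow> real mat \<Rightarrow> real mat \<Rightarrow> bool"
where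
  "dLPV_minimal n\<^sub>\<mu> n m q A B C D \<longleftrightarrow>
     lpv_matrices n\<^sub>\<mu> n m q A B C D \<and>
     \<not> (\<exists>n' A' B' C' D'. lpv_matrices n\<^sub>\<mu> n' m q A' B' C' D' \<and>
          (\<forall>w\<in>words n\<^sub>\<mu>. sub_markov n' A' B' C' D' w = sub_markov n A B C D w) \<and> n' < n)"

definition asLPV_SSA ::
  "'a measure \<Rightarrow> nat \<Rightarrow> 'a sched \<Rightarrow> (nat \<Rightarrow> real) \<Rightarrow> nat \<Rightarrow> nat \<Rightarrow> nat \<Rightarrow>
   (nat \<Rightarrow> real mat) \<Rightarrow> (nat \<Rightarrow> real mat) \<Rightarrow> real mat \<Rightarrow> real mat \<Rightarrow>
   'a vproc \<Rightarrow> 'a vproc \<Rightarrow> 'a vproc \<Rightarrow> bool" where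
  "asLPV_SSA M n\<^sub>\<mu> \<mu> p n m q A K C F x v y \<longleftrightarrow>
     lpv_matrices n\<^sub>\<mu> n m q A K C F \<and>
     vector_process M n x \<and> vector_process M m v \<and> vector_process M q y \<and>
     (\<forall>t. AE \<omega> in M. x (t + 1) \<omega> =
        vec n (\<lambda>j. \<Sum>i\<in>{1..n\<^sub>\<mu>}. (A i *\<^sub>v x t \<omega> + K i *\<^sub>v v t \<omega>) $ j * \<mu> i t \<omega>)) \<and>
     (\<forall>t. AE \<omega> in M. y t \<omega> = C *\<^sub>v x t \<omega> + F *\<^sub>v v t \<omega>) \<and>
     ZMWSII M n\<^sub>\<mu> \<mu> p (n + m) (\<lambda>t \<omega>. x t \<omega> @\<^sub>v v t \<omega>) \<and>
     (\<forall>\<sigma>\<in>{1..n\<^sub>\<mu>}. \<forall>t. corr_mat M n m (zproc \<mu> p x [\<sigma>] t) (zproc \<mu> p v [\<sigma>] t) = 0\<^sub>m n m) \<and>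
     (\<forall>w\<in>nonempty_words n\<^sub>\<mu>. \<forall>t. corr_mat M m n (v t) (zproc \<mu> p x w t) = 0\<^sub>m m n) \<and>
     ZMWSII M n\<^sub>\<mu> \<mu> p m v \<and>
     (\<forall>w\<in>nonempty_words n\<^sub>\<mu>. \<forall>t. corr_mat M m m (v t) (zproc \<mu> p v w t) = 0\<^sub>m m m) \<and>
     eigenvalues_in_unit_disk (kron_sum n\<^sub>\<mu> p n A)"

text \<open>The state process is not part of the data of an asLPV-SSA (it is determined by the matrices,
  the noise and the scheduling), hence the existential quantifier.\<close>

definition asLPV_realization ::
  "'a measure \<Rightarrow> nat \<Rightarrow> 'a sched \<Rightarrow> (nat \<Rightarrow> real) \<Rightarrow> nat \<Rightarrow> 'a vproc \<Rightarrow> nat \<Rightarrow> nat \<Rightarrow>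
   (nat \<Rightarrow> real mat) \<Rightarrow> (nat \<Rightarrow> real mat) \<Rightarrow> real mat \<Rightarrow> real mat \<Rightarrow> 'a vproc \<Rightarrow> bool" where
  "asLPV_realization M n\<^sub>\<mu> \<mu> p q y n m A K C F v \<longleftrightarrow>
     (\<exists>x. asLPV_SSA M n\<^sub>\<mu> \<mu> p n m q A K C F x v y)"

definition minimal_asLPV_realization ::
  "'a measure \<Rightarrow> nat \<Rightarrow> 'a sched \<Rightarrow> (nat \<Rightarrow> real) \<Rightarrow> nat \<Rightarrow> 'a vproc \<Rightarrow> nat \<Rightarrow> nat \<Rightarrow>
   (nat \<Rightarrow> real mat) \<Rightarrow> (nat \<Rightarrow> real mat) \<Rightarrow> real mat \<Rightarrow> real mat \<Rightarrow> 'a vproc \<Rightarrow> bool" where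
  "minimal_asLPV_realization M n\<^sub>\<mu> \<mu> p q y n m A K C F v \<longleftrightarrow>
     asLPV_realization M n\<^sub>\<mu> \<mu> p q y n m A K C F v \<and>
     \<not> (\<exists>n' m' A' K' C' F' v'. asLPV_realization M n\<^sub>\<mu> \<mu> p q y n' m' A' K' C' F' v' \<and> n' < n)"


subsection \<open>Innovation process\<close>

definition output_past ::
  "nat \<Rightarrow> 'a sched \<Rightarrow> (nat \<Rightarrow> real) \<Rightarrow> nat \<Rightarrow> 'a vproc \<Rightarrow> int \<Rightarrow> ('a \<Rightarrow> real) set" where
  "output_past n\<^sub>\<mu> \<mu> p q y t =
     {(\<lambda>\<omega>. zproc \<mu> p y w t \<omega> $ j) | w j. w \<in> nonempty_words n\<^sub>\<mu> \<and> j < q}"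

text \<open>\<open>e\<close> is a version of the innovation process of \<open>y\<close>, which is defined only up to almost sure
  equality.\<close>

definition innovation_process ::
  "'a measure \<Rightarrow> nat \<Rightarrow> 'a sched \<Rightarrow> (nat \<Rightarrow> real) \<Rightarrow> nat \<Rightarrow> 'a vproc \<Rightarrow> 'a vproc \<Rightarrow> bool" where
  "innovation_process M n\<^sub>\<mu> \<mu> p q y e \<longleftrightarrow>
     vector_process M q e \<and>
     (\<forall>t. \<forall>i<q. \<exists>P. is_lin_proj M (output_past n\<^sub>\<mu> \<mu> p q y t) (\<lambda>\<omega>. y t \<omega> $ i) P \<and>
        (AE \<omega> in M. e t \<omega> $ i = y t \<omega> $ i - P \<omega>))"

definition innovation_form ::
  "'a measure \<Rightarrow> nat \<Rightarrow> 'a sched \<Rightarrow> (nat \<Rightarrow> real) \<Rightarrow> nat \<Rightarrow> 'a vproc \<Rightarrow> nat \<Rightarrow> nat \<Rightarrow>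
   (nat \<Rightarrow> real mat) \<Rightarrow> (nat \<Rightarrow> real mat) \<Rightarrow> real mat \<Rightarrow> real mat \<Rightarrow> 'a vproc \<Rightarrow> bool" where
  "innovation_form M n\<^sub>\<mu> \<mu> p q y n m A K C F v \<longleftrightarrow>
     asLPV_realization M n\<^sub>\<mu> \<mu> p q y n m A K C F v \<and>
     m = q \<and> F = 1\<^sub>m q \<and> innovation_process M n\<^sub>\<mu> \<mu> p q y v"

definition full_rank ::
  "'a measure \<Rightarrow> nat \<Rightarrow> 'a sched \<Rightarrow> (nat \<Rightarrow> real) \<Rightarrow> nat \<Rightarrow> 'a vproc \<Rightarrow> bool" where
  "full_rank M n\<^sub>\<mu> \<mu> p q y \<longleftrightarrow>
     (\<exists>e. innovation_process M n\<^sub>\<mu> \<mu> p q y e \<and>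
       (\<forall>i\<in>{1..n\<^sub>\<mu>}. \<forall>t. invertible_mat
          (mat q q (\<lambda>(a, b). \<integral>\<omega>. e t \<omega> $ a * e t \<omega> $ b * (\<mu> i t \<omega>)\<^sup>2 \<partial>M))))"

end

theory Submission
  imports Defs
begin

text \<open>
  Suppose another realization, with state \<open>x'\<close>, noise \<open>v'\<close> and matrices \<open>A', K', C', F'\<close>, generates
  the same output \<open>y\<close>. Let \<open>e\<close> be the innovation of \<open>y\<close> and consider the correlations of \<open>y\<close> with
  its own lagged innovation, weighted by a word of scheduling variables:
  \<open>E[y(t) (e(\<tau>) \<mu>\<^sub>w(t - 1))\<^sup>T]\<close> with \<open>t = \<tau> + |w|\<close>. They depend on \<open>y\<close> and \<open>\<mu>\<close> only, and can be
  computed from either realization.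

  Two facts make the computation possible. First, at each instant the scheduling variables behave
  like an orthogonal family that is independent of the past: \<open>E[\<mu>\<^sub>\<sigma>(t) \<mu>\<^sub>\<rho>(t) | past] = \<delta> p\<^sub>\<sigma>\<close>, where the
  past comprises \<open>x'(k), v'(k)\<close> for \<open>k \<le> t\<close> and \<open>\<mu>(k)\<close> for \<open>k < t\<close>
  (\<open>ZMWSII_sched_orthogonal\<close>). So multiplication by \<open>\<mu>\<^sub>\<sigma>(t)\<close> maps square-integrable functions of the
  past, up to the factor \<open>\<surd>p\<^sub>\<sigma>\<close>, isometrically into square-integrable functions of the next past, and
  distinct letters have orthogonal ranges (\<open>mult_letter_inner\<close>). Second, \<open>e(\<tau>)\<close> is in the closed
  span of \<open>y(\<tau>)\<close> and the past outputs \<open>z\<^sup>y\<^sub>u(\<tau>)\<close>, all of which stay orthogonal to \<open>v'(t)\<close> after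
  multiplication by \<open>\<mu>\<^sub>w(t - 1)\<close> with \<open>w\<close> nonempty; since the multiplication is an isometry, \<open>e(\<tau>)\<close>
  inherits the orthogonality (\<open>noise_orthogonal_innovation\<close>).

  When \<open>x'(t)\<close> is expanded by the state equation one step at a time, only the letter that matches the
  word survives at each step, and the noise enters at the first step only.
  The result is \<open>p\<^sub>\<sigma>\<^sub>s C' A'\<^sub>s B'\<^sub>\<sigma>\<close> for the word \<open>\<sigma>s\<close>, with
  \<open>B'\<^sub>\<sigma> = E[(A'\<^sub>\<sigma> x'(\<tau>) + K'\<^sub>\<sigma> v'(\<tau>)) e(\<tau>)\<^sup>T]\<close> (\<open>lag_corr_output_word\<close>). For the given innovation form the noise is
  \<open>e\<close> itself and is uncorrelated with the state, so the same quantity equals \<open>p\<^sub>\<sigma>\<^sub>s C A\<^sub>s K\<^sub>\<sigma> Q\<close> with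
  \<open>Q = E[e(\<tau>) e(\<tau>)\<^sup>T]\<close> (\<open>input_corr_innovation_form\<close>). The full rank condition makes \<open>Q\<close> invertible. Hence
  \<open>C' A'\<^sub>s (B'\<^sub>\<sigma> Q\<^sup>-\<^sup>1) = C A\<^sub>s K\<^sub>\<sigma>\<close>: the deterministic system \<open>(A', B' Q\<^sup>-\<^sup>1, C', I)\<close> has the
  sub-Markov function of \<open>(A, K, C, I)\<close>, and minimality of the latter bounds the dimension of the
  other realization from below.
\<close>

section \<open>Closed subspaces of square-integrable random variables\<close>

lemma L2D: "X \<in> L2 M \<Longrightarrow> X \<in> borel_measurable M" "X \<in> L2 M \<Longrightarrow> integrable M (\<lambda>\<omega>. (X \<omega>)\<^sup>2)"
  by (auto simp: L2_def)

lemma L2_integrable_mult: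
  assumes "X \<in> L2 M" "Y \<in> L2 M"
  shows "integrable M (\<lambda>\<omega>. X \<omega> * Y \<omega>)"
proof (rule Bochner_Integration.integrable_bound)
  show "integrable M (\<lambda>\<omega>. (X \<omega>)\<^sup>2 + (Y \<omega>)\<^sup>2)"
    using assms by (simp add: L2_def)
  show "(\<lambda>\<omega>. X \<omega> * Y \<omega>) \<in> borel_measurable M"
    using assms by (auto simp: L2_def)
  have "\<bar>a * b\<bar> \<le> a\<^sup>2 + b\<^sup>2" for a b :: real
  proof -
    have "2 * (\<bar>a\<bar> * \<bar>b\<bar>) \<le> a\<^sup>2 + b\<^sup>2"
      using zero_le_power2[of "\<bar>a\<bar> - \<bar>b\<bar>"] by (simp add: power2_diff mult.assoc)
    moreover have "0 \<le> \<bar>a\<bar> * \<bar>b\<bar>" by simp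
    ultimately show ?thesis unfolding abs_mult by linarith
  qed
  then show "AE \<omega> in M. norm (X \<omega> * Y \<omega>) \<le> norm ((X \<omega>)\<^sup>2 + (Y \<omega>)\<^sup>2)"
    by auto
qed

lemma L2_zero: "(\<lambda>_. 0) \<in> L2 M"
  by (simp add: L2_def)

lemma L2_scale: "X \<in> L2 M \<Longrightarrow> (\<lambda>\<omega>. c * X \<omega>) \<in> L2 M"
  by (auto simp: L2_def power_mult_distrib)

lemma L2_add:
  assumes "X \<in> L2 M" "Y \<in> L2 M"
  shows "(\<lambda>\<omega>. X \<omega> + Y \<omega>) \<in> L2 M"
  using assms L2_integrable_mult[OF assms]
  by (auto simp: L2_def power2_sum mult.assoc)

lemma L2_diff:
  assumes "X \<in> L2 M" "Y \<in> L2 M"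
  shows "(\<lambda>\<omega>. X \<omega> - Y \<omega>) \<in> L2 M"
  using L2_add[OF assms(1) L2_scale[OF assms(2), of "-1"]] by simp

lemma L2_cong_AE:
  assumes "X \<in> L2 M" "Y \<in> borel_measurable M" "AE \<omega> in M. X \<omega> = Y \<omega>"
  shows "Y \<in> L2 M"
proof -
  have "integrable M (\<lambda>\<omega>. (Y \<omega>)\<^sup>2) \<longleftrightarrow> integrable M (\<lambda>\<omega>. (X \<omega>)\<^sup>2)"
    using assms by (intro integrable_cong_AE) (auto simp: L2_def)
  with assms show ?thesis by (simp add: L2_def)
qed

lemma L2_Cauchy_Schwarz:
  assumes "X \<in> L2 M" "Y \<in> L2 M"
  shows "(\<integral>\<omega>. X \<omega> * Y \<omega> \<partial>M)\<^sup>2 \<le> (\<integral>\<omega>. (X \<omega>)\<^sup>2 \<partial>M) * (\<integral>\<omega>. (Y \<omega>)\<^sup>2 \<partial>M)"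
proof -
  have [measurable]: "X \<in> borel_measurable M" "Y \<in> borel_measurable M"
    using assms by (auto simp: L2_def)
  let ?I = "\<integral>\<omega>. \<bar>X \<omega> * Y \<omega>\<bar> \<partial>M"
  have nn: "(\<integral>\<^sup>+\<omega>. ennreal \<bar>X \<omega>\<bar> * ennreal \<bar>Y \<omega>\<bar> \<partial>M) = ennreal ?I"
    using integrable_abs[OF L2_integrable_mult[OF assms]]
    by (subst nn_integral_eq_integral[symmetric]) (auto simp: abs_mult ennreal_mult)
  have sq: "(\<integral>\<^sup>+\<omega>. (ennreal \<bar>Z \<omega>\<bar>)\<^sup>2 \<partial>M) = ennreal (\<integral>\<omega>. (Z \<omega>)\<^sup>2 \<partial>M)" if "Z \<in> L2 M" for Z
    using that by (subst nn_integral_eq_integral[symmetric]) (auto simp: L2_def ennreal_power)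
  have "(ennreal ?I)\<^sup>2 \<le> ennreal (\<integral>\<omega>. (X \<omega>)\<^sup>2 \<partial>M) * ennreal (\<integral>\<omega>. (Y \<omega>)\<^sup>2 \<partial>M)"
    using Cauchy_Schwarz_nn_integral[of "\<lambda>\<omega>. ennreal \<bar>X \<omega>\<bar>" M "\<lambda>\<omega>. ennreal \<bar>Y \<omega>\<bar>"]
    by (simp add: nn sq assms)
  then have "ennreal (?I\<^sup>2) \<le> ennreal ((\<integral>\<omega>. (X \<omega>)\<^sup>2 \<partial>M) * (\<integral>\<omega>. (Y \<omega>)\<^sup>2 \<partial>M))"
    by (simp add: ennreal_mult ennreal_power)
  then have "?I\<^sup>2 \<le> (\<integral>\<omega>. (X \<omega>)\<^sup>2 \<partial>M) * (\<integral>\<omega>. (Y \<omega>)\<^sup>2 \<partial>M)"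
    by (subst (asm) ennreal_le_iff) auto
  moreover have "\<bar>\<integral>\<omega>. X \<omega> * Y \<omega> \<partial>M\<bar> \<le> ?I"
    by (rule integral_abs_bound)
  ultimately show ?thesis
    using power_mono[of "\<bar>\<integral>\<omega>. X \<omega> * Y \<omega> \<partial>M\<bar>" ?I 2] by simp
qed

text \<open>
  Measurability with respect to \<open>F\<close> is required up to null sets only: projections and outputs are
  determined only almost surely, and otherwise the set would not be closed in the sense of
  \<^const>\<open>L2_closed_subspace\<close>.
\<close>

definition L2_adapted :: "'a measure \<Rightarrow> 'a measure \<Rightarrow> ('a \<Rightarrow> real) set" where
  "L2_adapted M F = {X \<in> L2 M. \<exists>Y \<in> borel_measurable F. AE \<omega> in M. X \<omega> = Y \<omega>}"

lemma L2_closed_subspace_L2: "L2_closed_subspace M (L2 M)"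
  by (auto simp: L2_closed_subspace_def L2_zero L2_add L2_scale)

lemma
  assumes "L2_closed_subspace M H"
  shows L2_closed_subspace_subset: "H \<subseteq> L2 M"
    and L2_closed_subspace_zero: "(\<lambda>_. 0) \<in> H"
    and L2_closed_subspace_add: "X \<in> H \<Longrightarrow> Y \<in> H \<Longrightarrow> (\<lambda>\<omega>. X \<omega> + Y \<omega>) \<in> H"
    and L2_closed_subspace_scale: "X \<in> H \<Longrightarrow> (\<lambda>\<omega>. c * X \<omega>) \<in> H"
    and L2_closed_subspace_limit: "\<lbrakk>\<And>k::nat. f k \<in> H; X \<in> L2 M;
      (\<lambda>k. \<integral>\<omega>. (f k \<omega> - X \<omega>)\<^sup>2 \<partial>M) \<longlonglongrightarrow> 0\<rbrakk> \<Longrightarrow> X \<in> H"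
proof -
  have "H \<subseteq> L2 M" "(\<lambda>_. 0) \<in> H" "\<forall>X\<in>H. \<forall>Y\<in>H. (\<lambda>\<omega>. X \<omega> + Y \<omega>) \<in> H"
      "\<forall>c. \<forall>X\<in>H. (\<lambda>\<omega>. c * X \<omega>) \<in> H"
    and lim: "\<forall>f X. (\<forall>k::nat. f k \<in> H) \<and> X \<in> L2 M \<and>
        (\<lambda>k. \<integral>\<omega>. (f k \<omega> - X \<omega>)\<^sup>2 \<partial>M) \<longlonglongrightarrow> 0 \<longrightarrow> X \<in> H"
    using assms unfolding L2_closed_subspace_def by - (elim conjE, assumption)+
  then show "H \<subseteq> L2 M" "(\<lambda>_. 0) \<in> H" "X \<in> H \<Longrightarrow> Y \<in> H \<Longrightarrow> (\<lambda>\<omega>. X \<omega> + Y \<omega>) \<in> H"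
      "X \<in> H \<Longrightarrow> (\<lambda>\<omega>. c * X \<omega>) \<in> H"
    by simp_all
  show "X \<in> H" if "\<And>k::nat. f k \<in> H" "X \<in> L2 M" "(\<lambda>k. \<integral>\<omega>. (f k \<omega> - X \<omega>)\<^sup>2 \<partial>M) \<longlonglongrightarrow> 0"
    using lim[THEN spec[of _ f], THEN spec[of _ X]] that by simp
qed

text \<open>
  An \<open>L\<^sup>2\<close>-convergent sequence has an almost surely convergent subsequence, and a pointwise limit of
  \<open>F\<close>-measurable functions is \<open>F\<close>-measurable.
\<close>

lemma L2_closed_subspace_adapted: "L2_closed_subspace M (L2_adapted M F)"
  unfolding L2_closed_subspace_def
proof (intro conjI ballI allI impI)
  show "L2_adapted M F \<subseteq> L2 M" by (auto simp: L2_adapted_def)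
  show "(\<lambda>_. 0) \<in> L2_adapted M F"
    by (auto simp: L2_adapted_def L2_zero intro!: bexI[of _ "\<lambda>_. 0"])
next
  fix X Y assume "X \<in> L2_adapted M F" "Y \<in> L2_adapted M F"
  then obtain X' Y' where "X \<in> L2 M" "Y \<in> L2 M" "X' \<in> borel_measurable F" "Y' \<in> borel_measurable F"
    "AE \<omega> in M. X \<omega> = X' \<omega>" "AE \<omega> in M. Y \<omega> = Y' \<omega>"
    by (auto simp: L2_adapted_def)
  then show "(\<lambda>\<omega>. X \<omega> + Y \<omega>) \<in> L2_adapted M F"
    by (auto simp: L2_adapted_def L2_add intro!: bexI[of _ "\<lambda>\<omega>. X' \<omega> + Y' \<omega>"])
next
  fix c X assume "X \<in> L2_adapted M F"
  then obtain X' where "X \<in> L2 M" "X' \<in> borel_measurable F" "AE \<omega> in M. X \<omega> = X' \<omega>"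
    by (auto simp: L2_adapted_def)
  then show "(\<lambda>\<omega>. c * X \<omega>) \<in> L2_adapted M F"
    by (auto simp: L2_adapted_def L2_scale intro!: bexI[of _ "\<lambda>\<omega>. c * X' \<omega>"])
next
  fix f X
  assume *: "(\<forall>k::nat. f k \<in> L2_adapted M F) \<and> X \<in> L2 M \<and>
    (\<lambda>k. \<integral>\<omega>. (f k \<omega> - X \<omega>)\<^sup>2 \<partial>M) \<longlonglongrightarrow> 0"
  then have "\<forall>k. \<exists>Y. Y \<in> borel_measurable F \<and> (AE \<omega> in M. f k \<omega> = Y \<omega>)"
    by (auto simp: L2_adapted_def)
  then obtain g where g: "\<And>k. g k \<in> borel_measurable F" "\<And>k. AE \<omega> in M. f k \<omega> = g k \<omega>"
    by metis
  have "integrable M (\<lambda>\<omega>. (f k \<omega> - X \<omega>)\<^sup>2)" for k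
    using * L2_diff[of "f k" M X] by (auto simp: L2_adapted_def L2_def)
  then obtain r :: "nat \<Rightarrow> nat" where r: "AE \<omega> in M. (\<lambda>k. (f (r k) \<omega> - X \<omega>)\<^sup>2) \<longlonglongrightarrow> 0"
    using tendsto_L1_AE_subseq[of M "\<lambda>k \<omega>. (f k \<omega> - X \<omega>)\<^sup>2"] * by auto
  have "AE \<omega> in M. \<forall>k. f k \<omega> = g k \<omega>"
    using g(2) by (simp add: AE_all_countable)
  with r have "AE \<omega> in M. X \<omega> = lim (\<lambda>k. g (r k) \<omega>)"
  proof eventually_elim
    case (elim \<omega>)
    then have "(\<lambda>k. sqrt ((g (r k) \<omega> - X \<omega>)\<^sup>2)) \<longlonglongrightarrow> sqrt 0"
      by (intro tendsto_real_sqrt) simp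
    then have "(\<lambda>k. g (r k) \<omega> - X \<omega>) \<longlonglongrightarrow> 0"
      by (simp add: tendsto_rabs_zero_iff)
    then have "(\<lambda>k. g (r k) \<omega>) \<longlonglongrightarrow> X \<omega>"
      by (simp add: LIM_zero_iff)
    then show ?case by (simp add: limI)
  qed
  moreover have "(\<lambda>\<omega>. lim (\<lambda>k. g (r k) \<omega>)) \<in> borel_measurable F"
    using g(1) by measurable
  ultimately show "X \<in> L2_adapted M F"
    using * by (auto simp: L2_adapted_def)
qed

text \<open>
  The limit condition applied to a constant sequence.
\<close>

lemma L2_closed_subspace_cong_AE:
  assumes "L2_closed_subspace M H" "X \<in> H" "Y \<in> borel_measurable M" "AE \<omega> in M. X \<omega> = Y \<omega>"
  shows "Y \<in> H"
proof -
  have X: "X \<in> L2 M" using assms by (auto simp: L2_closed_subspace_def)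
  have Y: "Y \<in> L2 M" using L2_cong_AE[OF X assms(3,4)] .
  have "AE \<omega> in M. (X \<omega> - Y \<omega>)\<^sup>2 = 0" using assms(4) by auto
  then have "(\<integral>\<omega>. (X \<omega> - Y \<omega>)\<^sup>2 \<partial>M) = 0"
    by (rule integral_eq_zero_AE)
  then show ?thesis
    using L2_closed_subspace_limit[OF assms(1), of "\<lambda>_. X" Y] assms(2) Y by simp
qed

lemma L2_closed_subspace_sum:
  assumes "L2_closed_subspace M H" "\<And>i. i \<in> I \<Longrightarrow> X i \<in> H"
  shows "(\<lambda>\<omega>. \<Sum>i\<in>I. c i * X i \<omega>) \<in> H"
  using assms(2)
proof (induction I rule: infinite_finite_induct)
  case (insert i I)
  then have "(\<lambda>\<omega>. c i * X i \<omega> + (\<Sum>j\<in>I. c j * X j \<omega>)) \<in> H"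
    by (intro L2_closed_subspace_add[OF assms(1)] L2_closed_subspace_scale[OF assms(1)]) auto
  then show ?case using insert by simp
qed (use L2_closed_subspace_zero[OF assms(1)] in auto)

lemma L2_closed_subspace_diff:
  assumes "L2_closed_subspace M H" "X \<in> H" "Y \<in> H"
  shows "(\<lambda>\<omega>. X \<omega> - Y \<omega>) \<in> H"
  using L2_closed_subspace_add[OF assms(1,2) L2_closed_subspace_scale[OF assms(1,3), of "-1"]]
  by simp

lemma L2_closed_subspace_hull:
  assumes "S \<subseteq> L2 M"
  shows "L2_closed_subspace M (L2_closed_subspace M hull S)"
proof -
  have sub: "L2_closed_subspace M hull S \<subseteq> L2 M"
    by (rule hull_minimal[of S "L2 M"]) (use assms in \<open>auto intro: L2_closed_subspace_L2\<close>)
  have mem: "X \<in> L2_closed_subspace M hull S \<longleftrightarrow>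
      (\<forall>H. L2_closed_subspace M H \<longrightarrow> S \<subseteq> H \<longrightarrow> X \<in> H)" for X
    by (auto simp: hull_def)
  show ?thesis
    unfolding L2_closed_subspace_def[of M "L2_closed_subspace M hull S"]
  proof (intro conjI ballI allI impI)
    show "L2_closed_subspace M hull S \<subseteq> L2 M" by (fact sub)
    show "(\<lambda>_. 0) \<in> L2_closed_subspace M hull S"
      by (simp add: mem L2_closed_subspace_zero)
    show "(\<lambda>\<omega>. X \<omega> + Y \<omega>) \<in> L2_closed_subspace M hull S"
      if "X \<in> L2_closed_subspace M hull S" "Y \<in> L2_closed_subspace M hull S" for X Y
      using that by (simp add: mem L2_closed_subspace_add)
    show "(\<lambda>\<omega>. c * X \<omega>) \<in> L2_closed_subspace M hull S"
      if "X \<in> L2_closed_subspace M hull S" for c X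
      using that by (simp add: mem L2_closed_subspace_scale)
    fix f X
    assume "(\<forall>k::nat. f k \<in> L2_closed_subspace M hull S) \<and> X \<in> L2 M \<and>
      (\<lambda>k. \<integral>\<omega>. (f k \<omega> - X \<omega>)\<^sup>2 \<partial>M) \<longlonglongrightarrow> 0"
    then show "X \<in> L2_closed_subspace M hull S"
      unfolding mem using L2_closed_subspace_limit[of M _ f X] by metis
  qed
qed

text \<open>
  Multiplication by \<open>m\<close> is a multiple of an isometry on \<open>H\<close>, so \<open>Z \<mapsto> E[V Z m]\<close> is a continuous
  functional and its kernel is closed. The multiplier itself may be unbounded; only its action on
  \<open>H\<close> is controlled.
\<close>

lemma L2_closed_subspace_multiplier_annihilator:
  assumes H: "L2_closed_subspace M H" and V: "V \<in> L2 M"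
    and L2: "\<And>Z. Z \<in> H \<Longrightarrow> (\<lambda>\<omega>. Z \<omega> * m \<omega>) \<in> L2 M"
    and iso: "\<And>Z. Z \<in> H \<Longrightarrow> (\<integral>\<omega>. (Z \<omega> * m \<omega>)\<^sup>2 \<partial>M) = c * (\<integral>\<omega>. (Z \<omega>)\<^sup>2 \<partial>M)"
  shows "L2_closed_subspace M {Z \<in> H. (\<integral>\<omega>. V \<omega> * (Z \<omega> * m \<omega>) \<partial>M) = 0}"
  unfolding L2_closed_subspace_def
proof (intro conjI ballI allI impI)
  have HL2: "H \<subseteq> L2 M" using H by (simp add: L2_closed_subspace_def)
  then show "{Z \<in> H. (\<integral>\<omega>. V \<omega> * (Z \<omega> * m \<omega>) \<partial>M) = 0} \<subseteq> L2 M" by auto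
  show "(\<lambda>_. 0) \<in> {Z \<in> H. (\<integral>\<omega>. V \<omega> * (Z \<omega> * m \<omega>) \<partial>M) = 0}"
    using L2_closed_subspace_zero[OF H] by auto
  have int: "integrable M (\<lambda>\<omega>. V \<omega> * (Z \<omega> * m \<omega>))" if "Z \<in> H" for Z
    using L2_integrable_mult[OF V L2[OF that]] .
  show "(\<lambda>\<omega>. X \<omega> + Y \<omega>) \<in> {Z \<in> H. (\<integral>\<omega>. V \<omega> * (Z \<omega> * m \<omega>) \<partial>M) = 0}"
    if "X \<in> {Z \<in> H. (\<integral>\<omega>. V \<omega> * (Z \<omega> * m \<omega>) \<partial>M) = 0}"
      "Y \<in> {Z \<in> H. (\<integral>\<omega>. V \<omega> * (Z \<omega> * m \<omega>) \<partial>M) = 0}" for X Y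
    using that int L2_closed_subspace_add[OF H] by (auto simp: ring_distribs)
  show "(\<lambda>\<omega>. a * X \<omega>) \<in> {Z \<in> H. (\<integral>\<omega>. V \<omega> * (Z \<omega> * m \<omega>) \<partial>M) = 0}"
    if "X \<in> {Z \<in> H. (\<integral>\<omega>. V \<omega> * (Z \<omega> * m \<omega>) \<partial>M) = 0}" for a X
    using that L2_closed_subspace_scale[OF H] by (auto simp: mult.assoc mult.left_commute[of _ a])
  fix f X
  assume *: "(\<forall>k::nat. f k \<in> {Z \<in> H. (\<integral>\<omega>. V \<omega> * (Z \<omega> * m \<omega>) \<partial>M) = 0}) \<and> X \<in> L2 M \<and>
        (\<lambda>k. \<integral>\<omega>. (f k \<omega> - X \<omega>)\<^sup>2 \<partial>M) \<longlonglongrightarrow> 0"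
  then have fH: "f k \<in> H" and f0: "(\<integral>\<omega>. V \<omega> * (f k \<omega> * m \<omega>) \<partial>M) = 0" for k by auto
  have XH: "X \<in> H" using L2_closed_subspace_limit[OF H] fH * by blast
  have dH: "(\<lambda>\<omega>. f k \<omega> - X \<omega>) \<in> H" for k
    by (rule L2_closed_subspace_diff[OF H fH XH])
  have "(\<integral>\<omega>. V \<omega> * (X \<omega> * m \<omega>) \<partial>M)\<^sup>2
      \<le> (\<integral>\<omega>. (V \<omega>)\<^sup>2 \<partial>M) * (c * (\<integral>\<omega>. (f k \<omega> - X \<omega>)\<^sup>2 \<partial>M))" for k
  proof -
    have "(\<integral>\<omega>. V \<omega> * ((f k \<omega> - X \<omega>) * m \<omega>) \<partial>M)
        = (\<integral>\<omega>. V \<omega> * (f k \<omega> * m \<omega>) - V \<omega> * (X \<omega> * m \<omega>) \<partial>M)"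
      by (simp add: algebra_simps)
    also have "\<dots> = - (\<integral>\<omega>. V \<omega> * (X \<omega> * m \<omega>) \<partial>M)"
      using int[OF fH] int[OF XH] f0 by simp
    finally show ?thesis
      using L2_Cauchy_Schwarz[OF V L2[OF dH[of k]]] iso[OF dH[of k]] by simp
  qed
  moreover have "(\<lambda>k. (\<integral>\<omega>. (V \<omega>)\<^sup>2 \<partial>M) * (c * (\<integral>\<omega>. (f k \<omega> - X \<omega>)\<^sup>2 \<partial>M))) \<longlonglongrightarrow> 0"
    using * by (auto intro!: tendsto_eq_intros)
  ultimately have "(\<integral>\<omega>. V \<omega> * (X \<omega> * m \<omega>) \<partial>M)\<^sup>2 \<le> 0"
    by (intro LIMSEQ_le_const) auto
  then show "X \<in> {Z \<in> H. (\<integral>\<omega>. V \<omega> * (Z \<omega> * m \<omega>) \<partial>M) = 0}"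
    using XH by simp
qed

text \<open>
  The difference of two projections lies in the closed span and is orthogonal to it.
\<close>

lemma is_lin_proj_unique:
  assumes P: "is_lin_proj M S X P" and P': "is_lin_proj M S X P'"
  shows "AE \<omega> in M. P \<omega> = P' \<omega>"
proof -
  let ?H = "L2_closed_subspace M hull S"
  have X: "X \<in> L2 M" and PH: "P \<in> ?H" "P' \<in> ?H"
    using P P' by (auto simp only: is_lin_proj_def)
  have H: "L2_closed_subspace M ?H"
    by (rule L2_closed_subspace_hull) (use P in \<open>simp only: is_lin_proj_def\<close>)
  have HL2: "?H \<subseteq> L2 M" by (rule L2_closed_subspace_subset[OF H])
  define D where "D = (\<lambda>\<omega>. P \<omega> - P' \<omega>)"
  have DH: "D \<in> ?H" unfolding D_def by (rule L2_closed_subspace_diff[OF H PH])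
  have D: "D \<in> L2 M" using DH HL2 by (rule subsetD[rotated])
  have "(\<integral>\<omega>. (X \<omega> - P' \<omega>) * D \<omega> \<partial>M) - (\<integral>\<omega>. (X \<omega> - P \<omega>) * D \<omega> \<partial>M) = 0"
    using P P' DH by (simp only: is_lin_proj_def)
  moreover have "integrable M (\<lambda>\<omega>. (X \<omega> - P' \<omega>) * D \<omega>)" "integrable M (\<lambda>\<omega>. (X \<omega> - P \<omega>) * D \<omega>)"
    by (rule L2_integrable_mult[OF L2_diff[OF X subsetD[OF HL2 PH(2)]] D]
      L2_integrable_mult[OF L2_diff[OF X subsetD[OF HL2 PH(1)]] D])+
  ultimately have "(\<integral>\<omega>. (X \<omega> - P' \<omega>) * D \<omega> - (X \<omega> - P \<omega>) * D \<omega> \<partial>M) = 0"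
    by simp
  also have "(\<lambda>\<omega>. (X \<omega> - P' \<omega>) * D \<omega> - (X \<omega> - P \<omega>) * D \<omega>) = (\<lambda>\<omega>. (D \<omega>)\<^sup>2)"
    by (auto simp: D_def power2_eq_square algebra_simps)
  finally have "AE \<omega> in M. (D \<omega>)\<^sup>2 = 0"
    using D by (subst (asm) integral_nonneg_eq_0_iff_AE) (auto simp: L2_def)
  then show ?thesis by (auto simp: D_def)
qed

section \<open>Constant conditional expectations\<close>

lemma generated_preimage_subset: 
  assumes "\<And>X. X \<in> \<X> \<Longrightarrow> X \<in> borel_measurable M"
  shows "{X -` B \<inter> space M | X B. X \<in> \<X> \<and> B \<in> sets borel} \<subseteq> sets M"
  using assms by (auto intro: measurable_sets)

lemma space_gen_sigma [simp]: "space (gen_sigma M \<X>) = space M"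
  by (simp add: gen_sigma_def space_measure_of_conv)

lemma sets_gen_sigma:
  "sets (gen_sigma M \<X>) = sigma_sets (space M) {X -` B \<inter> space M | X B. X \<in> \<X> \<and> B \<in> sets borel}"
  unfolding gen_sigma_def by (subst sets_measure_of) auto

lemma subalgebra_gen_sigma:
  assumes "\<And>X. X \<in> \<X> \<Longrightarrow> X \<in> borel_measurable M"
  shows "subalgebra M (gen_sigma M \<X>)"
  unfolding subalgebra_def sets_gen_sigma
  using sets.sigma_sets_subset[OF generated_preimage_subset[OF assms]] by auto

lemma gen_sigma_measurable:
  assumes "X \<in> \<X>"
  shows "X \<in> borel_measurable (gen_sigma M \<X>)"
  using assms by (intro measurableI) (auto simp: sets_gen_sigma intro!: sigma_sets.Basic)

lemma sets_gen_sigma_mono: "\<X> \<subseteq> \<Y> \<Longrightarrow> sets (gen_sigma M \<X>) \<subseteq> sets (gen_sigma M \<Y>)"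
  unfolding sets_gen_sigma by (rule sigma_sets_mono') auto

text \<open>
  The intersections form a pi-system, which makes them the convenient generator of the
  sigma-algebra spanned by two families.
\<close>

lemma sets_gen_sigma_Un:
  "sets (gen_sigma M (\<X> \<union> \<Y>)) \<subseteq>
     sigma_sets (space M) {A \<inter> B | A B. A \<in> sets (gen_sigma M \<X>) \<and> B \<in> sets (gen_sigma M \<Y>)}"
proof -
  let ?E = "{A \<inter> B | A B. A \<in> sets (gen_sigma M \<X>) \<and> B \<in> sets (gen_sigma M \<Y>)}"
  have "{X -` B \<inter> space M | X B. X \<in> \<X> \<union> \<Y> \<and> B \<in> sets borel} \<subseteq> ?E"
  proof
    fix D assume "D \<in> {X -` B \<inter> space M | X B. X \<in> \<X> \<union> \<Y> \<and> B \<in> sets borel}"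
    then have "D \<in> sets (gen_sigma M \<X>) \<or> D \<in> sets (gen_sigma M \<Y>)"
      by (auto simp: sets_gen_sigma intro: sigma_sets.Basic)
    moreover have "space M \<in> sets (gen_sigma M \<X>)" "space M \<in> sets (gen_sigma M \<Y>)"
      using sets.top[of "gen_sigma M \<X>"] sets.top[of "gen_sigma M \<Y>"] by auto
    moreover have "D \<inter> space M = D" "space M \<inter> D = D"
      using \<open>D \<in> _\<close> by auto
    ultimately show "D \<in> ?E" by (smt (verit) mem_Collect_eq)
  qed
  then show ?thesis unfolding sets_gen_sigma[of M "\<X> \<union> \<Y>"] by (rule sigma_sets_mono')
qed

text \<open>
  The identity \<open>E[g | F] = c\<close> almost surely, in integrated form. This form is proved on a pi-system
  and then extended to the sigma-algebra that it generates.
\<close>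

definition constant_cond_exp :: "'a measure \<Rightarrow> 'a measure \<Rightarrow> ('a \<Rightarrow> real) \<Rightarrow> real \<Rightarrow> bool" where
  "constant_cond_exp M F g c \<longleftrightarrow>
     integrable M g \<and> (\<forall>D\<in>sets F. (\<integral>\<omega>. indicator D \<omega> * g \<omega> \<partial>M) = c * measure M D)"

context prob_space
begin

lemma sigma_finite_subalgebra_of_subalgebra: "subalgebra M F \<Longrightarrow> sigma_finite_subalgebra M F"
  by (intro finite_measure_subalgebra_is_sigma_finite)
     (simp add: finite_measure_subalgebra_def finite_measure_axioms finite_measure_subalgebra_axioms_def)

lemma constant_cond_exp_iff:
  assumes F: "subalgebra M F" and g: "integrable M g"
  shows "constant_cond_exp M F g c \<longleftrightarrow> (AE \<omega> in M. real_cond_exp M F g \<omega> = c)"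
proof -
  interpret S: sigma_finite_subalgebra M F by (rule sigma_finite_subalgebra_of_subalgebra[OF F])
  have FM: "sets F \<subseteq> sets M" using F by (simp add: subalgebra_def)
  show ?thesis
  proof
    assume c: "constant_cond_exp M F g c"
    show "AE \<omega> in M. real_cond_exp M F g \<omega> = c"
    proof (rule S.real_cond_exp_charact)
      fix A assume A: "A \<in> sets F"
      then have "A \<in> sets M" using FM by auto
      then show "(LINT \<omega>:A|M. g \<omega>) = (LINT \<omega>:A|M. c)"
        using c A by (simp add: set_lebesgue_integral_def constant_cond_exp_def)
    qed (use g in auto)
  next
    assume c: "AE \<omega> in M. real_cond_exp M F g \<omega> = c"
    have "(\<integral>\<omega>. indicator D \<omega> * g \<omega> \<partial>M) = c * measure M D" if D: "D \<in> sets F" for D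
    proof -
      have DM: "D \<in> sets M" using D FM by auto
      have "(\<integral>\<omega>. indicator D \<omega> * g \<omega> \<partial>M) = (\<integral>\<omega>. indicator D \<omega> * real_cond_exp M F g \<omega> \<partial>M)"
        using S.real_cond_exp_intA[OF g D] by (simp add: set_lebesgue_integral_def)
      also have "\<dots> = (\<integral>\<omega>. indicator D \<omega> * c \<partial>M)"
        using c DM by (intro integral_cong_AE) auto
      finally show ?thesis using DM by simp
    qed
    then show "constant_cond_exp M F g c" using g by (simp add: constant_cond_exp_def)
  qed
qed

lemma constant_cond_exp_integral_mult:
  assumes F: "subalgebra M F" and g: "constant_cond_exp M F g c"
    and Y: "Y \<in> borel_measurable F" and int: "integrable M (\<lambda>\<omega>. Y \<omega> * g \<omega>)"
  shows "(\<integral>\<omega>. Y \<omega> * g \<omega> \<partial>M) = c * (\<integral>\<omega>. Y \<omega> \<partial>M)"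
proof -
  interpret S: sigma_finite_subalgebra M F by (rule sigma_finite_subalgebra_of_subalgebra[OF F])
  have gi: "integrable M g" using g by (simp add: constant_cond_exp_def)
  have c: "AE \<omega> in M. real_cond_exp M F g \<omega> = c"
    using constant_cond_exp_iff[OF F gi] g by simp
  have [measurable]: "Y \<in> borel_measurable M" by (rule measurable_from_subalg[OF F Y])
  have "(\<integral>\<omega>. Y \<omega> * g \<omega> \<partial>M) = (\<integral>\<omega>. Y \<omega> * real_cond_exp M F g \<omega> \<partial>M)"
    using S.real_cond_exp_intg(2)[OF int Y] gi by simp
  also have "\<dots> = (\<integral>\<omega>. Y \<omega> * c \<partial>M)"
    using c by (intro integral_cong_AE) auto
  finally show ?thesis by (simp add: mult.commute)
qed

text \<open>
  The version for nonnegative functions comes without an integrability condition; it is the source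
  of all integrability statements about products with scheduling variables.
\<close>

lemma constant_cond_exp_nn_integral_mult:
  assumes F: "subalgebra M F" and g: "constant_cond_exp M F g c" and pos: "\<And>\<omega>. 0 \<le> g \<omega>" "0 \<le> c"
    and Y: "Y \<in> borel_measurable F"
  shows "(\<integral>\<^sup>+\<omega>. Y \<omega> * ennreal (g \<omega>) \<partial>M) = ennreal c * (\<integral>\<^sup>+\<omega>. Y \<omega> \<partial>M)"
proof -
  interpret S: sigma_finite_subalgebra M F by (rule sigma_finite_subalgebra_of_subalgebra[OF F])
  have gi: "integrable M g" using g by (simp add: constant_cond_exp_def)
  have [measurable]: "Y \<in> borel_measurable M" "g \<in> borel_measurable M"
    using measurable_from_subalg[OF F Y] gi by auto
  have "AE \<omega> in M. ennreal c = nn_cond_exp M F (\<lambda>\<omega>. ennreal (g \<omega>)) \<omega>"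
  proof (rule S.nn_cond_exp_charact)
    fix A assume A: "A \<in> sets F"
    then have AM[measurable]: "A \<in> sets M" using F by (auto simp: subalgebra_def)
    have "(\<integral>\<^sup>+\<omega>. ennreal (g \<omega>) * indicator A \<omega> \<partial>M) = (\<integral>\<^sup>+\<omega>. ennreal (indicator A \<omega> * g \<omega>) \<partial>M)"
      by (intro nn_integral_cong) (auto simp: indicator_def)
    also have "\<dots> = ennreal (\<integral>\<omega>. indicator A \<omega> * g \<omega> \<partial>M)"
      using integrable_mult_indicator[OF AM gi] pos by (intro nn_integral_eq_integral) auto
    also have "\<dots> = ennreal c * emeasure M A"
      using g A pos by (simp add: constant_cond_exp_def ennreal_mult emeasure_eq_measure)
    finally show "(\<integral>\<^sup>+\<omega>\<in>A. ennreal (g \<omega>) \<partial>M) = (\<integral>\<^sup>+\<omega>\<in>A. ennreal c \<partial>M)"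
      by (simp add: nn_integral_cmult_indicator)
  qed auto
  then have "(\<integral>\<^sup>+\<omega>. Y \<omega> * nn_cond_exp M F (\<lambda>\<omega>. ennreal (g \<omega>)) \<omega> \<partial>M) = (\<integral>\<^sup>+\<omega>. Y \<omega> * ennreal c \<partial>M)"
    by (intro nn_integral_cong_AE) auto
  then show ?thesis
    using S.nn_cond_exp_intg[OF Y, of "\<lambda>\<omega>. ennreal (g \<omega>)"]
    by (simp add: nn_integral_cmult mult.commute)
qed

text \<open>
  The sets on which the identity holds form a Dynkin system.
\<close>

lemma constant_cond_exp_sigma_sets:
  assumes E: "Int_stable E" "E \<subseteq> sets M" "space M \<in> E" and g: "integrable M g"
    and eq: "\<And>D. D \<in> E \<Longrightarrow> (\<integral>\<omega>. indicator D \<omega> * g \<omega> \<partial>M) = c * measure M D"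
    and N: "sets N \<subseteq> sigma_sets (space M) E"
  shows "constant_cond_exp M N g c"
proof -
  have EM: "sigma_sets (space M) E \<subseteq> sets M"
    using E(2) by (rule sets.sigma_sets_subset)
  have "(\<integral>\<omega>. indicator D \<omega> * g \<omega> \<partial>M) = c * measure M D" if "D \<in> sigma_sets (space M) E" for D
    using E(1) _ that
  proof (rule sigma_sets_induct_disjoint)
    show "E \<subseteq> Pow (space M)" using E(2) sets.space_closed by blast
    fix D assume "D \<in> E" then show "(\<integral>\<omega>. indicator D \<omega> * g \<omega> \<partial>M) = c * measure M D" by (rule eq)
  next
    fix A assume A: "A \<in> sigma_sets (space M) E"
      and IH: "(\<integral>\<omega>. indicator A \<omega> * g \<omega> \<partial>M) = c * measure M A"
    have AM: "A \<in> sets M" using A EM by auto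
    have "(\<integral>\<omega>. indicator (space M - A) \<omega> * g \<omega> \<partial>M)
        = (\<integral>\<omega>. indicator (space M) \<omega> * g \<omega> - indicator A \<omega> * g \<omega> \<partial>M)"
      using sets.sets_into_space[OF AM] by (intro Bochner_Integration.integral_cong) (auto simp: indicator_def)
    also have "\<dots> = (\<integral>\<omega>. indicator (space M) \<omega> * g \<omega> \<partial>M) - (\<integral>\<omega>. indicator A \<omega> * g \<omega> \<partial>M)"
      using integrable_mult_indicator[OF AM g] integrable_mult_indicator[OF sets.top g] by simp
    also have "\<dots> = c * measure M (space M - A)"
      using eq[OF E(3)] IH AM by (simp add: finite_measure_compl algebra_simps)
    finally show "(\<integral>\<omega>. indicator (space M - A) \<omega> * g \<omega> \<partial>M) = c * measure M (space M - A)" .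
  next
    fix A :: "nat \<Rightarrow> 'a set"
    assume dis: "disjoint_family A" and A: "range A \<subseteq> sigma_sets (space M) E"
      and IH: "\<And>i. (\<integral>\<omega>. indicator (A i) \<omega> * g \<omega> \<partial>M) = c * measure M (A i)"
    have AM: "range A \<subseteq> sets M" using A EM by auto
    then have U: "(\<Union>i. A i) \<in> sets M" by auto
    have "(LINT \<omega>:(\<Union>i. A i)|M. g \<omega>) = (\<Sum>i. (LINT \<omega>:(A i)|M. g \<omega>))"
      using AM dis g integrable_mult_indicator[OF U g]
      by (intro lebesgue_integral_countable_add)
         (auto simp: disjoint_family_on_def set_integrable_def)
    then have "(\<integral>\<omega>. indicator (\<Union>i. A i) \<omega> * g \<omega> \<partial>M) = (\<Sum>i. c * measure M (A i))"
      by (simp add: set_lebesgue_integral_def IH)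
    also have "\<dots> = c * measure M (\<Union>i. A i)"
      using sums_mult[OF finite_measure_UNION[OF AM dis], of c] by (simp add: sums_iff)
    finally show "(\<integral>\<omega>. indicator (\<Union>i. A i) \<omega> * g \<omega> \<partial>M) = c * measure M (\<Union>i. A i)" .
  qed simp
  then show ?thesis
    using N g by (auto simp: constant_cond_exp_def)
qed

text \<open>
  Let \<open>h = E[1\<^sub>A | H]\<close>. For \<open>D\<close> in \<open>G\<close>, conditional independence gives
  \<open>E[1\<^sub>D 1\<^sub>A 1\<^sub>B] = E[1\<^sub>D h 1\<^sub>B]\<close>, so that \<open>1\<^sub>A 1\<^sub>B\<close> and \<open>h 1\<^sub>B\<close> have the same conditional expectation given
  \<open>G\<close>. Therefore \<open>E[1\<^sub>A 1\<^sub>B g] = E[h 1\<^sub>B g]\<close>, and conditioning on \<open>H\<close> replaces \<open>g\<close> by \<open>c\<close> and then \<open>h\<close> by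
  \<open>1\<^sub>A\<close>. This passes from indicators to an unbounded \<open>g\<close> without an approximation argument.
\<close>

lemma cond_indep_constant_cond_exp:
  assumes F: "subalgebra M F" and G: "subalgebra M G" and H: "subalgebra M H"
    and ci: "cond_indep M F G H"
    and g: "g \<in> borel_measurable G" and gH: "constant_cond_exp M H g c"
    and A: "A \<in> sets F" and B: "B \<in> sets H"
  shows "(\<integral>\<omega>. indicator (A \<inter> B) \<omega> * g \<omega> \<partial>M) = c * measure M (A \<inter> B)"
proof -
  interpret SG: sigma_finite_subalgebra M G by (rule sigma_finite_subalgebra_of_subalgebra[OF G])
  interpret SH: sigma_finite_subalgebra M H by (rule sigma_finite_subalgebra_of_subalgebra[OF H])
  let ?h = "real_cond_exp M H (indicator A)"
  have gi: "integrable M g" using gH by (simp add: constant_cond_exp_def)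
  have gM[measurable]: "g \<in> borel_measurable M" by (rule measurable_from_subalg[OF G g])
  have AM[measurable]: "A \<in> sets M" and BM[measurable]: "B \<in> sets M"
    using A B F H by (auto simp: subalgebra_def)
  have ind: "integrable M (indicator E :: _ \<Rightarrow> real)" if "E \<in> sets M" for E
    using that by (intro integrable_real_indicator) (simp_all add: less_top[symmetric])
  have iA: "integrable M (indicator A :: _ \<Rightarrow> real)" by (rule ind[OF AM])
  have h01: "AE \<omega> in M. 0 \<le> ?h \<omega>" "AE \<omega> in M. ?h \<omega> \<le> 1"
    using SH.real_cond_exp_ge_c[OF iA, of 0] SH.real_cond_exp_le_c[OF iA, of 1]
    by (auto simp: indicator_def)
  have hb: "AE \<omega> in M. norm (indicator B \<omega> * ?h \<omega> * f \<omega>) \<le> norm (f \<omega> :: real)" for f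
    using h01 by eventually_elim (auto simp: indicator_def abs_mult mult_left_le_one_le)
  have hint: "integrable M (\<lambda>\<omega>. indicator B \<omega> * ?h \<omega> * f \<omega>)" if "integrable M f" for f :: "_ \<Rightarrow> real"
    by (rule Bochner_Integration.integrable_bound[OF that _ hb]) (use that in measurable)
  have hint1: "integrable M (\<lambda>\<omega>. indicator B \<omega> * ?h \<omega>)"
    using hint[of "\<lambda>_. 1"] by simp
  \<comment> \<open>Conditional independence says that both functions have the same expectation given \<open>G\<close>.\<close>
  have "AE \<omega> in M. real_cond_exp M G (indicator (A \<inter> B)) \<omega> =
      real_cond_exp M G (\<lambda>\<omega>. indicator B \<omega> * ?h \<omega>) \<omega>"
  proof (rule SG.real_cond_exp_charact)
    fix D assume D: "D \<in> sets G"
    then have DM[measurable]: "D \<in> sets M" using G by (auto simp: subalgebra_def)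
    have iD: "integrable M (indicator D :: _ \<Rightarrow> real)" by (rule ind[OF DM])
    have iAD: "integrable M (indicator (A \<inter> D) :: _ \<Rightarrow> real)" by (rule ind) simp
    have "(\<integral>\<omega>. indicator D \<omega> * indicator (A \<inter> B) \<omega> \<partial>M)
        = (\<integral>\<omega>. indicator B \<omega> * indicator (A \<inter> D) \<omega> \<partial>M :: real)"
      by (intro Bochner_Integration.integral_cong) (auto simp: indicator_def)
    also have "\<dots> = (\<integral>\<omega>. indicator B \<omega> * real_cond_exp M H (indicator (A \<inter> D)) \<omega> \<partial>M)"
      using SH.real_cond_exp_intA[OF iAD B]
      by (simp add: set_lebesgue_integral_def)
    also have "\<dots> = (\<integral>\<omega>. indicator B \<omega> * ?h \<omega> * real_cond_exp M H (indicator D) \<omega> \<partial>M)"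
    proof (rule integral_cong_AE)
      have "AE \<omega> in M. real_cond_exp M H (indicator (A \<inter> D)) \<omega> =
        ?h \<omega> * real_cond_exp M H (indicator D) \<omega>"
        using ci A D by (auto simp: cond_indep_def)
      then show "AE \<omega> in M. indicator B \<omega> * real_cond_exp M H (indicator (A \<inter> D)) \<omega> =
        indicator B \<omega> * ?h \<omega> * real_cond_exp M H (indicator D) \<omega>"
        by eventually_elim simp
    qed auto
    also have "\<dots> = (\<integral>\<omega>. indicator B \<omega> * ?h \<omega> * indicator D \<omega> \<partial>M)"
      by (rule SH.real_cond_exp_intg(2)[OF hint[OF iD]]) (use B in measurable)
    also have "\<dots> = (\<integral>\<omega>. indicator D \<omega> * (indicator B \<omega> * ?h \<omega>) \<partial>M)"
      by (simp add: mult.commute)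
    finally have "(\<integral>\<omega>. indicator D \<omega> * indicator (A \<inter> B) \<omega> \<partial>M) = \<dots>" .
    then show "(LINT \<omega>:D|M. indicator (A \<inter> B) \<omega>) =
        (LINT \<omega>:D|M. real_cond_exp M G (\<lambda>\<omega>. indicator B \<omega> * ?h \<omega>) \<omega>)"
      using SG.real_cond_exp_intA[OF hint1 D] by (simp add: set_lebesgue_integral_def)
  next
    show "integrable M (indicator (A \<inter> B) :: _ \<Rightarrow> real)" by (rule ind) simp
  next
    show "integrable M (real_cond_exp M G (\<lambda>\<omega>. indicator B \<omega> * ?h \<omega>))"
      by (rule SG.real_cond_exp_int(1)[OF hint1])
  qed auto
  then have "(\<integral>\<omega>. g \<omega> * real_cond_exp M G (indicator (A \<inter> B)) \<omega> \<partial>M)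
      = (\<integral>\<omega>. g \<omega> * real_cond_exp M G (\<lambda>\<omega>. indicator B \<omega> * ?h \<omega>) \<omega> \<partial>M)"
    by (intro integral_cong_AE) auto
  moreover have "(\<integral>\<omega>. g \<omega> * real_cond_exp M G (indicator (A \<inter> B)) \<omega> \<partial>M)
      = (\<integral>\<omega>. g \<omega> * indicator (A \<inter> B) \<omega> \<partial>M)"
    using integrable_mult_indicator[of "A \<inter> B" M g] gi g
    by (intro SG.real_cond_exp_intg(2)) (auto simp: mult.commute)
  moreover have "(\<integral>\<omega>. g \<omega> * real_cond_exp M G (\<lambda>\<omega>. indicator B \<omega> * ?h \<omega>) \<omega> \<partial>M)
      = (\<integral>\<omega>. g \<omega> * (indicator B \<omega> * ?h \<omega>) \<partial>M)"
    using hint[OF gi] g by (intro SG.real_cond_exp_intg(2)) (auto simp: mult.commute)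
  ultimately have "(\<integral>\<omega>. indicator (A \<inter> B) \<omega> * g \<omega> \<partial>M) = (\<integral>\<omega>. (indicator B \<omega> * ?h \<omega>) * g \<omega> \<partial>M)"
    by (simp add: mult.commute)
  also have "\<dots> = c * (\<integral>\<omega>. indicator B \<omega> * ?h \<omega> \<partial>M)"
    by (rule constant_cond_exp_integral_mult[OF H gH _ hint[OF gi]]) (use B in measurable)
  also have "(\<integral>\<omega>. indicator B \<omega> * ?h \<omega> \<partial>M) = (\<integral>\<omega>. indicator B \<omega> * indicator A \<omega> \<partial>M)"
    using SH.real_cond_exp_intA[OF iA B] by (simp add: set_lebesgue_integral_def)
  also have "\<dots> = measure M (A \<inter> B)"
    by (simp add: indicator_inter_arith[symmetric] Int_commute)
  finally show ?thesis .
qed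

end

section \<open>Words of scheduling variables\<close>

lemma sched_word_Nil [simp]: "sched_word \<mu> [] t \<omega> = 1"
  by (simp add: sched_word_def)

lemma sched_word_snoc: "sched_word \<mu> (w @ [\<sigma>]) t \<omega> = sched_word \<mu> w (t - 1) \<omega> * \<mu> \<sigma> t \<omega>"
proof -
  have "(\<Prod>i<length w. \<mu> ((w @ [\<sigma>]) ! i) (t - int (Suc (length w)) + 1 + int i) \<omega>)
      = (\<Prod>i<length w. \<mu> (w ! i) (t - 1 - int (length w) + 1 + int i) \<omega>)"
    by (intro prod.cong) (auto simp: nth_append algebra_simps)
  then show ?thesis by (simp add: sched_word_def)
qed

lemma sched_word_single [simp]: "sched_word \<mu> [\<sigma>] t \<omega> = \<mu> \<sigma> t \<omega>"
  using sched_word_snoc[of \<mu> "[]"] by simp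

lemma sched_word_append:
  "sched_word \<mu> (u @ w) t \<omega> = sched_word \<mu> u (t - int (length w)) \<omega> * sched_word \<mu> w t \<omega>"
proof (induction w arbitrary: t rule: rev_induct)
  case (snoc \<sigma> w)
  then show ?case
    using sched_word_snoc[of \<mu> "u @ w" \<sigma> t \<omega>]
    by (simp add: sched_word_snoc algebra_simps)
qed simp

lemma word_weight_simps [simp]:
  "word_weight p [] = 1" "word_weight p (\<sigma> # w) = p \<sigma> * word_weight p w"
  "word_weight p (u @ w) = word_weight p u * word_weight p w"
  by (simp_all add: word_weight_def)

lemma word_weight_pos:
  assumes "\<And>\<sigma>. \<sigma> \<in> {1..n} \<Longrightarrow> 0 < p \<sigma>" "w \<in> words n"
  shows "0 < word_weight p w"
  using assms(2) by (induction w) (auto simp: words_def intro!: mult_pos_pos assms(1))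

lemma words_append [simp]: "u @ w \<in> words n \<longleftrightarrow> u \<in> words n \<and> w \<in> words n"
  by (simp add: words_def)

lemma words_Cons [simp]: "\<sigma> # w \<in> words n \<longleftrightarrow> \<sigma> \<in> {1..n} \<and> w \<in> words n"
  by (auto simp: words_def)

lemma words_Nil [simp]: "[] \<in> words n"
  by (simp add: words_def)

lemma L2_adaptedD: "Z \<in> L2_adapted M F \<Longrightarrow> Z \<in> L2 M"
  by (simp add: L2_adapted_def)

context prob_space
begin

text \<open>
  By conditioning on \<open>F\<close>, \<open>E[(Z m)\<^sup>2] = c E[Z\<^sup>2]\<close>, first in the extended nonnegative reals and hence
  with a finite value.
\<close>

lemma L2_adapted_mult_L2:
  assumes F: "subalgebra M F" and m: "m \<in> borel_measurable M"
    and c: "constant_cond_exp M F (\<lambda>\<omega>. m \<omega> * m \<omega>) c" "0 \<le> c"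
    and Z: "Z \<in> L2_adapted M F"
  shows "(\<lambda>\<omega>. Z \<omega> * m \<omega>) \<in> L2 M"
proof -
  obtain Y where Y: "Y \<in> borel_measurable F" "AE \<omega> in M. Z \<omega> = Y \<omega>" and ZL: "Z \<in> L2 M"
    using Z by (auto simp: L2_adapted_def)
  have [measurable]: "Z \<in> borel_measurable M" "Y \<in> borel_measurable M" "m \<in> borel_measurable M"
    using L2D(1)[OF ZL] measurable_from_subalg[OF F Y(1)] m by auto
  have YL: "Y \<in> L2 M" by (rule L2_cong_AE[OF ZL _ Y(2)]) simp
  have "(\<integral>\<^sup>+\<omega>. ennreal ((Y \<omega> * m \<omega>)\<^sup>2) \<partial>M) = (\<integral>\<^sup>+\<omega>. ennreal ((Y \<omega>)\<^sup>2) * ennreal (m \<omega> * m \<omega>) \<partial>M)"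
    by (intro nn_integral_cong) (simp add: ennreal_mult[symmetric] power2_eq_square algebra_simps)
  also have "\<dots> = ennreal c * (\<integral>\<^sup>+\<omega>. ennreal ((Y \<omega>)\<^sup>2) \<partial>M)"
    by (rule constant_cond_exp_nn_integral_mult[OF F c(1) _ c(2)]) (use Y(1) in auto)
  also have "\<dots> < \<infinity>"
    using L2D(2)[OF YL] by (simp add: nn_integral_eq_integral ennreal_mult_less_top)
  finally have "integrable M (\<lambda>\<omega>. (Y \<omega> * m \<omega>)\<^sup>2)"
    by (intro integrableI_nonneg) auto
  then have "(\<lambda>\<omega>. Y \<omega> * m \<omega>) \<in> L2 M" by (simp add: L2_def)
  then show ?thesis
    by (rule L2_cong_AE) (use Y(2) in auto)
qed

lemma L2_adapted_mult_inner:
  assumes F: "subalgebra M F" and m: "m \<in> borel_measurable M" "m' \<in> borel_measurable M"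
    and c: "constant_cond_exp M F (\<lambda>\<omega>. m \<omega> * m' \<omega>) c"
    and Z: "Z \<in> L2_adapted M F" "Z' \<in> L2_adapted M F"
    and L: "(\<lambda>\<omega>. Z \<omega> * m \<omega>) \<in> L2 M" "(\<lambda>\<omega>. Z' \<omega> * m' \<omega>) \<in> L2 M"
  shows "(\<integral>\<omega>. (Z \<omega> * m \<omega>) * (Z' \<omega> * m' \<omega>) \<partial>M) = c * (\<integral>\<omega>. Z \<omega> * Z' \<omega> \<partial>M)"
proof -
  obtain Y where Y: "Y \<in> borel_measurable F" "AE \<omega> in M. Z \<omega> = Y \<omega>" and ZL: "Z \<in> L2 M"
    using Z(1) by (auto simp: L2_adapted_def)
  obtain Y' where Y': "Y' \<in> borel_measurable F" "AE \<omega> in M. Z' \<omega> = Y' \<omega>" and ZL': "Z' \<in> L2 M"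
    using Z(2) by (auto simp: L2_adapted_def)
  have [measurable]: "Z \<in> borel_measurable M" "Y \<in> borel_measurable M" "m \<in> borel_measurable M"
     "Z' \<in> borel_measurable M" "Y' \<in> borel_measurable M" "m' \<in> borel_measurable M"
    using L2D(1)[OF ZL] L2D(1)[OF ZL'] measurable_from_subalg[OF F Y(1)]
      measurable_from_subalg[OF F Y'(1)] m by auto
  have eq: "AE \<omega> in M. (Z \<omega> * m \<omega>) * (Z' \<omega> * m' \<omega>) = (Y \<omega> * Y' \<omega>) * (m \<omega> * m' \<omega>)"
    using Y(2) Y'(2) by eventually_elim simp
  have "integrable M (\<lambda>\<omega>. (Y \<omega> * Y' \<omega>) * (m \<omega> * m' \<omega>))"
    using L2_integrable_mult[OF L] eq by (subst (asm) integrable_cong_AE[OF _ _ eq]) auto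
  then have "(\<integral>\<omega>. (Y \<omega> * Y' \<omega>) * (m \<omega> * m' \<omega>) \<partial>M) = c * (\<integral>\<omega>. Y \<omega> * Y' \<omega> \<partial>M)"
    by (intro constant_cond_exp_integral_mult[OF F c]) (use Y Y' in auto)
  moreover have "(\<integral>\<omega>. (Z \<omega> * m \<omega>) * (Z' \<omega> * m' \<omega>) \<partial>M) = (\<integral>\<omega>. (Y \<omega> * Y' \<omega>) * (m \<omega> * m' \<omega>) \<partial>M)"
    by (rule integral_cong_AE[OF _ _ eq]) auto
  moreover have "(\<integral>\<omega>. Z \<omega> * Z' \<omega> \<partial>M) = (\<integral>\<omega>. Y \<omega> * Y' \<omega> \<partial>M)"
    using Y(2) Y'(2) by (intro integral_cong_AE) auto
  ultimately show ?thesis by simp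
qed

end

section \<open>Scheduling that is conditionally orthogonal given the past\<close>

text \<open>
  Here \<open>F t\<close> is the information available just before \<open>\<mu>(t)\<close>. The locale abstracts from what else,
  besides the earlier scheduling, this information comprises.
\<close>

locale orthogonal_scheduling = prob_space M for M :: "'a measure" +
  fixes n\<^sub>\<mu> :: nat and \<mu> :: "nat \<Rightarrow> int \<Rightarrow> 'a \<Rightarrow> real" and p :: "nat \<Rightarrow> real"
    and F :: "int \<Rightarrow> 'a measure"
  assumes subalg: "subalgebra M (F t)"
    and filtration: "s \<le> t \<Longrightarrow> sets (F s) \<subseteq> sets (F t)"
    and sched_measurable: "\<sigma> \<in> {1..n\<^sub>\<mu>} \<Longrightarrow> \<mu> \<sigma> t \<in> borel_measurable (F (t + 1))"
    and sched_orthogonal: "\<sigma> \<in> {1..n\<^sub>\<mu>} \<Longrightarrow> \<rho> \<in> {1..n\<^sub>\<mu>} \<Longrightarrow>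
      constant_cond_exp M (F t) (\<lambda>\<omega>. \<mu> \<sigma> t \<omega> * \<mu> \<rho> t \<omega>) (if \<sigma> = \<rho> then p \<sigma> else 0)"
    and p_pos: "\<sigma> \<in> {1..n\<^sub>\<mu>} \<Longrightarrow> 0 < p \<sigma>"
begin

abbreviation "H t \<equiv> L2_adapted M (F t)"

lemma measurable_F_mono: "s \<le> t \<Longrightarrow> Y \<in> borel_measurable (F s) \<Longrightarrow> Y \<in> borel_measurable (F t)"
  using filtration[of s t] subalg[of s] subalg[of t]
  by (auto simp: measurable_def subalgebra_def)

lemma adapted_mono: "s \<le> t \<Longrightarrow> Z \<in> H s \<Longrightarrow> Z \<in> H t"
  using measurable_F_mono by (auto simp: L2_adapted_def)

lemma sched_borel: "\<sigma> \<in> {1..n\<^sub>\<mu>} \<Longrightarrow> \<mu> \<sigma> t \<in> borel_measurable M"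
  by (rule measurable_from_subalg[OF subalg sched_measurable])

lemma mult_letter_L2:
  assumes "\<sigma> \<in> {1..n\<^sub>\<mu>}" "Z \<in> H t"
  shows "(\<lambda>\<omega>. Z \<omega> * \<mu> \<sigma> t \<omega>) \<in> L2 M"
  using L2_adapted_mult_L2[OF subalg sched_borel, of \<sigma> t t "p \<sigma>" Z]
    sched_orthogonal[of \<sigma> \<sigma> t] p_pos[of \<sigma>] assms by auto

lemma mult_letter_adapted:
  assumes "\<sigma> \<in> {1..n\<^sub>\<mu>}" "Z \<in> H t"
  shows "(\<lambda>\<omega>. Z \<omega> * \<mu> \<sigma> t \<omega>) \<in> H (t + 1)"
proof -
  obtain Y where "Y \<in> borel_measurable (F (t + 1))" "AE \<omega> in M. Z \<omega> = Y \<omega>"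
    using adapted_mono[of t "t + 1" Z] assms(2) by (auto simp: L2_adapted_def)
  then show ?thesis
    using mult_letter_L2[OF assms] sched_measurable[OF assms(1), of t]
    by (auto simp: L2_adapted_def intro!: bexI[of _ "\<lambda>\<omega>. Y \<omega> * \<mu> \<sigma> t \<omega>"])
qed

text \<open>
  Conditioning on \<open>F t\<close> replaces the product of the two letters by a constant. Up to scaling, the
  letters thus act on the past as isometries with orthogonal ranges, which drives all recursions over
  words.
\<close>

lemma mult_letter_inner:
  assumes "\<sigma> \<in> {1..n\<^sub>\<mu>}" "\<rho> \<in> {1..n\<^sub>\<mu>}" "Z \<in> H t" "Z' \<in> H t"
  shows "(\<integral>\<omega>. (Z \<omega> * \<mu> \<sigma> t \<omega>) * (Z' \<omega> * \<mu> \<rho> t \<omega>) \<partial>M) =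
    (if \<sigma> = \<rho> then p \<sigma> else 0) * (\<integral>\<omega>. Z \<omega> * Z' \<omega> \<partial>M)"
  by (rule L2_adapted_mult_inner[OF subalg sched_borel sched_borel sched_orthogonal])
     (use assms mult_letter_L2 in auto)

lemma mult_word_adapted:
  assumes "w \<in> words n\<^sub>\<mu>" "Z \<in> H t"
  shows "(\<lambda>\<omega>. Z \<omega> * sched_word \<mu> w (t + int (length w) - 1) \<omega>) \<in> H (t + int (length w))"
  using assms(1)
proof (induction w rule: rev_induct)
  case (snoc \<sigma> w)
  then have "(\<lambda>\<omega>. (Z \<omega> * sched_word \<mu> w (t + int (length w) - 1) \<omega>) * \<mu> \<sigma> (t + int (length w)) \<omega>)
      \<in> H (t + int (length w) + 1)"
    by (intro mult_letter_adapted) auto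
  then show ?case by (simp add: sched_word_snoc algebra_simps)
qed (use assms(2) in simp)

lemma mult_word_norm:
  assumes "w \<in> words n\<^sub>\<mu>" "Z \<in> H t"
  shows "(\<integral>\<omega>. (Z \<omega> * sched_word \<mu> w (t + int (length w) - 1) \<omega>)\<^sup>2 \<partial>M) =
    word_weight p w * (\<integral>\<omega>. (Z \<omega>)\<^sup>2 \<partial>M)"
  using assms(1)
proof (induction w rule: rev_induct)
  case (snoc \<sigma> w)
  let ?U = "\<lambda>\<omega>. Z \<omega> * sched_word \<mu> w (t + int (length w) - 1) \<omega>"
  have "?U \<in> H (t + int (length w))"
    using snoc.prems assms(2) by (intro mult_word_adapted) auto
  then have "(\<integral>\<omega>. (?U \<omega> * \<mu> \<sigma> (t + int (length w)) \<omega>) * (?U \<omega> * \<mu> \<sigma> (t + int (length w)) \<omega>) \<partial>M) =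
      p \<sigma> * (\<integral>\<omega>. ?U \<omega> * ?U \<omega> \<partial>M)"
    using mult_letter_inner[of \<sigma> \<sigma> ?U _ ?U] snoc.prems by auto
  also have "\<dots> = p \<sigma> * (word_weight p w * (\<integral>\<omega>. (Z \<omega>)\<^sup>2 \<partial>M))"
    using snoc by (simp add: power2_eq_square)
  finally show ?case by (simp add: sched_word_snoc power2_eq_square algebra_simps)
qed simp

end

section \<open>Admissible scheduling\<close>

lemma admissible_schedulingD:
  assumes "admissible_scheduling M n\<^sub>\<mu> \<mu> p"
  shows admissible_borel: "\<sigma> \<in> {1..n\<^sub>\<mu>} \<Longrightarrow> \<mu> \<sigma> t \<in> borel_measurable M"
    and admissible_pos: "\<sigma> \<in> {1..n\<^sub>\<mu>} \<Longrightarrow> 0 < p \<sigma>"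
    and admissible_words: "\<lbrakk>w \<in> nonempty_words n\<^sub>\<mu>; v \<in> nonempty_words n\<^sub>\<mu>; \<sigma> \<in> {1..n\<^sub>\<mu>}\<rbrakk> \<Longrightarrow>
        AE \<omega> in M. real_cond_exp M (sched_past M n\<^sub>\<mu> \<mu> t)
            (\<lambda>\<omega>. sched_word \<mu> (w @ [\<sigma>]) t \<omega> * sched_word \<mu> (v @ [\<sigma>]) t \<omega>) \<omega> =
          p \<sigma> * sched_word \<mu> w (t - 1) \<omega> * sched_word \<mu> v (t - 1) \<omega>"
    and admissible_letters: "\<lbrakk>\<sigma> \<in> {1..n\<^sub>\<mu>}; \<rho> \<in> {1..n\<^sub>\<mu>}; \<sigma> \<noteq> \<rho>\<rbrakk> \<Longrightarrow>
        AE \<omega> in M. real_cond_exp M (sched_past M n\<^sub>\<mu> \<mu> t) (\<lambda>\<omega>. \<mu> \<sigma> t \<omega> * \<mu> \<rho> t \<omega>) \<omega> = 0"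
    and admissible_affine: "\<exists>\<alpha>. \<forall>t. AE \<omega> in M. (\<Sum>\<sigma>\<in>{1..n\<^sub>\<mu>}. \<alpha> \<sigma> * \<mu> \<sigma> t \<omega>) = 1"
    and admissible_stationary: "\<lbrakk>w \<in> nonempty_words n\<^sub>\<mu>; v \<in> nonempty_words n\<^sub>\<mu>\<rbrakk> \<Longrightarrow>
        wide_sense_stationary M 2 (\<lambda>t \<omega>. vec_of_list [sched_word \<mu> w t \<omega>, sched_word \<mu> v t \<omega>])"
proof -
  note adm = assms[unfolded admissible_scheduling_def]
  note rest = adm[THEN conjunct2, THEN conjunct2]
  show "\<mu> \<sigma> t \<in> borel_measurable M" if "\<sigma> \<in> {1..n\<^sub>\<mu>}"
    by (rule adm[THEN conjunct1, rule_format, OF that])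
  show "0 < p \<sigma>" if "\<sigma> \<in> {1..n\<^sub>\<mu>}"
    by (rule adm[THEN conjunct2, THEN conjunct1, rule_format, OF that])
  show "AE \<omega> in M. real_cond_exp M (sched_past M n\<^sub>\<mu> \<mu> t)
            (\<lambda>\<omega>. sched_word \<mu> (w @ [\<sigma>]) t \<omega> * sched_word \<mu> (v @ [\<sigma>]) t \<omega>) \<omega> =
          p \<sigma> * sched_word \<mu> w (t - 1) \<omega> * sched_word \<mu> v (t - 1) \<omega>"
    if w: "w \<in> nonempty_words n\<^sub>\<mu>" "v \<in> nonempty_words n\<^sub>\<mu>" "\<sigma> \<in> {1..n\<^sub>\<mu>}"
    using rest[THEN conjunct1, THEN bspec, OF w(1), THEN bspec, OF w(2), THEN bspec, OF w(3),
        THEN bspec, OF w(3), THEN spec, of t]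
    by simp
  show "AE \<omega> in M. real_cond_exp M (sched_past M n\<^sub>\<mu> \<mu> t) (\<lambda>\<omega>. \<mu> \<sigma> t \<omega> * \<mu> \<rho> t \<omega>) \<omega> = 0"
    if "\<sigma> \<in> {1..n\<^sub>\<mu>}" "\<rho> \<in> {1..n\<^sub>\<mu>}" "\<sigma> \<noteq> \<rho>"
    by (rule rest[THEN conjunct2, THEN conjunct2, THEN conjunct1, rule_format, OF that])
  show "\<exists>\<alpha>. \<forall>t. AE \<omega> in M. (\<Sum>\<sigma>\<in>{1..n\<^sub>\<mu>}. \<alpha> \<sigma> * \<mu> \<sigma> t \<omega>) = 1"
    by (rule rest[THEN conjunct2, THEN conjunct2, THEN conjunct2, THEN conjunct1])
  show "wide_sense_stationary M 2 (\<lambda>t \<omega>. vec_of_list [sched_word \<mu> w t \<omega>, sched_word \<mu> v t \<omega>])"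
    if "w \<in> nonempty_words n\<^sub>\<mu>" "v \<in> nonempty_words n\<^sub>\<mu>"
    by (rule rest[THEN conjunct2, THEN conjunct2, THEN conjunct2, THEN conjunct2, rule_format, OF that])
qed

lemma admissible_word_L2:
  assumes "admissible_scheduling M n\<^sub>\<mu> \<mu> p" "w \<in> nonempty_words n\<^sub>\<mu>"
  shows "sched_word \<mu> w t \<in> L2 M"
proof -
  have "wide_sense_stationary M 2 (\<lambda>t \<omega>. vec_of_list [sched_word \<mu> w t \<omega>, sched_word \<mu> w t \<omega>])"
    by (rule admissible_stationary[OF assms(1,2,2)])
  then have "\<forall>i<2. (\<lambda>\<omega>. vec_of_list [sched_word \<mu> w t \<omega>, sched_word \<mu> w t \<omega>] $ i) \<in> L2 M"
    unfolding wide_sense_stationary_def square_integrable_vec_def by blast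
  from spec[OF this, of 0] show ?thesis by (simp add: vec_of_list_index)
qed

lemma subalgebra_sched_past:
  "admissible_scheduling M n\<^sub>\<mu> \<mu> p \<Longrightarrow> subalgebra M (sched_past M n\<^sub>\<mu> \<mu> t)"
  unfolding sched_past_def by (rule subalgebra_gen_sigma) (auto intro: admissible_borel)

lemma subalgebra_sched_future:
  "admissible_scheduling M n\<^sub>\<mu> \<mu> p \<Longrightarrow> subalgebra M (sched_future M n\<^sub>\<mu> \<mu> t)"
  unfolding sched_future_def by (rule subalgebra_gen_sigma) (auto intro: admissible_borel)

text \<open>
  For equal letters the definition only gives \<open>E[\<mu>\<^sub>\<rho>(t)\<^sup>2 \<mu>\<^sub>a(t - 1) \<mu>\<^sub>b(t - 1) | past] = p\<^sub>\<rho> \<mu>\<^sub>a(t - 1) \<mu>\<^sub>b(t - 1)\<close>. Summing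
  with the weights \<open>\<alpha>\<^sub>a \<alpha>\<^sub>b\<close> of the relation \<open>\<Sum>\<^sub>a \<alpha>\<^sub>a \<mu>\<^sub>a(t - 1) = 1\<close> removes the earlier letters.
\<close>

lemma (in prob_space) admissible_orthogonal_past:
  assumes adm: "admissible_scheduling M n\<^sub>\<mu> \<mu> p" and \<sigma>: "\<sigma> \<in> {1..n\<^sub>\<mu>}" and \<rho>: "\<rho> \<in> {1..n\<^sub>\<mu>}"
  shows "constant_cond_exp M (sched_past M n\<^sub>\<mu> \<mu> t) (\<lambda>\<omega>. \<mu> \<sigma> t \<omega> * \<mu> \<rho> t \<omega>)
    (if \<sigma> = \<rho> then p \<sigma> else 0)"
proof -
  let ?P = "sched_past M n\<^sub>\<mu> \<mu> t"
  have P: "subalgebra M ?P" by (rule subalgebra_sched_past[OF adm])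
  interpret S: sigma_finite_subalgebra M ?P by (rule sigma_finite_subalgebra_of_subalgebra[OF P])
  have one: "[a] \<in> nonempty_words n\<^sub>\<mu>" if "a \<in> {1..n\<^sub>\<mu>}" for a
    using that by (auto simp: nonempty_words_def)
  have two: "[a] @ [b] \<in> nonempty_words n\<^sub>\<mu>" if "a \<in> {1..n\<^sub>\<mu>}" "b \<in> {1..n\<^sub>\<mu>}" for a b
    using that by (auto simp: nonempty_words_def)
  have L: "\<mu> a s \<in> L2 M" if "a \<in> {1..n\<^sub>\<mu>}" for a s
  proof -
    have "sched_word \<mu> [a] s = \<mu> a s" by (rule ext) simp
    then show ?thesis using admissible_word_L2[OF adm one[OF that], of s] by simp
  qed
  have int: "integrable M (\<lambda>\<omega>. \<mu> a s \<omega> * \<mu> b s' \<omega>)" if "a \<in> {1..n\<^sub>\<mu>}" "b \<in> {1..n\<^sub>\<mu>}" for a b s s'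
    by (rule L2_integrable_mult[OF L[OF that(1)] L[OF that(2)]])
  show ?thesis
  proof (cases "\<sigma> = \<rho>")
    case False
    then have "AE \<omega> in M. real_cond_exp M ?P (\<lambda>\<omega>. \<mu> \<sigma> t \<omega> * \<mu> \<rho> t \<omega>) \<omega> = 0"
      by (rule admissible_letters[OF adm \<sigma> \<rho>])
    then show ?thesis
      using False constant_cond_exp_iff[OF P int[OF \<sigma> \<rho>]] by simp
  next
    case True
    obtain \<alpha> where \<alpha>: "AE \<omega> in M. (\<Sum>a\<in>{1..n\<^sub>\<mu>}. \<alpha> a * \<mu> a (t - 1) \<omega>) = 1"
      using admissible_affine[OF adm] by blast
    let ?W = "\<lambda>a b \<omega>. sched_word \<mu> ([a] @ [\<rho>]) t \<omega> * sched_word \<mu> ([b] @ [\<rho>]) t \<omega>"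
    let ?V = "\<lambda>a b \<omega>. \<mu> a (t - 1) \<omega> * \<mu> b (t - 1) \<omega>"
    have V: "integrable M (?V a b)" if "a \<in> {1..n\<^sub>\<mu>}" "b \<in> {1..n\<^sub>\<mu>}" for a b
      by (rule int[OF that])
    have W: "integrable M (?W a b)" if "a \<in> {1..n\<^sub>\<mu>}" "b \<in> {1..n\<^sub>\<mu>}" for a b
      by (rule L2_integrable_mult[OF admissible_word_L2[OF adm two[OF that(1) \<rho>]]
          admissible_word_L2[OF adm two[OF that(2) \<rho>]]])
    have ce: "AE \<omega> in M. real_cond_exp M ?P (?W a b) \<omega> = p \<rho> * ?V a b \<omega>"
      if "a \<in> {1..n\<^sub>\<mu>}" "b \<in> {1..n\<^sub>\<mu>}" for a b
      using admissible_words[OF adm one[OF that(1)] one[OF that(2)] \<rho>, of t]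
      by (simp add: mult.assoc)
    have "(\<integral>\<omega>. indicator D \<omega> * (\<mu> \<rho> t \<omega> * \<mu> \<rho> t \<omega>) \<partial>M) = p \<rho> * measure M D" if D: "D \<in> sets ?P" for D
    proof -
      have DM[measurable]: "D \<in> sets M" using D P by (auto simp: subalgebra_def)
      have ind: "integrable M (\<lambda>\<omega>. indicator D \<omega> * f \<omega> :: real)" if "integrable M f" for f
        using integrable_mult_indicator[OF DM that] by simp
      have dsum: "(\<integral>\<omega>. (\<Sum>a\<in>{1..n\<^sub>\<mu>}. \<Sum>b\<in>{1..n\<^sub>\<mu>}. \<alpha> a * \<alpha> b * (indicator D \<omega> * f a b \<omega>)) \<partial>M) =
          (\<Sum>a\<in>{1..n\<^sub>\<mu>}. \<Sum>b\<in>{1..n\<^sub>\<mu>}. \<alpha> a * \<alpha> b * (\<integral>\<omega>. indicator D \<omega> * f a b \<omega> \<partial>M))"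
        "(\<lambda>\<omega>. \<Sum>a\<in>{1..n\<^sub>\<mu>}. \<Sum>b\<in>{1..n\<^sub>\<mu>}. \<alpha> a * \<alpha> b * (indicator D \<omega> * f a b \<omega>)) \<in> borel_measurable M"
        if f: "\<And>a b. a \<in> {1..n\<^sub>\<mu>} \<Longrightarrow> b \<in> {1..n\<^sub>\<mu>} \<Longrightarrow> integrable M (f a b)"
        for f :: "nat \<Rightarrow> nat \<Rightarrow> 'a \<Rightarrow> real"
      proof -
        have i: "integrable M (\<lambda>\<omega>. \<alpha> a * \<alpha> b * (indicator D \<omega> * f a b \<omega>))"
          if "a \<in> {1..n\<^sub>\<mu>}" "b \<in> {1..n\<^sub>\<mu>}" for a b
          by (rule integrable_mult_right[OF ind[OF f[OF that]]])
        show "(\<lambda>\<omega>. \<Sum>a\<in>{1..n\<^sub>\<mu>}. \<Sum>b\<in>{1..n\<^sub>\<mu>}. \<alpha> a * \<alpha> b * (indicator D \<omega> * f a b \<omega>)) \<in> borel_measurable M"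
          by (intro borel_measurable_sum borel_measurable_integrable[OF i])
        show "(\<integral>\<omega>. (\<Sum>a\<in>{1..n\<^sub>\<mu>}. \<Sum>b\<in>{1..n\<^sub>\<mu>}. \<alpha> a * \<alpha> b * (indicator D \<omega> * f a b \<omega>)) \<partial>M) =
          (\<Sum>a\<in>{1..n\<^sub>\<mu>}. \<Sum>b\<in>{1..n\<^sub>\<mu>}. \<alpha> a * \<alpha> b * (\<integral>\<omega>. indicator D \<omega> * f a b \<omega> \<partial>M))"
          by (subst Bochner_Integration.integral_sum[OF Bochner_Integration.integrable_sum[OF i]],
              assumption, assumption, intro sum.cong refl,
              subst Bochner_Integration.integral_sum[OF i], assumption, assumption, simp)
      qed
      have ab: "(\<integral>\<omega>. indicator D \<omega> * ?W a b \<omega> \<partial>M) = p \<rho> * (\<integral>\<omega>. indicator D \<omega> * ?V a b \<omega> \<partial>M)"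
        if "a \<in> {1..n\<^sub>\<mu>}" "b \<in> {1..n\<^sub>\<mu>}" for a b
      proof -
        have "(\<integral>\<omega>. indicator D \<omega> * ?W a b \<omega> \<partial>M) = (\<integral>\<omega>. indicator D \<omega> * real_cond_exp M ?P (?W a b) \<omega> \<partial>M)"
          using S.real_cond_exp_intA[OF W[OF that] D] by (simp add: set_lebesgue_integral_def)
        also have "\<dots> = (\<integral>\<omega>. indicator D \<omega> * (p \<rho> * ?V a b \<omega>) \<partial>M)"
          using ce[OF that] that int[OF that] by (intro integral_cong_AE) auto
        also have "\<dots> = p \<rho> * (\<integral>\<omega>. indicator D \<omega> * ?V a b \<omega> \<partial>M)"
          by (simp add: mult.left_commute)
        finally show ?thesis .
      qed
      have "(\<integral>\<omega>. indicator D \<omega> * (\<mu> \<rho> t \<omega> * \<mu> \<rho> t \<omega>) \<partial>M) =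
        (\<integral>\<omega>. (\<Sum>a\<in>{1..n\<^sub>\<mu>}. \<Sum>b\<in>{1..n\<^sub>\<mu>}. \<alpha> a * \<alpha> b * (indicator D \<omega> * ?W a b \<omega>)) \<partial>M)"
      proof (rule integral_cong_AE)
        show "AE \<omega> in M. indicator D \<omega> * (\<mu> \<rho> t \<omega> * \<mu> \<rho> t \<omega>) =
          (\<Sum>a\<in>{1..n\<^sub>\<mu>}. \<Sum>b\<in>{1..n\<^sub>\<mu>}. \<alpha> a * \<alpha> b * (indicator D \<omega> * ?W a b \<omega>))"
          using \<alpha>
        proof eventually_elim
          case (elim \<omega>)
          have "(\<Sum>a\<in>{1..n\<^sub>\<mu>}. \<Sum>b\<in>{1..n\<^sub>\<mu>}. \<alpha> a * \<alpha> b * (indicator D \<omega> * ?W a b \<omega>)) =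
            (\<Sum>a\<in>{1..n\<^sub>\<mu>}. \<alpha> a * \<mu> a (t - 1) \<omega>) * (\<Sum>b\<in>{1..n\<^sub>\<mu>}. \<alpha> b * \<mu> b (t - 1) \<omega>) *
            (indicator D \<omega> * (\<mu> \<rho> t \<omega> * \<mu> \<rho> t \<omega>))"
            unfolding sum_product unfolding sum_distrib_right sched_word_snoc
            by (intro sum.cong refl) (simp add: mult_ac)
          then show ?case using elim by simp
        qed
      next
        show "(\<lambda>\<omega>. indicator D \<omega> * (\<mu> \<rho> t \<omega> * \<mu> \<rho> t \<omega>)) \<in> borel_measurable M"
          by (rule borel_measurable_integrable[OF ind[OF int[OF \<rho> \<rho>]]])
      qed (rule dsum(2)[OF W])
      also have "\<dots> = (\<Sum>a\<in>{1..n\<^sub>\<mu>}. \<Sum>b\<in>{1..n\<^sub>\<mu>}. \<alpha> a * \<alpha> b * (p \<rho> * (\<integral>\<omega>. indicator D \<omega> * ?V a b \<omega> \<partial>M)))"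
        by (subst dsum(1)[OF W], assumption, assumption) (intro sum.cong refl, simp only: ab)
      also have "\<dots> = p \<rho> * (\<Sum>a\<in>{1..n\<^sub>\<mu>}. \<Sum>b\<in>{1..n\<^sub>\<mu>}. \<alpha> a * \<alpha> b * (\<integral>\<omega>. indicator D \<omega> * ?V a b \<omega> \<partial>M))"
        unfolding sum_distrib_left by (intro sum.cong refl) (simp only: mult_ac)
      finally have eq: "(\<integral>\<omega>. indicator D \<omega> * (\<mu> \<rho> t \<omega> * \<mu> \<rho> t \<omega>) \<partial>M) =
        p \<rho> * (\<Sum>a\<in>{1..n\<^sub>\<mu>}. \<Sum>b\<in>{1..n\<^sub>\<mu>}. \<alpha> a * \<alpha> b * (\<integral>\<omega>. indicator D \<omega> * ?V a b \<omega> \<partial>M))" .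
      have eq2: "(\<Sum>a\<in>{1..n\<^sub>\<mu>}. \<Sum>b\<in>{1..n\<^sub>\<mu>}. \<alpha> a * \<alpha> b * (\<integral>\<omega>. indicator D \<omega> * ?V a b \<omega> \<partial>M)) =
        (\<integral>\<omega>. (\<Sum>a\<in>{1..n\<^sub>\<mu>}. \<Sum>b\<in>{1..n\<^sub>\<mu>}. \<alpha> a * \<alpha> b * (indicator D \<omega> * ?V a b \<omega>)) \<partial>M)"
        by (subst dsum(1)[OF V], assumption, assumption) (rule refl)
      have eq3: "(\<integral>\<omega>. (\<Sum>a\<in>{1..n\<^sub>\<mu>}. \<Sum>b\<in>{1..n\<^sub>\<mu>}. \<alpha> a * \<alpha> b * (indicator D \<omega> * ?V a b \<omega>)) \<partial>M) =
        (\<integral>\<omega>. indicator D \<omega> \<partial>M)"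
      proof (rule integral_cong_AE)
        show "AE \<omega> in M. (\<Sum>a\<in>{1..n\<^sub>\<mu>}. \<Sum>b\<in>{1..n\<^sub>\<mu>}. \<alpha> a * \<alpha> b * (indicator D \<omega> * ?V a b \<omega>)) = indicator D \<omega>"
        proof (rule eventually_mono[OF \<alpha>])
          fix \<omega> assume elim: "(\<Sum>a\<in>{1..n\<^sub>\<mu>}. \<alpha> a * \<mu> a (t - 1) \<omega>) = 1"
          have "(\<Sum>a\<in>{1..n\<^sub>\<mu>}. \<Sum>b\<in>{1..n\<^sub>\<mu>}. \<alpha> a * \<alpha> b * (indicator D \<omega> * ?V a b \<omega>)) =
            (\<Sum>a\<in>{1..n\<^sub>\<mu>}. \<alpha> a * \<mu> a (t - 1) \<omega>) * (\<Sum>b\<in>{1..n\<^sub>\<mu>}. \<alpha> b * \<mu> b (t - 1) \<omega>) * indicator D \<omega>"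
            unfolding sum_product unfolding sum_distrib_right
            by (intro sum.cong refl) (simp add: mult_ac)
          then show "(\<Sum>a\<in>{1..n\<^sub>\<mu>}. \<Sum>b\<in>{1..n\<^sub>\<mu>}. \<alpha> a * \<alpha> b * (indicator D \<omega> * ?V a b \<omega>)) = indicator D \<omega>"
            unfolding elim by simp
        qed
      next
        show "(\<lambda>\<omega>. \<Sum>a\<in>{1..n\<^sub>\<mu>}. \<Sum>b\<in>{1..n\<^sub>\<mu>}. \<alpha> a * \<alpha> b * (indicator D \<omega> * ?V a b \<omega>)) \<in> borel_measurable M"
          by (rule dsum(2)[OF V])
        show "(indicator D :: 'a \<Rightarrow> real) \<in> borel_measurable M"
          by (rule borel_measurable_indicator[OF DM])
      qed
      show ?thesis unfolding eq eq2 eq3 using DM by simp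
    qed
    then show ?thesis
      using True int[OF \<rho> \<rho>] by (simp add: constant_cond_exp_def)
  qed
qed

section \<open>The past of a process that is ZMWSII\<close>

definition process_past ::
  "'a measure \<Rightarrow> nat \<Rightarrow> 'a sched \<Rightarrow> nat \<Rightarrow> 'a vproc \<Rightarrow> int \<Rightarrow> 'a measure" where
  "process_past M n\<^sub>\<mu> \<mu> n r t = gen_sigma M
     ({(\<lambda>\<omega>. r k \<omega> $ i) | k i. k \<le> t \<and> i < n} \<union> {\<mu> \<sigma> k | \<sigma> k. \<sigma> \<in> {1..n\<^sub>\<mu>} \<and> k < t})"

lemma ZMWSII_D:
  assumes "ZMWSII M n\<^sub>\<mu> \<mu> p n r"
  shows ZMWSII_borel: "i < n \<Longrightarrow> (\<lambda>\<omega>. r t \<omega> $ i) \<in> borel_measurable M"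
    and ZMWSII_cond_indep: "cond_indep M (gen_sigma M {(\<lambda>\<omega>. r k \<omega> $ i) | k i. k \<le> t \<and> i < n})
            (sched_future M n\<^sub>\<mu> \<mu> t) (sched_past M n\<^sub>\<mu> \<mu> t)"
    and ZMWSII_L2: "i < n \<Longrightarrow> (\<lambda>\<omega>. r t \<omega> $ i) \<in> L2 M"
proof -
  note z = assms[unfolded ZMWSII_def]
  show "(\<lambda>\<omega>. r t \<omega> $ i) \<in> borel_measurable M" if "i < n"
    using z[THEN conjunct1] that by (simp add: vector_process_def random_vec_def)
  show "cond_indep M (gen_sigma M {(\<lambda>\<omega>. r k \<omega> $ i) | k i. k \<le> t \<and> i < n})
            (sched_future M n\<^sub>\<mu> \<mu> t) (sched_past M n\<^sub>\<mu> \<mu> t)"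
    by (rule z[THEN conjunct2, THEN conjunct1, THEN spec])
  show "(\<lambda>\<omega>. r t \<omega> $ i) \<in> L2 M" if "i < n"
    using z[THEN conjunct2, THEN conjunct2, THEN conjunct1, THEN spec, of t] that
    by (simp add: square_integrable_vec_def)
qed

context prob_space
begin

text \<open>
  Conditional independence of the process and the future scheduling lets the process join the
  conditioning sigma-algebra; the identity is checked on the pi-system of intersections of an event
  of the process with an event of the past scheduling.
\<close>

lemma ZMWSII_sched_orthogonal:
  assumes adm: "admissible_scheduling M n\<^sub>\<mu> \<mu> p" and z: "ZMWSII M n\<^sub>\<mu> \<mu> p n r"
    and \<sigma>: "\<sigma> \<in> {1..n\<^sub>\<mu>}" and \<rho>: "\<rho> \<in> {1..n\<^sub>\<mu>}"
  shows "constant_cond_exp M (process_past M n\<^sub>\<mu> \<mu> n r t) (\<lambda>\<omega>. \<mu> \<sigma> t \<omega> * \<mu> \<rho> t \<omega>)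
    (if \<sigma> = \<rho> then p \<sigma> else 0)"
proof -
  let ?R = "gen_sigma M {(\<lambda>\<omega>. r k \<omega> $ i) | k i. k \<le> t \<and> i < n}"
  let ?P = "sched_past M n\<^sub>\<mu> \<mu> t" and ?G = "sched_future M n\<^sub>\<mu> \<mu> t"
  let ?E = "{A \<inter> B | A B. A \<in> sets ?R \<and> B \<in> sets ?P}"
  have R: "subalgebra M ?R"
    by (rule subalgebra_gen_sigma) (use ZMWSII_borel[OF z] in auto)
  have P: "subalgebra M ?P" by (rule subalgebra_sched_past[OF adm])
  have G: "subalgebra M ?G" by (rule subalgebra_sched_future[OF adm])
  note orth = admissible_orthogonal_past[OF adm \<sigma> \<rho>, of t]
  have m: "\<mu> a t \<in> borel_measurable ?G" if "a \<in> {1..n\<^sub>\<mu>}" for a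
    unfolding sched_future_def by (rule gen_sigma_measurable) (use that in auto)
  have RP: "A \<in> sets M" "B \<in> sets M" if "A \<in> sets ?R" "B \<in> sets ?P" for A B
    using that R P by (auto simp: subalgebra_def)
  show ?thesis
  proof (rule constant_cond_exp_sigma_sets)
    show "Int_stable ?E"
    proof (rule Int_stableI)
      fix a b assume "a \<in> ?E" "b \<in> ?E"
      then obtain A B A' B' where ab: "a = A \<inter> B" "b = A' \<inter> B'"
        "A \<in> sets ?R" "B \<in> sets ?P" "A' \<in> sets ?R" "B' \<in> sets ?P" by blast
      then have "a \<inter> b = (A \<inter> A') \<inter> (B \<inter> B')" "A \<inter> A' \<in> sets ?R" "B \<inter> B' \<in> sets ?P"
        by auto
      then show "a \<inter> b \<in> ?E" by blast
    qed
    show "?E \<subseteq> sets M" using RP by blast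
    have "space M \<in> sets ?R" "space M \<in> sets ?P"
      using sets.top[of ?R] sets.top[of ?P] R P unfolding subalgebra_def by simp_all
    then show "space M \<in> ?E" by blast
    show "integrable M (\<lambda>\<omega>. \<mu> \<sigma> t \<omega> * \<mu> \<rho> t \<omega>)"
      using orth by (simp add: constant_cond_exp_def)
    show "sets (process_past M n\<^sub>\<mu> \<mu> n r t) \<subseteq> sigma_sets (space M) ?E"
      unfolding process_past_def sched_past_def by (rule sets_gen_sigma_Un)
    fix D assume "D \<in> ?E"
    then obtain A B where D: "D = A \<inter> B" "A \<in> sets ?R" "B \<in> sets ?P" by blast
    show "(\<integral>\<omega>. indicator D \<omega> * (\<mu> \<sigma> t \<omega> * \<mu> \<rho> t \<omega>) \<partial>M) =
      (if \<sigma> = \<rho> then p \<sigma> else 0) * measure M D"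
      unfolding D(1)
      by (rule cond_indep_constant_cond_exp[OF R G P ZMWSII_cond_indep[OF z]
          borel_measurable_times[OF m[OF \<sigma>] m[OF \<rho>]] orth D(2,3)])
  qed
qed

lemma ZMWSII_orthogonal_scheduling:
  assumes adm: "admissible_scheduling M n\<^sub>\<mu> \<mu> p" and z: "ZMWSII M n\<^sub>\<mu> \<mu> p n r"
  shows "orthogonal_scheduling M n\<^sub>\<mu> \<mu> p (process_past M n\<^sub>\<mu> \<mu> n r)"
proof unfold_locales
  show "subalgebra M (process_past M n\<^sub>\<mu> \<mu> n r t)" for t
    unfolding process_past_def
    by (rule subalgebra_gen_sigma) (use ZMWSII_borel[OF z] admissible_borel[OF adm] in auto)
  show "sets (process_past M n\<^sub>\<mu> \<mu> n r s) \<subseteq> sets (process_past M n\<^sub>\<mu> \<mu> n r t)" if "s \<le> t" for s t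
  proof -
    have "{(\<lambda>\<omega>. r k \<omega> $ i) | k i. k \<le> s \<and> i < n} \<subseteq> {(\<lambda>\<omega>. r k \<omega> $ i) | k i. k \<le> t \<and> i < n}"
      "{\<mu> \<sigma> k | \<sigma> k. \<sigma> \<in> {1..n\<^sub>\<mu>} \<and> k < s} \<subseteq> {\<mu> \<sigma> k | \<sigma> k. \<sigma> \<in> {1..n\<^sub>\<mu>} \<and> k < t}"
      using that order_trans[of _ s t] less_le_trans[of _ s t] by blast+
    then show ?thesis
      unfolding process_past_def by (intro sets_gen_sigma_mono Un_mono)
  qed
  show "\<mu> \<sigma> t \<in> borel_measurable (process_past M n\<^sub>\<mu> \<mu> n r (t + 1))" if "\<sigma> \<in> {1..n\<^sub>\<mu>}" for \<sigma> t
    unfolding process_past_def by (rule gen_sigma_measurable) (use that in force)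
qed (use ZMWSII_sched_orthogonal[OF adm z] admissible_pos[OF adm] in auto)

lemma ZMWSII_adapted:
  assumes z: "ZMWSII M n\<^sub>\<mu> \<mu> p n r" and i: "i < n"
  shows "(\<lambda>\<omega>. r t \<omega> $ i) \<in> L2_adapted M (process_past M n\<^sub>\<mu> \<mu> n r t)"
proof -
  have "(\<lambda>\<omega>. r t \<omega> $ i) \<in> borel_measurable (process_past M n\<^sub>\<mu> \<mu> n r t)"
    unfolding process_past_def by (rule gen_sigma_measurable) (use i in auto)
  then show ?thesis
    using ZMWSII_L2[OF z i] by (auto simp: L2_adapted_def)
qed

end

section \<open>Innovations and their correlations with later outputs\<close>

text \<open>
  The matrix \<open>E[r(\<tau> + |w|) (e(\<tau>) \<mu>\<^sub>w(\<tau> + |w| - 1))\<^sup>T]\<close>, that is, \<open>E[r(t) (z\<^sup>e\<^sub>w(t))\<^sup>T]\<close> without the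
  normalizing factor. The innovation stays at the fixed time \<open>\<tau>\<close> while the word grows, so that
  the recursions below relate correlations with one and the same random vector \<open>e(\<tau>)\<close>.
\<close>

definition lag_corr ::
  "'a measure \<Rightarrow> 'a sched \<Rightarrow> int \<Rightarrow> nat \<Rightarrow> nat \<Rightarrow> 'a vproc \<Rightarrow> 'a vproc \<Rightarrow> nat list \<Rightarrow> real mat" where
  "lag_corr M \<mu> \<tau> k q r e w = mat k q (\<lambda>(a, b).
     \<integral>\<omega>. r (\<tau> + int (length w)) \<omega> $ a * (e \<tau> \<omega> $ b * sched_word \<mu> w (\<tau> + int (length w) - 1) \<omega>) \<partial>M)"

lemma lag_corr_carrier [simp]: "lag_corr M \<mu> \<tau> k q r e w \<in> carrier_mat k q"
  by (simp add: lag_corr_def)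

lemma lag_corr_index:
  "a < k \<Longrightarrow> b < q \<Longrightarrow> lag_corr M \<mu> \<tau> k q r e w $$ (a, b) =
     (\<integral>\<omega>. r (\<tau> + int (length w)) \<omega> $ a *
       (e \<tau> \<omega> $ b * sched_word \<mu> w (\<tau> + int (length w) - 1) \<omega>) \<partial>M)"
  by (simp add: lag_corr_def)

text \<open>
  The innovation differs from the output by an element of the closed span of the past outputs.
\<close>

lemma innovation_in_closed_subspace:
  assumes e: "innovation_process M n\<^sub>\<mu> \<mu> p q y e" and j: "j < q"
    and S: "L2_closed_subspace M S" "(\<lambda>\<omega>. y t \<omega> $ j) \<in> S" "output_past n\<^sub>\<mu> \<mu> p q y t \<subseteq> S"
  shows "(\<lambda>\<omega>. e t \<omega> $ j) \<in> S"
proof -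
  have eb: "(\<lambda>\<omega>. e t \<omega> $ j) \<in> borel_measurable M"
    using e j by (simp add: innovation_process_def vector_process_def random_vec_def)
  from e j obtain P where P: "is_lin_proj M (output_past n\<^sub>\<mu> \<mu> p q y t) (\<lambda>\<omega>. y t \<omega> $ j) P"
    and eq: "AE \<omega> in M. e t \<omega> $ j = y t \<omega> $ j - P \<omega>"
    unfolding innovation_process_def by blast
  have "P \<in> L2_closed_subspace M hull output_past n\<^sub>\<mu> \<mu> p q y t"
    using P by (simp only: is_lin_proj_def)
  moreover have "L2_closed_subspace M hull output_past n\<^sub>\<mu> \<mu> p q y t \<subseteq> S"
    by (rule hull_minimal) (rule S)+
  ultimately have "P \<in> S" by (rule subsetD[rotated])
  then have "(\<lambda>\<omega>. y t \<omega> $ j - P \<omega>) \<in> S"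
    by (rule L2_closed_subspace_diff[OF S(1,2)])
  then show ?thesis
    by (rule L2_closed_subspace_cong_AE[OF S(1) _ eb]) (use eq in auto)
qed

lemma innovation_unique:
  assumes "innovation_process M n\<^sub>\<mu> \<mu> p q y e" "innovation_process M n\<^sub>\<mu> \<mu> p q y e'" "j < q"
  shows "AE \<omega> in M. e t \<omega> $ j = e' t \<omega> $ j"
proof -
  from assms(1,3) obtain P where P: "is_lin_proj M (output_past n\<^sub>\<mu> \<mu> p q y t) (\<lambda>\<omega>. y t \<omega> $ j) P"
    and eq: "AE \<omega> in M. e t \<omega> $ j = y t \<omega> $ j - P \<omega>"
    unfolding innovation_process_def by blast
  from assms(2,3) obtain P' where P': "is_lin_proj M (output_past n\<^sub>\<mu> \<mu> p q y t) (\<lambda>\<omega>. y t \<omega> $ j) P'"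
    and eq': "AE \<omega> in M. e' t \<omega> $ j = y t \<omega> $ j - P' \<omega>"
    unfolding innovation_process_def by blast
  from is_lin_proj_unique[OF P P'] eq eq' show ?thesis by eventually_elim simp
qed

lemma scalar_prod_sum: "i < dim_row B \<Longrightarrow> u \<in> carrier_vec (dim_col B) \<Longrightarrow>
  (B *\<^sub>v u) $ i = (\<Sum>j<dim_col B. B $$ (i, j) * u $ j)"
  by (simp add: scalar_prod_def atLeast0LessThan)

section \<open>Realizations with arbitrary noise\<close>

text \<open>
  The filtration consists of the state and the noise up to the present and the scheduling strictly
  before it.
\<close>

locale lpv_realization = prob_space M for M :: "'a measure" +
  fixes n\<^sub>\<mu> :: nat and \<mu> :: "nat \<Rightarrow> int \<Rightarrow> 'a \<Rightarrow> real" and p :: "nat \<Rightarrow> real"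
    and n m q :: nat and A K :: "nat \<Rightarrow> real mat" and C F :: "real mat" and x v y :: "'a vproc"
  assumes adm: "admissible_scheduling M n\<^sub>\<mu> \<mu> p"
    and ssa: "asLPV_SSA M n\<^sub>\<mu> \<mu> p n m q A K C F x v y"
begin

lemma ssa_matrices: "lpv_matrices n\<^sub>\<mu> n m q A K C F"
  and ssa_x: "vector_process M n x" and ssa_v: "vector_process M m v" and ssa_y: "vector_process M q y"
  and ssa_state: "\<And>t. AE \<omega> in M. x (t + 1) \<omega> =
        vec n (\<lambda>j. \<Sum>i\<in>{1..n\<^sub>\<mu>}. (A i *\<^sub>v x t \<omega> + K i *\<^sub>v v t \<omega>) $ j * \<mu> i t \<omega>)"
  and ssa_output: "\<And>t. AE \<omega> in M. y t \<omega> = C *\<^sub>v x t \<omega> + F *\<^sub>v v t \<omega>"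
  and ssa_ZMWSII: "ZMWSII M n\<^sub>\<mu> \<mu> p (n + m) (\<lambda>t \<omega>. x t \<omega> @\<^sub>v v t \<omega>)"
  and ssa_xv: "\<And>\<sigma> t. \<sigma> \<in> {1..n\<^sub>\<mu>} \<Longrightarrow> corr_mat M n m (zproc \<mu> p x [\<sigma>] t) (zproc \<mu> p v [\<sigma>] t) = 0\<^sub>m n m"
  and ssa_vx: "\<And>w t. w \<in> nonempty_words n\<^sub>\<mu> \<Longrightarrow> corr_mat M m n (v t) (zproc \<mu> p x w t) = 0\<^sub>m m n"
  and ssa_vv: "\<And>w t. w \<in> nonempty_words n\<^sub>\<mu> \<Longrightarrow> corr_mat M m m (v t) (zproc \<mu> p v w t) = 0\<^sub>m m m"
  using ssa unfolding asLPV_SSA_def by simp_all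

sublocale orthogonal_scheduling M n\<^sub>\<mu> \<mu> p
  "process_past M n\<^sub>\<mu> \<mu> (n + m) (\<lambda>t \<omega>. x t \<omega> @\<^sub>v v t \<omega>)"
  by (rule ZMWSII_orthogonal_scheduling[OF adm ssa_ZMWSII])

lemma closed_H: "L2_closed_subspace M (H t)"
  by (rule L2_closed_subspace_adapted)

lemma carrier_x: "\<omega> \<in> space M \<Longrightarrow> x t \<omega> \<in> carrier_vec n"
  and carrier_v: "\<omega> \<in> space M \<Longrightarrow> v t \<omega> \<in> carrier_vec m"
  and carrier_y: "\<omega> \<in> space M \<Longrightarrow> y t \<omega> \<in> carrier_vec q"
  using ssa_x ssa_v ssa_y by (auto simp: vector_process_def random_vec_def)

lemma borel_x: "i < n \<Longrightarrow> (\<lambda>\<omega>. x t \<omega> $ i) \<in> borel_measurable M"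
  and borel_v: "i < m \<Longrightarrow> (\<lambda>\<omega>. v t \<omega> $ i) \<in> borel_measurable M"
  and borel_y: "i < q \<Longrightarrow> (\<lambda>\<omega>. y t \<omega> $ i) \<in> borel_measurable M"
  using ssa_x ssa_v ssa_y by (auto simp: vector_process_def random_vec_def)

lemma x_adapted: assumes "i < n" shows "(\<lambda>\<omega>. x t \<omega> $ i) \<in> H t"
proof (rule L2_closed_subspace_cong_AE[OF closed_H])
  show "(\<lambda>\<omega>. (x t \<omega> @\<^sub>v v t \<omega>) $ i) \<in> H t"
    by (rule ZMWSII_adapted[OF ssa_ZMWSII]) (use assms in simp)
  have "(x t \<omega> @\<^sub>v v t \<omega>) $ i = x t \<omega> $ i" if "\<omega> \<in> space M" for \<omega>
    using carrier_x[OF that, of t] carrier_v[OF that, of t] assms by simp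
  then show "AE \<omega> in M. (x t \<omega> @\<^sub>v v t \<omega>) $ i = x t \<omega> $ i"
    by (rule AE_I2)
qed (rule borel_x[OF assms])

lemma v_adapted: assumes "i < m" shows "(\<lambda>\<omega>. v t \<omega> $ i) \<in> H t"
proof (rule L2_closed_subspace_cong_AE[OF closed_H])
  show "(\<lambda>\<omega>. (x t \<omega> @\<^sub>v v t \<omega>) $ (n + i)) \<in> H t"
    by (rule ZMWSII_adapted[OF ssa_ZMWSII]) (use assms in simp)
  have "(x t \<omega> @\<^sub>v v t \<omega>) $ (n + i) = v t \<omega> $ i" if "\<omega> \<in> space M" for \<omega>
    using carrier_x[OF that, of t] carrier_v[OF that, of t] assms by simp
  then show "AE \<omega> in M. (x t \<omega> @\<^sub>v v t \<omega>) $ (n + i) = v t \<omega> $ i"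
    by (rule AE_I2)
qed (rule borel_v[OF assms])

lemma state_AE:
  assumes "a < n"
  shows "AE \<omega> in M. x (t + 1) \<omega> $ a = (\<Sum>\<sigma>\<in>{1..n\<^sub>\<mu>}.
    ((\<Sum>j<n. A \<sigma> $$ (a, j) * x t \<omega> $ j) + (\<Sum>j<m. K \<sigma> $$ (a, j) * v t \<omega> $ j)) * \<mu> \<sigma> t \<omega>)"
  using ssa_state[of t] AE_space
proof eventually_elim
  case (elim \<omega>)
  have "(A \<sigma> *\<^sub>v x t \<omega> + K \<sigma> *\<^sub>v v t \<omega>) $ a =
      (\<Sum>j<n. A \<sigma> $$ (a, j) * x t \<omega> $ j) + (\<Sum>j<m. K \<sigma> $$ (a, j) * v t \<omega> $ j)"
    if "\<sigma> \<in> {1..n\<^sub>\<mu>}" for \<sigma>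
  proof -
    have "A \<sigma> \<in> carrier_mat n n" "K \<sigma> \<in> carrier_mat n m"
      using ssa_matrices that by (auto simp: lpv_matrices_def)
    then show ?thesis
      using assms scalar_prod_sum[of a "A \<sigma>" "x t \<omega>"] scalar_prod_sum[of a "K \<sigma>" "v t \<omega>"]
        carrier_x[OF elim(2), of t] carrier_v[OF elim(2), of t] by auto
  qed
  then show ?case
    unfolding elim(1) using assms by simp
qed

lemma output_AE:
  assumes "a < q"
  shows "AE \<omega> in M. y t \<omega> $ a =
    (\<Sum>j<n. C $$ (a, j) * x t \<omega> $ j) + (\<Sum>j<m. F $$ (a, j) * v t \<omega> $ j)"
  using ssa_output[of t] AE_space
proof eventually_elim
  case (elim \<omega>)
  have "C \<in> carrier_mat q n" "F \<in> carrier_mat q m"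
    using ssa_matrices by (auto simp: lpv_matrices_def)
  then show ?case
    unfolding elim(1)
    using assms scalar_prod_sum[of a C "x t \<omega>"] scalar_prod_sum[of a F "v t \<omega>"]
      carrier_x[OF elim(2), of t] carrier_v[OF elim(2), of t] by auto
qed

lemma comb_adapted:
  "(\<lambda>\<omega>. (\<Sum>j<n. B $$ (a, j) * x t \<omega> $ j) + (\<Sum>j<m. D $$ (a, j) * v t \<omega> $ j)) \<in> H t"
  by (intro L2_closed_subspace_add[OF closed_H] L2_closed_subspace_sum[OF closed_H])
     (auto intro: x_adapted v_adapted)

lemma y_adapted: assumes "i < q" shows "(\<lambda>\<omega>. y t \<omega> $ i) \<in> H t"
  by (rule L2_closed_subspace_cong_AE[OF closed_H comb_adapted borel_y[OF assms]])
     (use output_AE[OF assms, of t] in auto)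

lemma comb_inner:
  assumes "U \<in> L2 M"
  shows "(\<integral>\<omega>. ((\<Sum>j<n. B $$ (a, j) * x t \<omega> $ j) + (\<Sum>j<m. D $$ (a, j) * v t \<omega> $ j)) * U \<omega> \<partial>M) =
    (\<Sum>j<n. B $$ (a, j) * (\<integral>\<omega>. x t \<omega> $ j * U \<omega> \<partial>M)) +
    (\<Sum>j<m. D $$ (a, j) * (\<integral>\<omega>. v t \<omega> $ j * U \<omega> \<partial>M))"
proof -
  have xi: "integrable M (\<lambda>\<omega>. B $$ (a, j) * (x t \<omega> $ j * U \<omega>))" if "j \<in> {..<n}" for j
    using that by (intro integrable_mult_right L2_integrable_mult[OF L2_adaptedD[OF x_adapted] assms]) auto
  have vi: "integrable M (\<lambda>\<omega>. D $$ (a, j) * (v t \<omega> $ j * U \<omega>))" if "j \<in> {..<m}" for j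
    using that by (intro integrable_mult_right L2_integrable_mult[OF L2_adaptedD[OF v_adapted] assms]) auto
  have "(\<integral>\<omega>. ((\<Sum>j<n. B $$ (a, j) * x t \<omega> $ j) + (\<Sum>j<m. D $$ (a, j) * v t \<omega> $ j)) * U \<omega> \<partial>M) =
    (\<integral>\<omega>. (\<Sum>j<n. B $$ (a, j) * (x t \<omega> $ j * U \<omega>)) + (\<Sum>j<m. D $$ (a, j) * (v t \<omega> $ j * U \<omega>)) \<partial>M)"
    by (simp add: distrib_right sum_distrib_right mult.assoc)
  also have "\<dots> = (\<integral>\<omega>. (\<Sum>j<n. B $$ (a, j) * (x t \<omega> $ j * U \<omega>)) \<partial>M) +
      (\<integral>\<omega>. (\<Sum>j<m. D $$ (a, j) * (v t \<omega> $ j * U \<omega>)) \<partial>M)"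
    by (rule Bochner_Integration.integral_add) (rule Bochner_Integration.integrable_sum, (rule xi vi), assumption)+
  also have "(\<integral>\<omega>. (\<Sum>j<n. B $$ (a, j) * (x t \<omega> $ j * U \<omega>)) \<partial>M) =
      (\<Sum>j<n. B $$ (a, j) * (\<integral>\<omega>. x t \<omega> $ j * U \<omega> \<partial>M))"
    using Bochner_Integration.integral_sum[of "{..<n}" M, OF xi] by simp
  also have "(\<integral>\<omega>. (\<Sum>j<m. D $$ (a, j) * (v t \<omega> $ j * U \<omega>)) \<partial>M) =
      (\<Sum>j<m. D $$ (a, j) * (\<integral>\<omega>. v t \<omega> $ j * U \<omega> \<partial>M))"
    using Bochner_Integration.integral_sum[of "{..<m}" M, OF vi] by simp
  finally show ?thesis .
qed

lemma nonempty_words_weight: "w \<in> nonempty_words n\<^sub>\<mu> \<Longrightarrow> 0 < word_weight p w"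
  by (rule word_weight_pos[of n\<^sub>\<mu>]) (use p_pos in \<open>auto simp: nonempty_words_def\<close>)

lemma zproc_index:
  "r (t - int (length w)) \<omega> \<in> carrier_vec k \<Longrightarrow> j < k \<Longrightarrow>
    zproc \<mu> p r w t \<omega> $ j =
      1 / sqrt (word_weight p w) * (r (t - int (length w)) \<omega> $ j * sched_word \<mu> w (t - 1) \<omega>)"
  by (simp add: zproc_def)

lemma noise_orthogonal_state:
  assumes w: "w \<in> nonempty_words n\<^sub>\<mu>" and i: "i < m" and j: "j < n"
  shows "(\<integral>\<omega>. v t \<omega> $ i * (x (t - int (length w)) \<omega> $ j * sched_word \<mu> w (t - 1) \<omega>) \<partial>M) = 0"
proof -
  have "0 = corr_mat M m n (v t) (zproc \<mu> p x w t) $$ (i, j)"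
    using ssa_vx[OF w, of t] i j by simp
  also have "\<dots> = (\<integral>\<omega>. v t \<omega> $ i * zproc \<mu> p x w t \<omega> $ j \<partial>M)"
    using i j by (simp add: corr_mat_def)
  also have "\<dots> = (\<integral>\<omega>. 1 / sqrt (word_weight p w) *
      (v t \<omega> $ i * (x (t - int (length w)) \<omega> $ j * sched_word \<mu> w (t - 1) \<omega>)) \<partial>M)"
    by (rule Bochner_Integration.integral_cong) (use zproc_index[OF carrier_x j] in auto)
  finally show ?thesis
    using nonempty_words_weight[OF w] by simp
qed

lemma noise_orthogonal_noise:
  assumes w: "w \<in> nonempty_words n\<^sub>\<mu>" and i: "i < m" and j: "j < m"
  shows "(\<integral>\<omega>. v t \<omega> $ i * (v (t - int (length w)) \<omega> $ j * sched_word \<mu> w (t - 1) \<omega>) \<partial>M) = 0"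
proof -
  have "0 = corr_mat M m m (v t) (zproc \<mu> p v w t) $$ (i, j)"
    using ssa_vv[OF w, of t] i j by simp
  also have "\<dots> = (\<integral>\<omega>. v t \<omega> $ i * zproc \<mu> p v w t \<omega> $ j \<partial>M)"
    using i j by (simp add: corr_mat_def)
  also have "\<dots> = (\<integral>\<omega>. 1 / sqrt (word_weight p w) *
      (v t \<omega> $ i * (v (t - int (length w)) \<omega> $ j * sched_word \<mu> w (t - 1) \<omega>)) \<partial>M)"
    by (rule Bochner_Integration.integral_cong) (use zproc_index[OF carrier_v j] in auto)
  finally show ?thesis
    using nonempty_words_weight[OF w] by simp
qed

end

context lpv_realization
begin

text \<open>
  The random variables of time \<open>s\<close> that, weighted by the scheduling word \<open>w\<close>, are orthogonal to the
  noise \<open>|w|\<close> steps later. Being a closed subspace, this set contains the innovation as soon as it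
  contains the output and its past.
\<close>

definition noise_null :: "nat list \<Rightarrow> nat \<Rightarrow> int \<Rightarrow> ('a \<Rightarrow> real) set" where
  "noise_null w i s = {Z \<in> H s.
     (\<integral>\<omega>. v (s + int (length w)) \<omega> $ i *
       (Z \<omega> * sched_word \<mu> w (s + int (length w) - 1) \<omega>) \<partial>M) = 0}"

lemma nonempty_words_words: "w \<in> nonempty_words n\<^sub>\<mu> \<Longrightarrow> w \<in> words n\<^sub>\<mu>"
  by (simp add: nonempty_words_def)

lemma noise_null_closed:
  assumes w: "w \<in> words n\<^sub>\<mu>" and i: "i < m"
  shows "L2_closed_subspace M (noise_null w i s)"
  unfolding noise_null_def
  by (rule L2_closed_subspace_multiplier_annihilator[OF closed_H L2_adaptedD[OF v_adapted[OF i]]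
      L2_adaptedD[OF mult_word_adapted[OF w]] mult_word_norm[OF w]])

lemma x_noise_null:
  assumes "w \<in> nonempty_words n\<^sub>\<mu>" "i < m" "j < n"
  shows "(\<lambda>\<omega>. x s \<omega> $ j) \<in> noise_null w i s"
  using noise_orthogonal_state[OF assms, of "s + int (length w)"] x_adapted[OF assms(3)]
  by (simp add: noise_null_def)

lemma v_noise_null:
  assumes "w \<in> nonempty_words n\<^sub>\<mu>" "i < m" "j < m"
  shows "(\<lambda>\<omega>. v s \<omega> $ j) \<in> noise_null w i s"
  using noise_orthogonal_noise[OF assms, of "s + int (length w)"] v_adapted[OF assms(3)]
  by (simp add: noise_null_def)

lemma y_noise_null:
  assumes w: "w \<in> nonempty_words n\<^sub>\<mu>" and i: "i < m" and j: "j < q"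
  shows "(\<lambda>\<omega>. y s \<omega> $ j) \<in> noise_null w i s"
proof -
  have c: "L2_closed_subspace M (noise_null w i s)"
    by (rule noise_null_closed[OF nonempty_words_words[OF w] i])
  show ?thesis
  proof (rule L2_closed_subspace_cong_AE[OF c])
    show "(\<lambda>\<omega>. (\<Sum>k<n. C $$ (j, k) * x s \<omega> $ k) + (\<Sum>k<m. F $$ (j, k) * v s \<omega> $ k)) \<in> noise_null w i s"
      by (intro L2_closed_subspace_add[OF c] L2_closed_subspace_sum[OF c])
         (auto intro: x_noise_null[OF w i] v_noise_null[OF w i])
    show "AE \<omega> in M. (\<Sum>k<n. C $$ (j, k) * x s \<omega> $ k) + (\<Sum>k<m. F $$ (j, k) * v s \<omega> $ k) = y s \<omega> $ j"
      using output_AE[OF j, of s] by eventually_elim simp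
  qed (rule borel_y[OF j])
qed

lemma output_past_scaled:
  assumes w: "w \<in> nonempty_words n\<^sub>\<mu>" and j: "j < q"
  shows "AE \<omega> in M. 1 / sqrt (word_weight p w) *
    (y (s - int (length w)) \<omega> $ j * sched_word \<mu> w (s - 1) \<omega>) = zproc \<mu> p y w s \<omega> $ j"
  by (rule AE_I2) (simp add: zproc_index[OF carrier_y j])

lemma output_past_borel:
  assumes w: "w \<in> nonempty_words n\<^sub>\<mu>" and j: "j < q"
  shows "(\<lambda>\<omega>. zproc \<mu> p y w s \<omega> $ j) \<in> borel_measurable M"
proof -
  have "(\<lambda>\<omega>. y (s - int (length w)) \<omega> $ j * sched_word \<mu> w (s - int (length w) + int (length w) - 1) \<omega>)
      \<in> borel_measurable M"
    by (rule L2D(1)[OF L2_adaptedD[OF mult_word_adapted[OF nonempty_words_words[OF w] y_adapted[OF j]]]])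
  then have "(\<lambda>\<omega>. 1 / sqrt (word_weight p w) *
    (y (s - int (length w)) \<omega> $ j * sched_word \<mu> w (s - 1) \<omega>)) \<in> borel_measurable M"
    by simp
  then show ?thesis
    by (rule measurable_cong[THEN iffD1, rotated]) (simp add: zproc_index[OF carrier_y j])
qed

lemma output_past_adapted: "output_past n\<^sub>\<mu> \<mu> p q y s \<subseteq> H s"
proof
  fix Z assume "Z \<in> output_past n\<^sub>\<mu> \<mu> p q y s"
  then obtain w j where Z: "Z = (\<lambda>\<omega>. zproc \<mu> p y w s \<omega> $ j)" and w: "w \<in> nonempty_words n\<^sub>\<mu>" and j: "j < q"
    by (auto simp: output_past_def)
  show "Z \<in> H s"
    unfolding Z
  proof (rule L2_closed_subspace_cong_AE[OF closed_H L2_closed_subspace_scale[OF closed_H]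
        output_past_borel[OF w j] output_past_scaled[OF w j]])
    show "(\<lambda>\<omega>. y (s - int (length w)) \<omega> $ j * sched_word \<mu> w (s - 1) \<omega>) \<in> H s"
      using mult_word_adapted[OF nonempty_words_words[OF w] y_adapted[OF j], of "s - int (length w)"]
      by simp
  qed
qed

text \<open>
  A past output is \<open>y(s - |u|)\<close> times the word \<open>u\<close>; weighting it further by \<open>w\<close> yields \<open>y(s - |u|)\<close>
  times the word \<open>uw\<close>, which is covered by the orthogonality of noise and output.
\<close>

lemma output_past_noise_null:
  assumes w: "w \<in> nonempty_words n\<^sub>\<mu>" and i: "i < m"
  shows "output_past n\<^sub>\<mu> \<mu> p q y s \<subseteq> noise_null w i s"
proof
  fix Z assume ZP: "Z \<in> output_past n\<^sub>\<mu> \<mu> p q y s"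
  then obtain u j where Z: "Z = (\<lambda>\<omega>. zproc \<mu> p y u s \<omega> $ j)" and u: "u \<in> nonempty_words n\<^sub>\<mu>" and j: "j < q"
    by (auto simp: output_past_def)
  have c: "L2_closed_subspace M (noise_null w i s)"
    by (rule noise_null_closed[OF nonempty_words_words[OF w] i])
  have uw: "u @ w \<in> nonempty_words n\<^sub>\<mu>"
    using u w by (auto simp: nonempty_words_def)
  \<comment> \<open>Multiplying by the products over \<open>u\<close> and then \<open>w\<close> amounts to multiplying by the one over \<open>uw\<close>.\<close>
  have "(\<integral>\<omega>. v (s + int (length w)) \<omega> $ i * (y (s - int (length u)) \<omega> $ j *
      sched_word \<mu> u (s - 1) \<omega> * sched_word \<mu> w (s + int (length w) - 1) \<omega>) \<partial>M) = 0"
    using y_noise_null[OF uw i j, of "s - int (length u)"]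
    by (simp add: noise_null_def sched_word_append mult.assoc)
  moreover have "(\<lambda>\<omega>. y (s - int (length u)) \<omega> $ j * sched_word \<mu> u (s - 1) \<omega>) \<in> H s"
    using mult_word_adapted[OF nonempty_words_words[OF u] y_adapted[OF j], of "s - int (length u)"]
    by simp
  ultimately have "(\<lambda>\<omega>. y (s - int (length u)) \<omega> $ j * sched_word \<mu> u (s - 1) \<omega>) \<in> noise_null w i s"
    by (simp add: noise_null_def)
  then show "Z \<in> noise_null w i s"
    unfolding Z
    by (rule L2_closed_subspace_cong_AE[OF c L2_closed_subspace_scale[OF c]
        output_past_borel[OF u j] output_past_scaled[OF u j]])
qed

context
  fixes e :: "'a vproc"
  assumes e: "innovation_process M n\<^sub>\<mu> \<mu> p q y e"
begin

lemma innovation_adapted: "j < q \<Longrightarrow> (\<lambda>\<omega>. e t \<omega> $ j) \<in> H t"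
  by (rule innovation_in_closed_subspace[OF e _ closed_H y_adapted output_past_adapted])

lemma noise_orthogonal_innovation:
  assumes w: "w \<in> nonempty_words n\<^sub>\<mu>"
  shows "lag_corr M \<mu> \<tau> m q v e w = 0\<^sub>m m q"
proof (rule eq_matI)
  fix i j assume ij: "i < dim_row (0\<^sub>m m q :: real mat)" "j < dim_col (0\<^sub>m m q :: real mat)"
  then have i: "i < m" and j: "j < q" by auto
  have "(\<lambda>\<omega>. e \<tau> \<omega> $ j) \<in> noise_null w i \<tau>"
    by (rule innovation_in_closed_subspace[OF e j noise_null_closed[OF nonempty_words_words[OF w] i]
        y_noise_null[OF w i j] output_past_noise_null[OF w i]])
  then show "lag_corr M \<mu> \<tau> m q v e w $$ (i, j) = 0\<^sub>m m q $$ (i, j)"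
    using i j by (simp add: lag_corr_index noise_null_def)
qed (simp_all add: lag_corr_def)

text \<open>
  Substituting the state equation gives a sum over all letters \<open>\<sigma>\<close> of terms with the factor
  \<open>\<mu>\<^sub>\<sigma> \<mu>\<^sub>\<rho>\<close> at the same instant, of which only \<open>\<sigma> = \<rho>\<close> contributes.
\<close>

lemma lag_corr_state_snoc:
  assumes w: "w \<in> words n\<^sub>\<mu>" and \<rho>: "\<rho> \<in> {1..n\<^sub>\<mu>}"
  shows "lag_corr M \<mu> \<tau> n q x e (w @ [\<rho>]) =
    p \<rho> \<cdot>\<^sub>m (A \<rho> * lag_corr M \<mu> \<tau> n q x e w + K \<rho> * lag_corr M \<mu> \<tau> m q v e w)"
proof (rule eq_matI)
  have car: "A \<rho> \<in> carrier_mat n n" "K \<rho> \<in> carrier_mat n m"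
    using ssa_matrices \<rho> by (auto simp: lpv_matrices_def)
  fix a b
  assume "a < dim_row (p \<rho> \<cdot>\<^sub>m (A \<rho> * lag_corr M \<mu> \<tau> n q x e w + K \<rho> * lag_corr M \<mu> \<tau> m q v e w))"
    "b < dim_col (p \<rho> \<cdot>\<^sub>m (A \<rho> * lag_corr M \<mu> \<tau> n q x e w + K \<rho> * lag_corr M \<mu> \<tau> m q v e w))"
  then have a: "a < n" and b: "b < q"
    using car by (auto simp: lag_corr_def)
  let ?t = "\<tau> + int (length w)"
  let ?U = "\<lambda>\<omega>. e \<tau> \<omega> $ b * sched_word \<mu> w (?t - 1) \<omega>"
  let ?Z = "\<lambda>\<sigma> \<omega>. (\<Sum>j<n. A \<sigma> $$ (a, j) * x ?t \<omega> $ j) + (\<Sum>j<m. K \<sigma> $$ (a, j) * v ?t \<omega> $ j)"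
  have U: "?U \<in> H ?t" by (rule mult_word_adapted[OF w innovation_adapted[OF b]])
  have Z: "?Z \<sigma> \<in> H ?t" for \<sigma> by (rule comb_adapted)
  have int: "integrable M (\<lambda>\<omega>. (?Z \<sigma> \<omega> * \<mu> \<sigma> ?t \<omega>) * (?U \<omega> * \<mu> \<rho> ?t \<omega>))" if "\<sigma> \<in> {1..n\<^sub>\<mu>}" for \<sigma>
    by (rule L2_integrable_mult[OF mult_letter_L2[OF that Z] mult_letter_L2[OF \<rho> U]])
  have "lag_corr M \<mu> \<tau> n q x e (w @ [\<rho>]) $$ (a, b) =
      (\<integral>\<omega>. x (?t + 1) \<omega> $ a * (?U \<omega> * \<mu> \<rho> ?t \<omega>) \<partial>M)"
    using a b by (simp add: lag_corr_index sched_word_snoc algebra_simps)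
  also have "\<dots> = (\<integral>\<omega>. (\<Sum>\<sigma>\<in>{1..n\<^sub>\<mu>}. (?Z \<sigma> \<omega> * \<mu> \<sigma> ?t \<omega>) * (?U \<omega> * \<mu> \<rho> ?t \<omega>)) \<partial>M)"
  proof (rule integral_cong_AE)
    show "(\<lambda>\<omega>. x (?t + 1) \<omega> $ a * (?U \<omega> * \<mu> \<rho> ?t \<omega>)) \<in> borel_measurable M"
      by (rule borel_measurable_times[OF borel_x[OF a] L2D(1)[OF mult_letter_L2[OF \<rho> U]]])
    show "(\<lambda>\<omega>. \<Sum>\<sigma>\<in>{1..n\<^sub>\<mu>}. (?Z \<sigma> \<omega> * \<mu> \<sigma> ?t \<omega>) * (?U \<omega> * \<mu> \<rho> ?t \<omega>)) \<in> borel_measurable M"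
      by (rule borel_measurable_sum, rule borel_measurable_integrable, rule int)
    show "AE \<omega> in M. x (?t + 1) \<omega> $ a * (?U \<omega> * \<mu> \<rho> ?t \<omega>) =
        (\<Sum>\<sigma>\<in>{1..n\<^sub>\<mu>}. (?Z \<sigma> \<omega> * \<mu> \<sigma> ?t \<omega>) * (?U \<omega> * \<mu> \<rho> ?t \<omega>))"
      using state_AE[OF a, of ?t] by eventually_elim (simp only: sum_distrib_right)
  qed
  also have "\<dots> = (\<Sum>\<sigma>\<in>{1..n\<^sub>\<mu>}. (\<integral>\<omega>. (?Z \<sigma> \<omega> * \<mu> \<sigma> ?t \<omega>) * (?U \<omega> * \<mu> \<rho> ?t \<omega>) \<partial>M))"
    by (rule Bochner_Integration.integral_sum) (rule int)
  also have "\<dots> = (\<Sum>\<sigma>\<in>{1..n\<^sub>\<mu>}. if \<sigma> = \<rho> then p \<rho> * (\<integral>\<omega>. ?Z \<rho> \<omega> * ?U \<omega> \<partial>M) else 0)"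
    by (intro sum.cong refl, subst mult_letter_inner[OF _ \<rho> Z U]) auto
  also have "\<dots> = p \<rho> * (\<integral>\<omega>. ?Z \<rho> \<omega> * ?U \<omega> \<partial>M)"
    using \<rho> by simp
  also have "(\<integral>\<omega>. ?Z \<rho> \<omega> * ?U \<omega> \<partial>M) =
      (\<Sum>j<n. A \<rho> $$ (a, j) * lag_corr M \<mu> \<tau> n q x e w $$ (j, b)) +
      (\<Sum>j<m. K \<rho> $$ (a, j) * lag_corr M \<mu> \<tau> m q v e w $$ (j, b))"
    using b by (simp add: comb_inner[OF L2_adaptedD[OF U]] lag_corr_index)
  also have "\<dots> = (A \<rho> * lag_corr M \<mu> \<tau> n q x e w + K \<rho> * lag_corr M \<mu> \<tau> m q v e w) $$ (a, b)"
    using a b car by (simp add: scalar_prod_def atLeast0LessThan lag_corr_def)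
  also have "p \<rho> * \<dots> =
      (p \<rho> \<cdot>\<^sub>m (A \<rho> * lag_corr M \<mu> \<tau> n q x e w + K \<rho> * lag_corr M \<mu> \<tau> m q v e w)) $$ (a, b)"
    using a b car by (simp add: lag_corr_def)
  finally show "lag_corr M \<mu> \<tau> n q x e (w @ [\<rho>]) $$ (a, b) =
      (p \<rho> \<cdot>\<^sub>m (A \<rho> * lag_corr M \<mu> \<tau> n q x e w + K \<rho> * lag_corr M \<mu> \<tau> m q v e w)) $$ (a, b)" .
next
  have "A \<rho> \<in> carrier_mat n n" "K \<rho> \<in> carrier_mat n m"
    using ssa_matrices \<rho> by (auto simp: lpv_matrices_def)
  then show "dim_row (lag_corr M \<mu> \<tau> n q x e (w @ [\<rho>])) =
      dim_row (p \<rho> \<cdot>\<^sub>m (A \<rho> * lag_corr M \<mu> \<tau> n q x e w + K \<rho> * lag_corr M \<mu> \<tau> m q v e w))"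
    "dim_col (lag_corr M \<mu> \<tau> n q x e (w @ [\<rho>])) =
      dim_col (p \<rho> \<cdot>\<^sub>m (A \<rho> * lag_corr M \<mu> \<tau> n q x e w + K \<rho> * lag_corr M \<mu> \<tau> m q v e w))"
    by (auto simp: lag_corr_def)
qed

lemma lag_corr_output:
  assumes w: "w \<in> words n\<^sub>\<mu>"
  shows "lag_corr M \<mu> \<tau> q q y e w = C * lag_corr M \<mu> \<tau> n q x e w + F * lag_corr M \<mu> \<tau> m q v e w"
proof (rule eq_matI)
  have car: "C \<in> carrier_mat q n" "F \<in> carrier_mat q m"
    using ssa_matrices by (auto simp: lpv_matrices_def)
  show "dim_row (lag_corr M \<mu> \<tau> q q y e w) = dim_row (C * lag_corr M \<mu> \<tau> n q x e w + F * lag_corr M \<mu> \<tau> m q v e w)"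
    "dim_col (lag_corr M \<mu> \<tau> q q y e w) = dim_col (C * lag_corr M \<mu> \<tau> n q x e w + F * lag_corr M \<mu> \<tau> m q v e w)"
    using car by (auto simp: lag_corr_def)
  fix a b
  assume "a < dim_row (C * lag_corr M \<mu> \<tau> n q x e w + F * lag_corr M \<mu> \<tau> m q v e w)"
    "b < dim_col (C * lag_corr M \<mu> \<tau> n q x e w + F * lag_corr M \<mu> \<tau> m q v e w)"
  then have a: "a < q" and b: "b < q"
    using car by (auto simp: lag_corr_def)
  let ?t = "\<tau> + int (length w)"
  let ?U = "\<lambda>\<omega>. e \<tau> \<omega> $ b * sched_word \<mu> w (?t - 1) \<omega>"
  have U: "?U \<in> L2 M" by (rule L2_adaptedD[OF mult_word_adapted[OF w innovation_adapted[OF b]]])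
  have "lag_corr M \<mu> \<tau> q q y e w $$ (a, b) = (\<integral>\<omega>. y ?t \<omega> $ a * ?U \<omega> \<partial>M)"
    using a b by (simp add: lag_corr_index)
  also have "\<dots> = (\<integral>\<omega>. ((\<Sum>j<n. C $$ (a, j) * x ?t \<omega> $ j) + (\<Sum>j<m. F $$ (a, j) * v ?t \<omega> $ j)) * ?U \<omega> \<partial>M)"
  proof (rule integral_cong_AE)
    show "(\<lambda>\<omega>. y ?t \<omega> $ a * ?U \<omega>) \<in> borel_measurable M"
      by (rule borel_measurable_times[OF borel_y[OF a] L2D(1)[OF U]])
    show "(\<lambda>\<omega>. ((\<Sum>j<n. C $$ (a, j) * x ?t \<omega> $ j) + (\<Sum>j<m. F $$ (a, j) * v ?t \<omega> $ j)) * ?U \<omega>)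
        \<in> borel_measurable M"
      by (rule borel_measurable_times[OF L2D(1)[OF L2_adaptedD[OF comb_adapted]] L2D(1)[OF U]])
    show "AE \<omega> in M. y ?t \<omega> $ a * ?U \<omega> =
        ((\<Sum>j<n. C $$ (a, j) * x ?t \<omega> $ j) + (\<Sum>j<m. F $$ (a, j) * v ?t \<omega> $ j)) * ?U \<omega>"
      using output_AE[OF a, of ?t] by eventually_elim (simp only:)
  qed
  also have "\<dots> = (\<Sum>j<n. C $$ (a, j) * lag_corr M \<mu> \<tau> n q x e w $$ (j, b)) +
      (\<Sum>j<m. F $$ (a, j) * lag_corr M \<mu> \<tau> m q v e w $$ (j, b))"
    using b by (simp add: comb_inner[OF U] lag_corr_index)
  also have "\<dots> = (C * lag_corr M \<mu> \<tau> n q x e w + F * lag_corr M \<mu> \<tau> m q v e w) $$ (a, b)"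
    using a b car by (simp add: scalar_prod_def atLeast0LessThan lag_corr_def)
  finally show "lag_corr M \<mu> \<tau> q q y e w $$ (a, b) =
    (C * lag_corr M \<mu> \<tau> n q x e w + F * lag_corr M \<mu> \<tau> m q v e w) $$ (a, b)" .
qed

end

end

lemma word_mat_carrier:
  assumes "\<And>\<sigma>. \<sigma> \<in> {1..k} \<Longrightarrow> A \<sigma> \<in> carrier_mat n n" "w \<in> words k"
  shows "word_mat n A w \<in> carrier_mat n n"
  using assms(2) by (induction w) (auto intro!: mult_carrier_mat assms(1))

lemma word_mat_snoc:
  assumes "\<And>\<sigma>. \<sigma> \<in> {1..k} \<Longrightarrow> A \<sigma> \<in> carrier_mat n n" "w \<in> words k" "\<rho> \<in> {1..k}"
  shows "word_mat n A (w @ [\<rho>]) = A \<rho> * word_mat n A w"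
  using assms(2)
proof (induction w)
  case Nil
  then show ?case using assms(1)[OF assms(3)] by simp
next
  case (Cons \<sigma> w)
  then have "A \<rho> \<in> carrier_mat n n" "word_mat n A w \<in> carrier_mat n n" "A \<sigma> \<in> carrier_mat n n"
    using word_mat_carrier[OF assms(1)] assms(1,3) by auto
  then show ?case using Cons by (simp add: assoc_mult_mat[of _ n n _ n _ n])
qed

lemma smult_mat_cancel:
  fixes c :: real
  assumes "c \<noteq> 0" "c \<cdot>\<^sub>m X = c \<cdot>\<^sub>m Y"
  shows "X = Y"
proof -
  have "(1 / c) \<cdot>\<^sub>m (c \<cdot>\<^sub>m X) = (1 / c) \<cdot>\<^sub>m (c \<cdot>\<^sub>m Y)" by (simp only: assms(2))
  moreover have "(1 / c) \<cdot>\<^sub>m (c \<cdot>\<^sub>m Z) = Z" for Z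
    using assms(1) by (intro eq_matI) auto
  ultimately show ?thesis by simp
qed

context lpv_realization
begin

lemma carrier_A: "\<sigma> \<in> {1..n\<^sub>\<mu>} \<Longrightarrow> A \<sigma> \<in> carrier_mat n n"
  and carrier_K: "\<sigma> \<in> {1..n\<^sub>\<mu>} \<Longrightarrow> K \<sigma> \<in> carrier_mat n m"
  and carrier_C: "C \<in> carrier_mat q n" and carrier_F: "F \<in> carrier_mat q m"
  using ssa_matrices by (auto simp: lpv_matrices_def)

text \<open>
  The matrix \<open>E[(A\<^sub>\<sigma> x(\<tau>) + K\<^sub>\<sigma> v(\<tau>)) e(\<tau>)\<^sup>T]\<close>. Up to normalization by the innovation
  covariance it is the input matrix of a deterministic system attached to the realization.
\<close>

definition input_corr :: "'a vproc \<Rightarrow> int \<Rightarrow> nat \<Rightarrow> real mat" where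
  "input_corr e \<tau> \<sigma> = A \<sigma> * lag_corr M \<mu> \<tau> n q x e [] + K \<sigma> * lag_corr M \<mu> \<tau> m q v e []"

lemma input_corr_carrier: "\<sigma> \<in> {1..n\<^sub>\<mu>} \<Longrightarrow> input_corr e \<tau> \<sigma> \<in> carrier_mat n q"
  unfolding input_corr_def
  by (intro add_carrier_mat mult_carrier_mat[OF carrier_K]) simp_all

text \<open>
  The noise contributes only at the first letter: afterwards it is orthogonal to the weighted
  innovation.
\<close>

lemma lag_corr_state_word:
  assumes e: "innovation_process M n\<^sub>\<mu> \<mu> p q y e" and \<sigma>: "\<sigma> \<in> {1..n\<^sub>\<mu>}" and s: "s \<in> words n\<^sub>\<mu>"
  shows "lag_corr M \<mu> \<tau> n q x e (\<sigma> # s) =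
    word_weight p (\<sigma> # s) \<cdot>\<^sub>m (word_mat n A s * input_corr e \<tau> \<sigma>)"
  using s
proof (induction s rule: rev_induct)
  case Nil
  show ?case
    using lag_corr_state_snoc[OF e words_Nil \<sigma>, of \<tau>] input_corr_carrier[OF \<sigma>, of e \<tau>]
    by (simp add: input_corr_def[symmetric])
next
  case (snoc \<rho> s)
  then have s: "s \<in> words n\<^sub>\<mu>" and \<rho>: "\<rho> \<in> {1..n\<^sub>\<mu>}" by auto
  let ?c = "word_weight p (\<sigma> # s)" and ?W = "word_mat n A s" and ?B = "input_corr e \<tau> \<sigma>"
  have W: "?W \<in> carrier_mat n n" by (rule word_mat_carrier[OF carrier_A s])
  note B = input_corr_carrier[OF \<sigma>, of e \<tau>]
  have "\<sigma> # s \<in> words n\<^sub>\<mu>" and ne: "\<sigma> # s \<in> nonempty_words n\<^sub>\<mu>"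
    using \<sigma> s by (auto simp: nonempty_words_def)
  then have "lag_corr M \<mu> \<tau> n q x e (\<sigma> # s @ [\<rho>]) =
      p \<rho> \<cdot>\<^sub>m (A \<rho> * lag_corr M \<mu> \<tau> n q x e (\<sigma> # s) + K \<rho> * lag_corr M \<mu> \<tau> m q v e (\<sigma> # s))"
    using lag_corr_state_snoc[OF e, of "\<sigma> # s" \<rho> \<tau>] \<rho> by simp
  also have "\<dots> = p \<rho> \<cdot>\<^sub>m (A \<rho> * (?c \<cdot>\<^sub>m (?W * ?B)) + K \<rho> * 0\<^sub>m m q)"
    by (simp only: snoc.IH[OF s] noise_orthogonal_innovation[OF e ne])
  also have "K \<rho> * 0\<^sub>m m q = 0\<^sub>m n q"
    by (rule right_mult_zero_mat[OF carrier_K[OF \<rho>]])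
  also have "A \<rho> * (?c \<cdot>\<^sub>m (?W * ?B)) = ?c \<cdot>\<^sub>m (A \<rho> * (?W * ?B))"
    by (rule mult_smult_distrib[OF carrier_A[OF \<rho>] mult_carrier_mat[OF W B]])
  also have "A \<rho> * (?W * ?B) = word_mat n A (s @ [\<rho>]) * ?B"
    by (simp only: word_mat_snoc[OF carrier_A s \<rho>] assoc_mult_mat[OF carrier_A[OF \<rho>] W B])
  also have "p \<rho> \<cdot>\<^sub>m (?c \<cdot>\<^sub>m (word_mat n A (s @ [\<rho>]) * ?B) + 0\<^sub>m n q) =
      word_weight p (\<sigma> # s @ [\<rho>]) \<cdot>\<^sub>m (word_mat n A (s @ [\<rho>]) * ?B)"
  proof -
    have "word_mat n A (s @ [\<rho>]) * ?B \<in> carrier_mat n q"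
      by (rule mult_carrier_mat[OF word_mat_carrier[OF carrier_A snoc.prems] B])
    then show ?thesis by (intro eq_matI) auto
  qed
  finally show ?case .
qed

lemma lag_corr_output_word:
  assumes e: "innovation_process M n\<^sub>\<mu> \<mu> p q y e" and \<sigma>: "\<sigma> \<in> {1..n\<^sub>\<mu>}" and s: "s \<in> words n\<^sub>\<mu>"
  shows "lag_corr M \<mu> \<tau> q q y e (\<sigma> # s) =
    word_weight p (\<sigma> # s) \<cdot>\<^sub>m (C * word_mat n A s * input_corr e \<tau> \<sigma>)"
proof -
  let ?c = "word_weight p (\<sigma> # s)" and ?W = "word_mat n A s" and ?B = "input_corr e \<tau> \<sigma>"
  have W: "?W \<in> carrier_mat n n" by (rule word_mat_carrier[OF carrier_A s])
  note B = input_corr_carrier[OF \<sigma>, of e \<tau>]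
  have w: "\<sigma> # s \<in> words n\<^sub>\<mu>" and ne: "\<sigma> # s \<in> nonempty_words n\<^sub>\<mu>"
    using \<sigma> s by (auto simp: nonempty_words_def)
  have "lag_corr M \<mu> \<tau> q q y e (\<sigma> # s) = C * (?c \<cdot>\<^sub>m (?W * ?B)) + F * 0\<^sub>m m q"
    by (simp only: lag_corr_output[OF e w] lag_corr_state_word[OF e \<sigma> s] noise_orthogonal_innovation[OF e ne])
  also have "C * (?c \<cdot>\<^sub>m (?W * ?B)) = ?c \<cdot>\<^sub>m (C * (?W * ?B))"
    by (rule mult_smult_distrib[OF carrier_C mult_carrier_mat[OF W B]])
  also have "C * (?W * ?B) = C * ?W * ?B"
    by (rule assoc_mult_mat[OF carrier_C W B, symmetric])
  also have "F * 0\<^sub>m m q = 0\<^sub>m q q"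
    by (rule right_mult_zero_mat[OF carrier_F])
  also have "?c \<cdot>\<^sub>m (C * ?W * ?B) + 0\<^sub>m q q = ?c \<cdot>\<^sub>m (C * ?W * ?B)"
    using mult_carrier_mat[OF mult_carrier_mat[OF carrier_C W] B] by (intro right_add_zero_mat) simp
  finally show ?thesis .
qed

lemma state_noise_uncorrelated:
  assumes \<sigma>: "\<sigma> \<in> {1..n\<^sub>\<mu>}" and a: "a < n" and b: "b < m"
  shows "(\<integral>\<omega>. x t \<omega> $ a * v t \<omega> $ b \<partial>M) = 0"
proof -
  have "0 = corr_mat M n m (zproc \<mu> p x [\<sigma>] (t + 1)) (zproc \<mu> p v [\<sigma>] (t + 1)) $$ (a, b)"
    using ssa_xv[OF \<sigma>, of "t + 1"] a b by simp
  also have "\<dots> = (\<integral>\<omega>. zproc \<mu> p x [\<sigma>] (t + 1) \<omega> $ a * zproc \<mu> p v [\<sigma>] (t + 1) \<omega> $ b \<partial>M)"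
    using a b by (simp add: corr_mat_def)
  also have "\<dots> = (\<integral>\<omega>. 1 / p \<sigma> * ((x t \<omega> $ a * \<mu> \<sigma> t \<omega>) * (v t \<omega> $ b * \<mu> \<sigma> t \<omega>)) \<partial>M)"
  proof (rule Bochner_Integration.integral_cong[OF refl])
    fix \<omega> assume \<omega>: "\<omega> \<in> space M"
    have "zproc \<mu> p x [\<sigma>] (t + 1) \<omega> $ a = 1 / sqrt (p \<sigma>) * (x t \<omega> $ a * \<mu> \<sigma> t \<omega>)"
      using zproc_index[of x "t + 1" "[\<sigma>]" \<omega> n a] carrier_x[OF \<omega>, of t] a by simp
    moreover have "zproc \<mu> p v [\<sigma>] (t + 1) \<omega> $ b = 1 / sqrt (p \<sigma>) * (v t \<omega> $ b * \<mu> \<sigma> t \<omega>)"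
      using zproc_index[of v "t + 1" "[\<sigma>]" \<omega> m b] carrier_v[OF \<omega>, of t] b by simp
    moreover have "(1 / sqrt (p \<sigma>) * X) * (1 / sqrt (p \<sigma>) * Y) = 1 / p \<sigma> * (X * Y)" for X Y
      using p_pos[OF \<sigma>] by (simp add: field_simps)
    ultimately show "zproc \<mu> p x [\<sigma>] (t + 1) \<omega> $ a * zproc \<mu> p v [\<sigma>] (t + 1) \<omega> $ b =
        1 / p \<sigma> * ((x t \<omega> $ a * \<mu> \<sigma> t \<omega>) * (v t \<omega> $ b * \<mu> \<sigma> t \<omega>))"
      by simp
  qed
  also have "\<dots> = 1 / p \<sigma> * (\<integral>\<omega>. (x t \<omega> $ a * \<mu> \<sigma> t \<omega>) * (v t \<omega> $ b * \<mu> \<sigma> t \<omega>) \<partial>M)"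
    by (rule integral_mult_right_zero)
  also have "\<dots> = (\<integral>\<omega>. x t \<omega> $ a * v t \<omega> $ b \<partial>M)"
    using mult_letter_inner[OF \<sigma> \<sigma> x_adapted[OF a] v_adapted[OF b]] p_pos[OF \<sigma>] by simp
  finally show ?thesis by simp
qed

end

text \<open>
  An empty alphabet would turn the relation \<open>\<Sum>\<^sub>\<sigma> \<alpha>\<^sub>\<sigma> \<mu>\<^sub>\<sigma>(t) = 1\<close> into \<open>0 = 1\<close>.
\<close>

lemma (in prob_space) admissible_letters_exist:
  assumes "admissible_scheduling M n\<^sub>\<mu> \<mu> p"
  shows "1 \<in> {1..n\<^sub>\<mu>}"
proof (rule ccontr)
  assume "1 \<notin> {1..n\<^sub>\<mu>}"
  then have "{1..n\<^sub>\<mu>} = {}" by auto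
  then have "AE \<omega> in M. False"
    using admissible_affine[OF assms] by simp
  then show False by simp
qed

section \<open>Realizations in innovation form\<close>

text \<open>
  Two versions of the innovation occur: the noise \<open>v\<close> of the realization, and the version \<open>e\<close> supplied
  by the full rank condition. They agree almost surely.
\<close>

locale lpv_innovation_form = lpv_realization M n\<^sub>\<mu> \<mu> p n q q A K C "1\<^sub>m q" x v y
  for M :: "'a measure" and n\<^sub>\<mu> \<mu> p n q A K C x v y +
  fixes e :: "'a vproc"
  assumes v_innovation: "innovation_process M n\<^sub>\<mu> \<mu> p q y v"
    and e_innovation: "innovation_process M n\<^sub>\<mu> \<mu> p q y e"
begin

lemma input_corr_innovation_form:
  assumes \<sigma>: "\<sigma> \<in> {1..n\<^sub>\<mu>}"
  shows "input_corr e \<tau> \<sigma> = K \<sigma> * lag_corr M \<mu> \<tau> q q v e []"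
proof -
  have "lag_corr M \<mu> \<tau> n q x e [] = 0\<^sub>m n q"
  proof (rule eq_matI)
    fix a b assume "a < dim_row (0\<^sub>m n q :: real mat)" "b < dim_col (0\<^sub>m n q :: real mat)"
    then have a: "a < n" and b: "b < q" by auto
    have "(\<integral>\<omega>. x \<tau> \<omega> $ a * e \<tau> \<omega> $ b \<partial>M) = (\<integral>\<omega>. x \<tau> \<omega> $ a * v \<tau> \<omega> $ b \<partial>M)"
    proof (rule integral_cong_AE)
      show "AE \<omega> in M. x \<tau> \<omega> $ a * e \<tau> \<omega> $ b = x \<tau> \<omega> $ a * v \<tau> \<omega> $ b"
        using innovation_unique[OF e_innovation v_innovation b, of \<tau>] by eventually_elim simp
    qed (intro borel_measurable_times borel_x[OF a] borel_v[OF b]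
        L2D(1)[OF L2_adaptedD[OF innovation_adapted[OF e_innovation b]]])+
    then show "lag_corr M \<mu> \<tau> n q x e [] $$ (a, b) = 0\<^sub>m n q $$ (a, b)"
      using a b state_noise_uncorrelated[OF \<sigma> a b, of \<tau>] by (simp add: lag_corr_index)
  qed (simp_all add: lag_corr_def)
  then show ?thesis
    unfolding input_corr_def
    using right_mult_zero_mat[OF carrier_A[OF \<sigma>], of q] carrier_K[OF \<sigma>]
    by (simp add: left_add_zero_mat[OF mult_carrier_mat[OF carrier_K[OF \<sigma>] lag_corr_carrier]])
qed

text \<open>
  Conditioning on the past replaces \<open>\<mu>\<^sub>\<sigma>\<^sup>2\<close> by \<open>p\<^sub>\<sigma>\<close>, so the matrices of the full rank condition are
  multiples of one and the same covariance matrix.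
\<close>

lemma weighted_innovation_covariance:
  assumes \<sigma>: "\<sigma> \<in> {1..n\<^sub>\<mu>}"
  shows "mat q q (\<lambda>(a, b). \<integral>\<omega>. e \<tau> \<omega> $ a * e \<tau> \<omega> $ b * (\<mu> \<sigma> \<tau> \<omega>)\<^sup>2 \<partial>M) =
    p \<sigma> \<cdot>\<^sub>m lag_corr M \<mu> \<tau> q q v e []"
proof (rule eq_matI)
  fix a b
  assume "a < dim_row (p \<sigma> \<cdot>\<^sub>m lag_corr M \<mu> \<tau> q q v e [])"
    "b < dim_col (p \<sigma> \<cdot>\<^sub>m lag_corr M \<mu> \<tau> q q v e [])"
  then have a: "a < q" and b: "b < q" by (auto simp: lag_corr_def)
  note ad = innovation_adapted[OF e_innovation, of _ \<tau>]
  have "(\<integral>\<omega>. e \<tau> \<omega> $ a * e \<tau> \<omega> $ b * (\<mu> \<sigma> \<tau> \<omega>)\<^sup>2 \<partial>M) =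
      (\<integral>\<omega>. (e \<tau> \<omega> $ a * \<mu> \<sigma> \<tau> \<omega>) * (e \<tau> \<omega> $ b * \<mu> \<sigma> \<tau> \<omega>) \<partial>M)"
    by (simp add: power2_eq_square mult_ac)
  also have "\<dots> = p \<sigma> * (\<integral>\<omega>. e \<tau> \<omega> $ a * e \<tau> \<omega> $ b \<partial>M)"
    using mult_letter_inner[OF \<sigma> \<sigma> ad[OF a] ad[OF b]] by simp
  also have "(\<integral>\<omega>. e \<tau> \<omega> $ a * e \<tau> \<omega> $ b \<partial>M) = (\<integral>\<omega>. v \<tau> \<omega> $ a * e \<tau> \<omega> $ b \<partial>M)"
  proof (rule integral_cong_AE)
    show "AE \<omega> in M. e \<tau> \<omega> $ a * e \<tau> \<omega> $ b = v \<tau> \<omega> $ a * e \<tau> \<omega> $ b"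
      using innovation_unique[OF e_innovation v_innovation a, of \<tau>] by eventually_elim simp
  qed (intro borel_measurable_times borel_v[OF a] L2D(1)[OF L2_adaptedD[OF ad]] a b)+
  finally show "mat q q (\<lambda>(a, b). \<integral>\<omega>. e \<tau> \<omega> $ a * e \<tau> \<omega> $ b * (\<mu> \<sigma> \<tau> \<omega>)\<^sup>2 \<partial>M) $$ (a, b) =
      (p \<sigma> \<cdot>\<^sub>m lag_corr M \<mu> \<tau> q q v e []) $$ (a, b)"
    using a b by (simp add: lag_corr_index lag_corr_def[of M \<mu> \<tau> q q v e "[]"])
qed (simp_all add: lag_corr_def)

lemma innovation_covariance_right_inverse:
  assumes \<sigma>: "\<sigma> \<in> {1..n\<^sub>\<mu>}"
    and inv: "invertible_mat (mat q q (\<lambda>(a, b). \<integral>\<omega>. e \<tau> \<omega> $ a * e \<tau> \<omega> $ b * (\<mu> \<sigma> \<tau> \<omega>)\<^sup>2 \<partial>M))"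
  obtains R where "R \<in> carrier_mat q q" "lag_corr M \<mu> \<tau> q q v e [] * R = 1\<^sub>m q"
proof -
  let ?Q = "lag_corr M \<mu> \<tau> q q v e []"
  from inv obtain B where B: "p \<sigma> \<cdot>\<^sub>m ?Q * B = 1\<^sub>m q" "B * (p \<sigma> \<cdot>\<^sub>m ?Q) = 1\<^sub>m (dim_row B)"
    unfolding weighted_innovation_covariance[OF \<sigma>] invertible_mat_def inverts_mat_def
    by (auto simp: lag_corr_def)
  have "dim_col B = q" using arg_cong[OF B(1), of dim_col] by simp
  moreover have "dim_row B = q" using arg_cong[OF B(2), of dim_col] by (simp add: lag_corr_def)
  ultimately have Bc: "B \<in> carrier_mat q q" by auto
  then have "?Q * (p \<sigma> \<cdot>\<^sub>m B) = 1\<^sub>m q"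
    using B(1) mult_smult_distrib[OF lag_corr_carrier Bc] mult_smult_assoc_mat[OF lag_corr_carrier Bc]
    by metis
  then show thesis using that[of "p \<sigma> \<cdot>\<^sub>m B"] Bc by simp
qed

end

section \<open>Minimality\<close>

theorem corollary1:
  fixes M :: "'a measure"
    and n\<^sub>\<mu> n\<^sub>x n\<^sub>y :: nat
    and \<mu> :: "nat \<Rightarrow> int \<Rightarrow> 'a \<Rightarrow> real"
    and p :: "nat \<Rightarrow> real"
    and y v :: "int \<Rightarrow> 'a \<Rightarrow> real vec"
    and A K :: "nat \<Rightarrow> real mat"
    and C :: "real mat"
  assumes "prob_space M"
    and "admissible_scheduling M n\<^sub>\<mu> \<mu> p"
    and "vector_process M n\<^sub>y y"
    and "innovation_form M n\<^sub>\<mu> \<mu> p n\<^sub>y y n\<^sub>x n\<^sub>y A K C (1\<^sub>m n\<^sub>y) v"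
    and "full_rank M n\<^sub>\<mu> \<mu> p n\<^sub>y y"
    and "SII M n\<^sub>\<mu> \<mu> p n\<^sub>y y"
    and "dLPV_minimal n\<^sub>\<mu> n\<^sub>x n\<^sub>y n\<^sub>y A K C (1\<^sub>m n\<^sub>y)"
    and "stably_invertible n\<^sub>\<mu> p n\<^sub>x A K C"
  shows "minimal_asLPV_realization M n\<^sub>\<mu> \<mu> p n\<^sub>y y n\<^sub>x n\<^sub>y A K C (1\<^sub>m n\<^sub>y) v \<and>
         innovation_form M n\<^sub>\<mu> \<mu> p n\<^sub>y y n\<^sub>x n\<^sub>y A K C (1\<^sub>m n\<^sub>y) v"
proof -
  interpret prob_space M by (rule assms(1))
  note form = assms(4)[unfolded innovation_form_def]
  have real: "asLPV_realization M n\<^sub>\<mu> \<mu> p n\<^sub>y y n\<^sub>x n\<^sub>y A K C (1\<^sub>m n\<^sub>y) v"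
    and v: "innovation_process M n\<^sub>\<mu> \<mu> p n\<^sub>y y v"
    using form by simp_all
  obtain x where x: "asLPV_SSA M n\<^sub>\<mu> \<mu> p n\<^sub>x n\<^sub>y n\<^sub>y A K C (1\<^sub>m n\<^sub>y) x v y"
    using real unfolding asLPV_realization_def by blast
  obtain e where e: "innovation_process M n\<^sub>\<mu> \<mu> p n\<^sub>y y e"
    and inv: "\<And>i t. i \<in> {1..n\<^sub>\<mu>} \<Longrightarrow> invertible_mat
      (mat n\<^sub>y n\<^sub>y (\<lambda>(a, b). \<integral>\<omega>. e t \<omega> $ a * e t \<omega> $ b * (\<mu> i t \<omega>)\<^sup>2 \<partial>M))"
    using assms(5) unfolding full_rank_def by blast
  interpret S: lpv_innovation_form M n\<^sub>\<mu> \<mu> p n\<^sub>x n\<^sub>y A K C x v y e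
    by unfold_locales (fact assms(2) x v e)+
  define Q where "Q = lag_corr M \<mu> 0 n\<^sub>y n\<^sub>y v e []"
  have one: "1 \<in> {1..n\<^sub>\<mu>}" by (rule admissible_letters_exist[OF assms(2)])
  obtain R where R: "R \<in> carrier_mat n\<^sub>y n\<^sub>y" and QR: "Q * R = 1\<^sub>m n\<^sub>y"
    using S.innovation_covariance_right_inverse[OF one inv[OF one]] unfolding Q_def by blast
  have Q: "Q \<in> carrier_mat n\<^sub>y n\<^sub>y" unfolding Q_def by simp
  have False
    if r': "asLPV_realization M n\<^sub>\<mu> \<mu> p n\<^sub>y y n' m' A' K' C' F' v'" and less: "n' < n\<^sub>x"
    for n' m' A' K' C' F' v'
  proof -
    obtain x' where x': "asLPV_SSA M n\<^sub>\<mu> \<mu> p n' m' n\<^sub>y A' K' C' F' x' v' y"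
      using r' unfolding asLPV_realization_def by blast
    interpret S': lpv_realization M n\<^sub>\<mu> \<mu> p n' m' n\<^sub>y A' K' C' F' x' v' y
      by unfold_locales (fact assms(2) x')+
    \<comment> \<open>The input matrices of the deterministic competitor of dimension \<open>n'\<close>.\<close>
    define K'' where "K'' = (\<lambda>\<sigma>. S'.input_corr e 0 \<sigma> * R)"
    have K'': "K'' \<sigma> \<in> carrier_mat n' n\<^sub>y" if "\<sigma> \<in> {1..n\<^sub>\<mu>}" for \<sigma>
      unfolding K''_def by (rule mult_carrier_mat[OF S'.input_corr_carrier[OF that] R])
    have "lpv_matrices n\<^sub>\<mu> n' n\<^sub>y n\<^sub>y A' K'' C' (1\<^sub>m n\<^sub>y)"
      using S'.carrier_A S'.carrier_C K'' by (simp add: lpv_matrices_def)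
    moreover have "sub_markov n' A' K'' C' (1\<^sub>m n\<^sub>y) w = sub_markov n\<^sub>x A K C (1\<^sub>m n\<^sub>y) w"
      if w: "w \<in> words n\<^sub>\<mu>" for w
    proof (cases w)
      case (Cons \<sigma> s)
      then have \<sigma>: "\<sigma> \<in> {1..n\<^sub>\<mu>}" and s: "s \<in> words n\<^sub>\<mu>" using w by auto
      let ?W = "word_mat n\<^sub>x A s" and ?W' = "word_mat n' A' s" and ?B = "S'.input_corr e 0 \<sigma>"
      have CW: "C * ?W \<in> carrier_mat n\<^sub>y n\<^sub>x"
        by (rule mult_carrier_mat[OF S.carrier_C word_mat_carrier[OF S.carrier_A s]])
      have CW': "C' * ?W' \<in> carrier_mat n\<^sub>y n'"
        by (rule mult_carrier_mat[OF S'.carrier_C word_mat_carrier[OF S'.carrier_A s]])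
      have "word_weight p (\<sigma> # s) \<noteq> 0"
        using word_weight_pos[of n\<^sub>\<mu> p w] S.p_pos w Cons by (metis less_irrefl)
      moreover have "word_weight p (\<sigma> # s) \<cdot>\<^sub>m (C' * ?W' * ?B) =
          word_weight p (\<sigma> # s) \<cdot>\<^sub>m (C * ?W * (K \<sigma> * Q))"
        using S.lag_corr_output_word[OF e \<sigma> s, of 0] S'.lag_corr_output_word[OF e \<sigma> s, of 0]
        by (simp only: S.input_corr_innovation_form[OF \<sigma>] Q_def)
      ultimately have eq: "C' * ?W' * ?B = C * ?W * (K \<sigma> * Q)"
        by (rule smult_mat_cancel)
      have "sub_markov n' A' K'' C' (1\<^sub>m n\<^sub>y) w = C' * ?W' * (?B * R)"
        by (simp add: Cons K''_def)
      also have "\<dots> = C' * ?W' * ?B * R"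
        by (rule assoc_mult_mat[OF CW' S'.input_corr_carrier[OF \<sigma>] R, symmetric])
      also have "\<dots> = C * ?W * (K \<sigma> * Q * R)"
        unfolding eq by (rule assoc_mult_mat[OF CW mult_carrier_mat[OF S.carrier_K[OF \<sigma>] Q] R])
      also have "K \<sigma> * Q * R = K \<sigma>"
        unfolding assoc_mult_mat[OF S.carrier_K[OF \<sigma>] Q R] QR
        by (rule right_mult_one_mat[OF S.carrier_K[OF \<sigma>]])
      finally show ?thesis by (simp add: Cons)
    qed simp
    ultimately show False
      using assms(7) less unfolding dLPV_minimal_def by blast
  qed
  then show ?thesis
    using real assms(4) unfolding minimal_asLPV_realization_def by blast
qed

end
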